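(* Let $n\geq 2$, $1\leq p\leq\infty$, $0<s<1$ with $sp<n$, $p^*_s:=\frac{np}{n-sp}$, and $1\leq q\leq r<p^*_s$. Let $K,V:\mathbf{R}^n\to\mathbf{R}$ be two positive Lebesgue measurable functions such that $\inf_{\mathbf{D}}V>0$ for every compact subset $\mathbf{D}\subset\mathbf{R}^n$, such that for some $t\in\bigl(\frac{p^*_s}{p^*_s-r},\infty\bigr]$ one has $K\in L^t(\Omega)$ for each measurable set $\Omega\subset\mathbf{R}^n$ with $\mathfrak{L}(\Omega)<\infty$, and such that $KV^{-\tau}$ vanishes at infinity for $\tau:=\frac{p^*_s-r}{p^*_s-q}$. Then the embedding $M^{s;q,p}_{\mathrm V}(\mathbf{R}^n)\to L^r_{\mathrm K}(\mathbf{R}^n)$ is compact.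
   Context: $\mathfrak{L}$ denotes Lebesgue measure on $\mathbf{R}^n$. A function $f\in L^1_{loc}(\mathbf{R}^n)$ is said to vanish at infinity if $\mathfrak{L}(\{x\in\mathbf{R}^n:|f(x)|\geq c\})<\infty$ for every constant $c>0$. When $sp<n$, $M^{s;q,p}_{\mathrm V}(\mathbf{R}^n)$ is the Banach space obtained as the completion of (the functions of finite norm in) $C^1_c(\mathbf{R}^n)$ with respect to the norm $$\|u\|_{M^{s;q,p}_{\mathrm V}(\mathbf{R}^n)}:=\Bigl(\int_{\mathbf{R}^n}|u|^qV\,dx\Bigr)^{1/q}+[u]_{s,p,\mathbf{R}^n},\qquad [u]^p_{s,p,\mathbf{R}^n}:=\int_{\mathbf{R}^n}\int_{\mathbf{R}^n}\frac{|u(x)-u(y)|^p}{|x-y|^{n+sp}}\,dx\,dy;$$ it is a subspace of $D^{s,p}(\mathbf{R}^n)$, the completion of $C^1_c(\mathbf{R}^n)$ with respect to $[\cdot]_{s,p,\mathbf{R}^n}$. $L^r_{\mathrm K}(\mathbf{R}^n)$ is the weighted Lebesgue space with norm $\bigl(\int_{\mathbf{R}^n}|u|^rK\,dx\bigr)^{1/r}$. *)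

theory Defs
  imports "HOL-Analysis.Analysis"
begin

definition C1_c :: "(real^'n \<Rightarrow> real) set" where
  "C1_c = {u. (\<exists>u'. (\<forall>x. GDERIV u x :> u' x) \<and> continuous_on UNIV u') \<and>
              compact (closure {x. u x \<noteq> 0})}"

text \<open>
  Integrals of nonnegative functions take values in \<open>[0, \<infinity>]\<close>. The real-valued (semi)norms derived
  from them use \<^const>\<open>enn2real\<close>, which sends \<open>\<infinity>\<close> to \<open>0\<close>; they are meaningful only on the spaces below,
  where the integrals are required to be finite.
\<close>

definition weighted_integral :: "real \<Rightarrow> (real^'n \<Rightarrow> real) \<Rightarrow> (real^'n \<Rightarrow> real) \<Rightarrow> ennreal" where
  "weighted_integral q w u = (\<integral>\<^sup>+x. ennreal (\<bar>u x\<bar> powr q * w x) \<partial>lebesgue)"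

definition weighted_norm :: "real \<Rightarrow> (real^'n \<Rightarrow> real) \<Rightarrow> (real^'n \<Rightarrow> real) \<Rightarrow> real" where
  "weighted_norm q w u = enn2real (weighted_integral q w u) powr (1 / q)"

text \<open>The elements of \<open>weighted_Lp r K\<close> are functions; identification up to null sets is
  expressed by \<open>AE\<close> in the formulas below.\<close>

definition weighted_Lp :: "real \<Rightarrow> (real^'n \<Rightarrow> real) \<Rightarrow> (real^'n \<Rightarrow> real) set" where
  "weighted_Lp r K = {f \<in> borel_measurable lebesgue. weighted_integral r K f < \<infinity>}"

text \<open>On the diagonal the integrand is \<open>0 / 0 = 0\<close>; the diagonal is a null set.\<close>

definition gagliardo_integral :: "real \<Rightarrow> real \<Rightarrow> (real^'n \<Rightarrow> real) \<Rightarrow> ennreal" where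
  "gagliardo_integral s p u =
     (\<integral>\<^sup>+y. (\<integral>\<^sup>+x. ennreal (\<bar>u x - u y\<bar> powr p / norm (x - y) powr (real CARD('n) + s * p))
        \<partial>lebesgue) \<partial>lebesgue)"

definition gagliardo_seminorm :: "real \<Rightarrow> real \<Rightarrow> (real^'n \<Rightarrow> real) \<Rightarrow> real" where
  "gagliardo_seminorm s p u = enn2real (gagliardo_integral s p u) powr (1 / p)"

definition MV_norm :: "real \<Rightarrow> real \<Rightarrow> real \<Rightarrow> (real^'n \<Rightarrow> real) \<Rightarrow> (real^'n \<Rightarrow> real) \<Rightarrow> real" where
  "MV_norm s q p V u = weighted_norm q V u + gagliardo_seminorm s p u"

definition MV_core :: "real \<Rightarrow> real \<Rightarrow> real \<Rightarrow> (real^'n \<Rightarrow> real) \<Rightarrow> (real^'n \<Rightarrow> real) set" where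
  "MV_core s q p V =
     {u \<in> C1_c. weighted_integral q V u < \<infinity> \<and> gagliardo_integral s p u < \<infinity>}"

text \<open>
  The completion of a space \<open>X\<close> of functions (closed under linear combinations) with respect to a
  norm \<open>N\<close>: Cauchy sequences in \<open>X\<close> modulo sequences converging to zero in norm.
\<close>

definition cauchy_seqs :: "('a \<Rightarrow> real) set \<Rightarrow> (('a \<Rightarrow> real) \<Rightarrow> real) \<Rightarrow> (nat \<Rightarrow> 'a \<Rightarrow> real) set" where
  "cauchy_seqs X N = {\<sigma>. (\<forall>k. \<sigma> k \<in> X) \<and>
     (\<forall>\<epsilon>>0. \<exists>m. \<forall>j\<ge>m. \<forall>k\<ge>m. N (\<lambda>x. \<sigma> j x - \<sigma> k x) < \<epsilon>)}"

definition cauchy_rel ::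
  "('a \<Rightarrow> real) set \<Rightarrow> (('a \<Rightarrow> real) \<Rightarrow> real) \<Rightarrow> ((nat \<Rightarrow> 'a \<Rightarrow> real) \<times> (nat \<Rightarrow> 'a \<Rightarrow> real)) set" where
  "cauchy_rel X N = {(\<sigma>, \<rho>). \<sigma> \<in> cauchy_seqs X N \<and> \<rho> \<in> cauchy_seqs X N \<and>
     (\<lambda>k. N (\<lambda>x. \<sigma> k x - \<rho> k x)) \<longlonglongrightarrow> 0}"

definition cauchy_class ::
  "('a \<Rightarrow> real) set \<Rightarrow> (('a \<Rightarrow> real) \<Rightarrow> real) \<Rightarrow> (nat \<Rightarrow> 'a \<Rightarrow> real) \<Rightarrow> (nat \<Rightarrow> 'a \<Rightarrow> real) set" where
  "cauchy_class X N \<sigma> = cauchy_rel X N `` {\<sigma>}"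

definition norm_completion ::
  "('a \<Rightarrow> real) set \<Rightarrow> (('a \<Rightarrow> real) \<Rightarrow> real) \<Rightarrow> (nat \<Rightarrow> 'a \<Rightarrow> real) set set" where
  "norm_completion X N = cauchy_seqs X N // cauchy_rel X N"

definition completion_norm ::
  "(('a \<Rightarrow> real) \<Rightarrow> real) \<Rightarrow> (nat \<Rightarrow> 'a \<Rightarrow> real) set \<Rightarrow> real" where
  "completion_norm N \<xi> = lim (\<lambda>k. N ((SOME \<sigma>. \<sigma> \<in> \<xi>) k))"

text \<open>
  \<open>J\<close> is the embedding of the completion of \<open>(X, N)\<close> into the weighted Lebesgue space: a bounded
  injective linear map extending the inclusion of \<open>X\<close>. Since \<open>X\<close> is dense in its completion, these
  conditions determine \<open>J\<close> up to null sets. Linear combinations in the completion are formed on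
  representatives.
\<close>

definition is_embedding ::
  "(real^'n \<Rightarrow> real) set \<Rightarrow> ((real^'n \<Rightarrow> real) \<Rightarrow> real) \<Rightarrow> real \<Rightarrow> (real^'n \<Rightarrow> real) \<Rightarrow>
   ((nat \<Rightarrow> real^'n \<Rightarrow> real) set \<Rightarrow> real^'n \<Rightarrow> real) \<Rightarrow> bool" where
  "is_embedding X N r K J \<longleftrightarrow>
     (\<forall>\<xi>\<in>norm_completion X N. J \<xi> \<in> weighted_Lp r K) \<and>
     (\<forall>u\<in>X. AE x in lebesgue. J (cauchy_class X N (\<lambda>k. u)) x = u x) \<and>
     (\<forall>\<sigma>\<in>cauchy_seqs X N. \<forall>\<rho>\<in>cauchy_seqs X N. \<forall>a b. AE x in lebesgue.
        J (cauchy_class X N (\<lambda>k y. a * \<sigma> k y + b * \<rho> k y)) x =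
        a * J (cauchy_class X N \<sigma>) x + b * J (cauchy_class X N \<rho>) x) \<and>
     (\<forall>\<xi>\<in>norm_completion X N. \<forall>\<eta>\<in>norm_completion X N.
        (AE x in lebesgue. J \<xi> x = J \<eta> x) \<longrightarrow> \<xi> = \<eta>) \<and>
     (\<exists>C. \<forall>\<xi>\<in>norm_completion X N. weighted_norm r K (J \<xi>) \<le> C * completion_norm N \<xi>)"

definition is_compact_map ::
  "(real^'n \<Rightarrow> real) set \<Rightarrow> ((real^'n \<Rightarrow> real) \<Rightarrow> real) \<Rightarrow> real \<Rightarrow> (real^'n \<Rightarrow> real) \<Rightarrow>
   ((nat \<Rightarrow> real^'n \<Rightarrow> real) set \<Rightarrow> real^'n \<Rightarrow> real) \<Rightarrow> bool" where
  "is_compact_map X N r K J \<longleftrightarrow>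
     (\<forall>\<xi>. (\<forall>k. \<xi> k \<in> norm_completion X N) \<and> (\<exists>B. \<forall>k::nat. completion_norm N (\<xi> k) \<le> B) \<longrightarrow>
        (\<exists>\<kappa>::nat \<Rightarrow> nat. strict_mono \<kappa> \<and>
           (\<exists>w\<in>weighted_Lp r K. (\<lambda>j. weighted_norm r K (\<lambda>x. J (\<xi> (\<kappa> j)) x - w x)) \<longlonglongrightarrow> 0)))"

definition compactly_embedded ::
  "(real^'n \<Rightarrow> real) set \<Rightarrow> ((real^'n \<Rightarrow> real) \<Rightarrow> real) \<Rightarrow> real \<Rightarrow> (real^'n \<Rightarrow> real) \<Rightarrow> bool" where
  "compactly_embedded X N r K \<longleftrightarrow> (\<exists>J. is_embedding X N r K J \<and> is_compact_map X N r K J)"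

definition Lp_on :: "ennreal \<Rightarrow> (real^'n) set \<Rightarrow> (real^'n \<Rightarrow> real) set" where
  "Lp_on t \<Omega> = {f \<in> borel_measurable (lebesgue_on \<Omega>).
     if t = \<infinity> then \<exists>C. AE x in lebesgue_on \<Omega>. \<bar>f x\<bar> \<le> C
     else (\<integral>\<^sup>+x. ennreal (\<bar>f x\<bar> powr enn2real t) \<partial>lebesgue_on \<Omega>) < \<infinity>}"

definition locally_integrable :: "(real^'n \<Rightarrow> real) \<Rightarrow> bool" where
  "locally_integrable f \<longleftrightarrow> (\<forall>D. compact D \<longrightarrow> f absolutely_integrable_on D)"

definition vanishes_at_infinity :: "(real^'n \<Rightarrow> real) \<Rightarrow> bool" where
  "vanishes_at_infinity f \<longleftrightarrow> locally_integrable f \<and>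
     (\<forall>c>0. emeasure lebesgue {x. \<bar>f x\<bar> \<ge> c} < \<infinity>)"

end

theory Submission
  imports Defs "HOL-Complex_Analysis.Great_Picard"
begin

text \<open>
  Write \<open>P\<close> for the critical exponent. Comparing a function with its averages over cubes yields both the
  fractional Sobolev inequality and, by a diagonal argument over the countably many averages, an almost
  everywhere convergent subsequence of every sequence bounded in the Gagliardo seminorm and in \<open>L^P\<close>.
  For each \<open>\<epsilon> > 0\<close> there is an integrable \<open>h\<close> with
  \<open>\<bar>t\<bar>^r K \<le> \<epsilon> (\<bar>t\<bar>^q V + \<bar>t\<bar>^P) + h\<close>, so along that subsequence the differences \<open>w\<close> to the limit satisfy
  \<open>\<bar>w\<bar>^r K \<le> \<epsilon> (\<bar>w\<bar>^q V + \<bar>w\<bar>^P) + min (\<bar>w\<bar>^r K) h\<close>, and dominated convergence applies to the last term.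
  This gives compactness on the dense subspace; Fatou's lemma shows that the norm is closable with respect
  to \<open>L^r_K\<close>, so that the extension to the completion is injective.
\<close>

section \<open>Weighted Lebesgue norms\<close>

text \<open>An element of the completion is a class of Cauchy sequences, not a function: the
  embedding has to be built as an L^r_K limit, and its injectivity is a statement about the norm.
  All analysis is done on \<open>C1_c\<close>, where the L^P norm is finite from the start. The
  Sobolev proof depends on this, since its integrated bound carries a power of the same L^P norm on
  the right. The exponents of the hypotheses are those of two Young inequalities. The number \<tau>
  solves q \<tau> + P (1 - \<tau>) = r, so K \<le> \<epsilon> V^\<tau> places |t|^r K between |t|^q
  V and |t|^P. Where this fails, Young against |t|^P leaves K^(P/(P-r)), which explains the lower
  bound on the Lebesgue exponent of K. The remainder h is integrable but not small, so there only
  pointwise convergence helps. Cubes supply it: averaging at scale 1/m has an L^p error O(m^(-s)),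
  uniformly over a Gagliardo-bounded family, while at a fixed scale an average is a function on a
  countable lattice.\<close>

lemma powr_add_le_two_powr:
  fixes a b q :: real
  assumes "0 \<le> q"
  shows "\<bar>a + b\<bar> powr q \<le> 2 powr q * (\<bar>a\<bar> powr q + \<bar>b\<bar> powr q)"
proof -
  have "\<bar>a + b\<bar> \<le> 2 * max \<bar>a\<bar> \<bar>b\<bar>" by linarith
  then have "\<bar>a + b\<bar> powr q \<le> (2 * max \<bar>a\<bar> \<bar>b\<bar>) powr q"
    using assms by (intro powr_mono2) auto
  also have "\<dots> = 2 powr q * max \<bar>a\<bar> \<bar>b\<bar> powr q"
    by (subst powr_mult) auto
  also have "\<dots> \<le> 2 powr q * (\<bar>a\<bar> powr q + \<bar>b\<bar> powr q)"
    by (intro mult_left_mono) (auto simp: max_def)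
  finally show ?thesis .
qed

text \<open>Convexity of x^q at the points x / a and y / b with weights a / (a + b) and b / (a + b).
  In \<open>Lp_integral_Minkowski\<close> a and b bound the two norms, and these weights make the
  integrated right-hand side at most (a + b)^q.\<close>

lemma powr_add_le_convex:
  fixes x y a b q :: real
  assumes "1 \<le> q" "0 < a" "0 < b" "0 \<le> x" "0 \<le> y"
  shows "(x + y) powr q \<le> (a + b) powr q * ((a / (a + b)) * (x / a) powr q + (b / (a + b)) * (y / b) powr q)"
proof -
  have conv: "convex_on {0..} (\<lambda>x::real. x powr q)"
  proof (intro convex_onI)
    fix t u v :: real
    assume t: "0 < t" "t < 1" and uv: "u \<in> {0..}" "v \<in> {0..}"
    show "((1 - t) *\<^sub>R u + t *\<^sub>R v) powr q \<le> (1 - t) * u powr q + t * v powr q"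
    proof (cases "u = 0 \<or> v = 0")
      case False
      then show ?thesis
        using convex_onD[OF powr_convex[OF assms(1)], of t u v] t uv by auto
    next
      case True
      \<comment> \<open>If one of u and v is 0, the claim reduces to c^q \<le> c for the weight c of
        the other one.\<close>
      have "c powr q \<le> c" if "0 < c" "c < 1" for c :: real
        using that powr_mono'[of 1 q c] assms(1) by simp
      moreover have "0 \<le> u powr q" "0 \<le> v powr q" by auto
      ultimately show ?thesis using True t uv
        by (auto simp: powr_mult intro!: mult_right_mono)
    qed
  qed auto
  have eq: "x + y = (a + b) * ((1 - b / (a + b)) * (x / a) + (b / (a + b)) * (y / b))"
  proof -
    have "1 - b / (a + b) = a / (a + b)" using assms by (simp add: field_simps)
    then have "(1 - b / (a + b)) * (x / a) + (b / (a + b)) * (y / b) = (x + y) / (a + b)"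
      using assms by (simp add: add_divide_distrib)
    then show ?thesis using assms by simp
  qed
  have 1: "1 - b / (a + b) = a / (a + b)" using assms by (simp add: field_simps)
  have "(x + y) powr q = (a + b) powr q * ((1 - b / (a + b)) * (x / a) + (b / (a + b)) * (y / b)) powr q"
    unfolding 1 by (subst eq, subst powr_mult) (use assms in \<open>auto simp: 1\<close>)
  also have "\<dots> \<le> (a + b) powr q * ((1 - b / (a + b)) * (x / a) powr q + (b / (a + b)) * (y / b) powr q)"
    using convex_onD[OF conv, of "b / (a + b)" "x / a" "y / b"] assms
    by (intro mult_left_mono) auto
  finally show ?thesis unfolding 1 .
qed

text \<open>The measure is a parameter because one calculus serves Lebesgue measure with the weights
  K, V and 1 and, for the Gagliardo seminorm, the product measure on pairs of points.\<close>

definition Lp_integral :: "'a measure \<Rightarrow> real \<Rightarrow> ('a \<Rightarrow> real) \<Rightarrow> ('a \<Rightarrow> real) \<Rightarrow> ennreal" where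
  "Lp_integral M q w f = (\<integral>\<^sup>+x. ennreal (\<bar>f x\<bar> powr q * w x) \<partial>M)"

definition Lp_norm :: "'a measure \<Rightarrow> real \<Rightarrow> ('a \<Rightarrow> real) \<Rightarrow> ('a \<Rightarrow> real) \<Rightarrow> real" where
  "Lp_norm M q w f = enn2real (Lp_integral M q w f) powr (1 / q)"

locale weighted_measure =
  fixes M :: "'a measure" and q :: real and w :: "'a \<Rightarrow> real"
  assumes q_ge_1: "1 \<le> q"
    and weight_measurable [measurable]: "w \<in> borel_measurable M"
    and weight_nonneg: "0 \<le> w x"
begin

lemma Lp_integral_add_le:
  assumes [measurable]: "f \<in> borel_measurable M" "g \<in> borel_measurable M"
  shows "Lp_integral M q w (\<lambda>x. f x + g x)
    \<le> ennreal (2 powr q) * (Lp_integral M q w f + Lp_integral M q w g)"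
proof -
  have "Lp_integral M q w (\<lambda>x. f x + g x) \<le>
    (\<integral>\<^sup>+x. ennreal (2 powr q) * (ennreal (\<bar>f x\<bar> powr q * w x) + ennreal (\<bar>g x\<bar> powr q * w x)) \<partial>M)"
    unfolding Lp_integral_def
  proof (intro nn_integral_mono)
    fix x
    have "\<bar>f x + g x\<bar> powr q * w x \<le> 2 powr q * (\<bar>f x\<bar> powr q + \<bar>g x\<bar> powr q) * w x"
      using powr_add_le_two_powr[of q "f x" "g x"] q_ge_1 weight_nonneg[of x]
      by (intro mult_right_mono) auto
    also have "\<dots> = 2 powr q * (\<bar>f x\<bar> powr q * w x + \<bar>g x\<bar> powr q * w x)"
      by (simp add: algebra_simps)
    finally show "ennreal (\<bar>f x + g x\<bar> powr q * w x) \<le>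
      ennreal (2 powr q) * (ennreal (\<bar>f x\<bar> powr q * w x) + ennreal (\<bar>g x\<bar> powr q * w x))"
      using weight_nonneg[of x] by (simp add: ennreal_leI flip: ennreal_plus ennreal_mult)
  qed
  also have "\<dots> = ennreal (2 powr q) * (Lp_integral M q w f + Lp_integral M q w g)"
    unfolding Lp_integral_def by (subst nn_integral_cmult) (auto simp: nn_integral_add)
  finally show ?thesis .
qed

lemma Lp_integral_scale:
  assumes [measurable]: "f \<in> borel_measurable M"
  shows "Lp_integral M q w (\<lambda>x. a * f x) = ennreal (\<bar>a\<bar> powr q) * Lp_integral M q w f"
  unfolding Lp_integral_def
  by (subst nn_integral_cmult[symmetric])
     (auto intro!: nn_integral_cong simp: abs_mult powr_mult weight_nonneg mult.assoc simp flip: ennreal_mult)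

lemma Lp_integral_uminus: "Lp_integral M q w (\<lambda>x. - f x) = Lp_integral M q w f"
  by (simp add: Lp_integral_def)

lemma Lp_integral_eq_norm:
  assumes "Lp_integral M q w f < \<infinity>"
  shows "Lp_integral M q w f = ennreal (Lp_norm M q w f powr q)"
  using assms q_ge_1 by (auto simp: Lp_norm_def powr_powr)

lemma Lp_norm_nonneg: "0 \<le> Lp_norm M q w f"
  by (simp add: Lp_norm_def)

lemma Lp_norm_le:
  assumes "Lp_integral M q w f \<le> ennreal (a powr q)" "0 \<le> a"
  shows "Lp_norm M q w f \<le> a"
proof -
  have "enn2real (Lp_integral M q w f) \<le> a powr q"
    using assms(1) by (simp add: enn2real_leI)
  then have "Lp_norm M q w f \<le> (a powr q) powr (1 / q)"
    unfolding Lp_norm_def using q_ge_1 by (intro powr_mono2) auto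
  then show ?thesis using assms(2) q_ge_1 by (simp add: powr_powr)
qed

text \<open>Finiteness has to be assumed because \<open>Lp_norm\<close> is 0 when the integral is
  infinite; in \<open>Lp_norm_le\<close> it is part of the bound.\<close>

lemma Lp_integral_le:
  assumes "Lp_integral M q w f < \<infinity>" "Lp_norm M q w f \<le> a"
  shows "Lp_integral M q w f \<le> ennreal (a powr q)"
  unfolding Lp_integral_eq_norm[OF assms(1)]
  using assms(2) q_ge_1 Lp_norm_nonneg by (intro ennreal_leI powr_mono2) auto

lemma Lp_norm_scale:
  assumes [measurable]: "f \<in> borel_measurable M"
  shows "Lp_norm M q w (\<lambda>x. a * f x) = \<bar>a\<bar> * Lp_norm M q w f"
  using q_ge_1 by (simp add: Lp_norm_def Lp_integral_scale enn2real_mult powr_mult powr_powr)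

lemma Lp_integral_finite_linear:
  assumes [measurable]: "f \<in> borel_measurable M" "g \<in> borel_measurable M"
    and "Lp_integral M q w f < \<infinity>" "Lp_integral M q w g < \<infinity>"
  shows "Lp_integral M q w (\<lambda>x. a * f x + b * g x) < \<infinity>"
proof -
  have "Lp_integral M q w (\<lambda>x. a * f x + b * g x) \<le> ennreal (2 powr q) *
    (ennreal (\<bar>a\<bar> powr q) * Lp_integral M q w f + ennreal (\<bar>b\<bar> powr q) * Lp_integral M q w g)"
    using Lp_integral_add_le[of "\<lambda>x. a * f x" "\<lambda>x. b * g x"] by (simp add: Lp_integral_scale)
  also have "\<dots> < \<infinity>"
    using assms(3,4) by (auto simp: ennreal_mult_less_top)
  finally show ?thesis .
qed

lemma Lp_integral_finite_diff:
  assumes "f \<in> borel_measurable M" "g \<in> borel_measurable M"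
    and "Lp_integral M q w f < \<infinity>" "Lp_integral M q w g < \<infinity>"
  shows "Lp_integral M q w (\<lambda>x. f x - g x) < \<infinity>"
  using Lp_integral_finite_linear[OF assms, of 1 "-1"] by simp

text \<open>Positive bounds a and b stand in for the norms, so that the convexity inequality can
  divide by them even if a function has norm 0.\<close>

lemma Lp_integral_Minkowski:
  assumes [measurable]: "f \<in> borel_measurable M" "g \<in> borel_measurable M"
    and ab: "0 < a" "0 < b"
    and f: "Lp_integral M q w f \<le> ennreal (a powr q)"
    and g: "Lp_integral M q w g \<le> ennreal (b powr q)"
  shows "Lp_integral M q w (\<lambda>x. f x + g x) \<le> ennreal ((a + b) powr q)"
proof -
  \<comment> \<open>The coefficients of |f|^q w and |g|^q w in the convexity inequality; ca a^q + cb
    b^q collapses to (a + b)^q.\<close>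
  define ca where "ca = (a + b) powr q * (a / (a + b)) / a powr q"
  define cb where "cb = (a + b) powr q * (b / (a + b)) / b powr q"
  have c: "0 \<le> ca" "0 \<le> cb" using ab by (auto simp: ca_def cb_def)
  have "Lp_integral M q w (\<lambda>x. f x + g x) \<le>
    (\<integral>\<^sup>+x. ennreal ca * ennreal (\<bar>f x\<bar> powr q * w x) + ennreal cb * ennreal (\<bar>g x\<bar> powr q * w x) \<partial>M)"
    unfolding Lp_integral_def
  proof (intro nn_integral_mono)
    fix x
    have "\<bar>f x + g x\<bar> powr q * w x \<le> (\<bar>f x\<bar> + \<bar>g x\<bar>) powr q * w x"
      using q_ge_1 weight_nonneg[of x] by (intro mult_right_mono powr_mono2) auto
    also have "\<dots> \<le> ((a + b) powr q *
        ((a / (a + b)) * (\<bar>f x\<bar> / a) powr q + (b / (a + b)) * (\<bar>g x\<bar> / b) powr q)) * w x"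
      using q_ge_1 weight_nonneg[of x] ab
      by (intro mult_right_mono powr_add_le_convex) auto
    also have "\<dots> = ca * (\<bar>f x\<bar> powr q * w x) + cb * (\<bar>g x\<bar> powr q * w x)"
      using ab by (simp add: ca_def cb_def powr_divide algebra_simps)
    finally show "ennreal (\<bar>f x + g x\<bar> powr q * w x) \<le>
      ennreal ca * ennreal (\<bar>f x\<bar> powr q * w x) + ennreal cb * ennreal (\<bar>g x\<bar> powr q * w x)"
      using weight_nonneg[of x] c by (simp add: ennreal_leI flip: ennreal_plus ennreal_mult)
  qed
  also have "\<dots> = ennreal ca * Lp_integral M q w f + ennreal cb * Lp_integral M q w g"
    unfolding Lp_integral_def by (subst nn_integral_add) (auto simp: nn_integral_cmult)
  also have "\<dots> \<le> ennreal ca * ennreal (a powr q) + ennreal cb * ennreal (b powr q)"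
    by (intro add_mono mult_left_mono f g) auto
  also have "\<dots> = ennreal (ca * a powr q + cb * b powr q)"
    using c by (simp flip: ennreal_plus ennreal_mult)
  also have "ca * a powr q + cb * b powr q = (a + b) powr q * (a / (a + b) + b / (a + b))"
    using ab by (simp add: ca_def cb_def distrib_left)
  also have "a / (a + b) + b / (a + b) = 1"
    using ab by (simp add: add_divide_distrib[symmetric])
  finally show ?thesis by simp
qed

lemma Lp_norm_triangle:
  assumes [measurable]: "f \<in> borel_measurable M" "g \<in> borel_measurable M"
    and fin: "Lp_integral M q w f < \<infinity>" "Lp_integral M q w g < \<infinity>"
  shows "Lp_norm M q w (\<lambda>x. f x + g x) \<le> Lp_norm M q w f + Lp_norm M q w g"
proof (rule field_le_epsilon)
  fix e :: real assume e: "0 < e"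
  \<comment> \<open>Padding each norm by e / 2 makes the bounds positive.\<close>
  have "Lp_integral M q w (\<lambda>x. f x + g x)
    \<le> ennreal (((Lp_norm M q w f + e / 2) + (Lp_norm M q w g + e / 2)) powr q)"
    using e Lp_norm_nonneg[of f] Lp_norm_nonneg[of g] fin
    by (intro Lp_integral_Minkowski Lp_integral_le) auto
  then have "Lp_norm M q w (\<lambda>x. f x + g x) \<le> (Lp_norm M q w f + e / 2) + (Lp_norm M q w g + e / 2)"
    using e Lp_norm_nonneg[of f] Lp_norm_nonneg[of g] by (intro Lp_norm_le) auto
  then show "Lp_norm M q w (\<lambda>x. f x + g x) \<le> Lp_norm M q w f + Lp_norm M q w g + e" by simp
qed

lemma Lp_norm_uminus: "Lp_norm M q w (\<lambda>x. - f x) = Lp_norm M q w f"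
  by (simp add: Lp_norm_def Lp_integral_uminus)

lemma Lp_integral_cong_AE:
  assumes "AE x in M. f x = g x"
  shows "Lp_integral M q w f = Lp_integral M q w g"
  unfolding Lp_integral_def using assms by (intro nn_integral_cong_AE) auto

lemma Lp_norm_eq_0_AE:
  assumes [measurable]: "f \<in> borel_measurable M"
    and "Lp_integral M q w f < \<infinity>" "Lp_norm M q w f = 0" and pos: "\<And>x. 0 < w x"
  shows "AE x in M. f x = 0"
proof -
  have "Lp_integral M q w f = 0" using Lp_integral_eq_norm[OF assms(2)] assms(3) q_ge_1 by simp
  then have "AE x in M. ennreal (\<bar>f x\<bar> powr q * w x) = 0"
    unfolding Lp_integral_def by (subst (asm) nn_integral_0_iff_AE) auto
  then show ?thesis
  proof eventually_elim
    case (elim x)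
    have "\<bar>f x\<bar> powr q * w x \<le> 0" using elim by (simp add: ennreal_eq_0_iff)
    with pos[of x] have "\<bar>f x\<bar> powr q \<le> 0" by (simp add: mult_le_0_iff)
    then show ?case by (simp add: powr_le_cancel_iff)
  qed
qed

text \<open>Lower semicontinuity along a.e. convergence. The bound is asked for only eventually,
  since bounds taken from a Cauchy condition start at some index.\<close>

lemma Lp_integral_Fatou:
  assumes [measurable]: "\<And>k. f k \<in> borel_measurable M"
    and lim: "AE x in M. (\<lambda>k. f k x) \<longlonglongrightarrow> g x"
    and bound: "eventually (\<lambda>k. Lp_integral M q w (f k) \<le> A) sequentially"
  shows "Lp_integral M q w g \<le> A"
proof -
  have "Lp_integral M q w g \<le> (\<integral>\<^sup>+x. liminf (\<lambda>k. ennreal (\<bar>f k x\<bar> powr q * w x)) \<partial>M)"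
    unfolding Lp_integral_def
  proof (rule nn_integral_mono_AE, use lim in eventually_elim)
    case (elim x)
    have "(\<lambda>k. ennreal (\<bar>f k x\<bar> powr q * w x)) \<longlonglongrightarrow> ennreal (\<bar>g x\<bar> powr q * w x)"
      using elim q_ge_1 by (intro tendsto_ennrealI tendsto_mult tendsto_powr' tendsto_rabs tendsto_const) auto
    then show ?case by (simp add: lim_imp_Liminf)
  qed
  also have "\<dots> \<le> liminf (\<lambda>k. Lp_integral M q w (f k))"
    unfolding Lp_integral_def by (rule nn_integral_liminf) auto
  also have "\<dots> \<le> A"
    using Liminf_mono[OF bound] by (simp add: Liminf_const)
  finally show ?thesis .
qed

end

section \<open>Cube averages and the fractional Sobolev inequality\<close>

text \<open>For m > 0 this is the half-open cell of the lattice (1/m) Z^n that contains x; m is the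
  reciprocal side length. Floors make the cells a partition, so that an average over cells takes one
  value per lattice point.\<close>

definition cube :: "real \<Rightarrow> real^'n \<Rightarrow> (real^'n) set" where
  "cube m x = {y. \<forall>i. \<lfloor>m * y$i\<rfloor> = \<lfloor>m * x$i\<rfloor>}"

definition cube_average :: "real \<Rightarrow> (real^'n \<Rightarrow> real) \<Rightarrow> real^'n \<Rightarrow> real" where
  "cube_average m u x = m ^ CARD('n) * (LINT y|lborel. indicator (cube m x) y * u y)"

lemma cube_sets [measurable]: "cube m x \<in> sets borel"
proof -
  have [measurable]: "(\<lambda>y::real^'a. y $ i) \<in> borel_measurable borel" for i
    by (intro borel_measurable_continuous_onI continuous_intros)
  have "cube m x = {y \<in> space borel. \<forall>i. \<lfloor>m * y$i\<rfloor> = \<lfloor>m * x$i\<rfloor>}"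
    by (simp add: cube_def)
  also have "\<dots> \<in> sets borel" by measurable
  finally show ?thesis .
qed

text \<open>The cell lies between the open and the closed box with the same corners, which have
  equal volume.\<close>

lemma emeasure_cube:
  fixes x :: "real^'n"
  assumes m: "0 < m"
  shows "emeasure lborel (cube m x) = ennreal ((1 / m) ^ CARD('n))"
proof -
  define l where "l = (\<chi> i. of_int \<lfloor>m * x$i\<rfloor> / m :: real^'n)"
  define u where "u = (\<chi> i. (of_int \<lfloor>m * x$i\<rfloor> + 1) / m :: real^'n)"
  have d: "u - l = (\<chi> i. 1 / m)" by (simp add: u_def l_def vec_eq_iff add_divide_distrib)
  have inner: "(u - l) \<bullet> b = 1 / m" if "b \<in> Basis" for b
    using that unfolding d by (auto simp: Basis_vec_def inner_axis)
  then have prod: "(\<Prod>b\<in>Basis. (u - l) \<bullet> b) = (1 / m) ^ CARD('n)" by simp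
  have le: "l \<bullet> b \<le> u \<bullet> b" if "b \<in> Basis" for b
    using inner[OF that] m by (simp add: inner_diff_left) (smt (verit) divide_pos_pos)
  have sub1: "box l u \<subseteq> cube m x"
  proof
    fix y assume "y \<in> box l u"
    then have "of_int \<lfloor>m * x$i\<rfloor> / m < y$i" "y$i < (of_int \<lfloor>m * x$i\<rfloor> + 1) / m" for i
      by (auto simp: mem_box_cart l_def u_def)
    then have "of_int \<lfloor>m * x$i\<rfloor> < m * y$i" "m * y$i < of_int \<lfloor>m * x$i\<rfloor> + 1" for i
      using m by (auto simp: field_simps)
    then have "\<lfloor>m * y$i\<rfloor> = \<lfloor>m * x$i\<rfloor>" for i
      by (intro floor_unique) (auto intro: less_imp_le)
    then show "y \<in> cube m x" by (simp add: cube_def)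
  qed
  have sub2: "cube m x \<subseteq> cbox l u"
  proof
    fix y assume y: "y \<in> cube m x"
    have "of_int \<lfloor>m * x$i\<rfloor> \<le> m * y$i" "m * y$i \<le> of_int \<lfloor>m * x$i\<rfloor> + 1" for i
    proof -
      have "\<lfloor>m * y$i\<rfloor> = \<lfloor>m * x$i\<rfloor>" using y by (simp add: cube_def)
      then show "of_int \<lfloor>m * x$i\<rfloor> \<le> m * y$i" "m * y$i \<le> of_int \<lfloor>m * x$i\<rfloor> + 1" by linarith+
    qed
    then show "y \<in> cbox l u"
      using m by (auto simp: mem_box_cart l_def u_def field_simps)
  qed
  have "emeasure lborel (box l u) \<le> emeasure lborel (cube m x)"
    by (intro emeasure_mono sub1) auto
  moreover have "emeasure lborel (cube m x) \<le> emeasure lborel (cbox l u)"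
    by (intro emeasure_mono sub2) auto
  ultimately show ?thesis using le prod by simp
qed

text \<open>Each coordinate differs by at most 1/m, and the Euclidean norm is at most the l^1 norm.
  The resulting factor n is the base of the constant n^(n + s p) below.\<close>

lemma norm_diff_le_cube:
  fixes x :: "real^'n"
  assumes m: "0 < m" and y: "y \<in> cube m x"
  shows "norm (y - x) \<le> real CARD('n) / m"
proof -
  have "\<bar>(y - x) $ i\<bar> \<le> 1 / m" for i
  proof -
    have "\<lfloor>m * y$i\<rfloor> = \<lfloor>m * x$i\<rfloor>" using y by (simp add: cube_def)
    then have "\<bar>m * y$i - m * x$i\<bar> \<le> 1" by linarith
    then have "m * \<bar>(y - x)$i\<bar> \<le> 1" using m by (simp add: abs_mult flip: right_diff_distrib)
    then show ?thesis using m by (simp add: field_simps)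
  qed
  then have "(\<Sum>i\<in>UNIV. \<bar>(y - x) $ i\<bar>) \<le> (\<Sum>i\<in>(UNIV::'n set). 1 / m)"
    by (intro sum_mono)
  then show ?thesis using norm_le_l1_cart[of "y - x"] by simp
qed

text \<open>Jensen's inequality for t^p on a set of measure \<mu>, obtained by integrating the
  tangent line inequality at a = (B / \<mu>)^(1/p). The case B = 0 is separate because then a =
  0.\<close>

lemma nn_integral_le_power_mean:
  fixes f :: "'a \<Rightarrow> real"
  assumes [measurable]: "f \<in> borel_measurable M" "S \<in> sets M" and f: "\<And>x. 0 \<le> f x"
    and p: "1 \<le> p" and \<mu>: "0 < \<mu>" "emeasure M S = ennreal \<mu>" and B: "0 \<le> B"
    and le: "(\<integral>\<^sup>+x. ennreal (indicator S x * f x powr p) \<partial>M) \<le> ennreal B"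
  shows "(\<integral>\<^sup>+x. ennreal (indicator S x * f x) \<partial>M) \<le> ennreal (\<mu> * (B / \<mu>) powr (1 / p))"
proof (cases "B = 0")
  case True
  then have "AE x in M. ennreal (indicator S x * f x powr p) = 0"
    using le by (subst nn_integral_0_iff_AE[symmetric]) auto
  then have "AE x in M. ennreal (indicator S x * f x) = 0"
    by eventually_elim (use f in \<open>auto simp: ennreal_eq_0_iff indicator_def split: if_splits\<close>)
  then have "(\<integral>\<^sup>+x. ennreal (indicator S x * f x) \<partial>M) = 0"
    by (subst nn_integral_0_iff_AE) auto
  then show ?thesis by simp
next
  case False
  define a where "a = (B / \<mu>) powr (1 / p)"
  have a: "0 < a" "a powr p = B / \<mu>" using False B \<mu> p by (auto simp: a_def powr_powr)
  have pt: "t \<le> a * (t powr p / (p * a powr p) + (1 - 1 / p))" if "0 \<le> t" for t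
  proof -
    \<comment> \<open>Young's inequality for t / a and 1 with p and its conjugate exponent; p = 1
      has no finite conjugate, but there both sides are equal.\<close>
    have "t / a \<le> (t / a) powr p / p + (1 - 1 / p)"
    proof (cases "p = 1")
      case False
      then show ?thesis
        using Youngs_inequality[of p "p / (p - 1)" "t / a" 1] p a(1) that
        by (simp add: field_simps)
    next
      case True
      moreover have "(t / a) powr 1 = t / a" using a(1) that by (intro powr_one) auto
      ultimately show ?thesis by (metis div_by_1 diff_self add.right_neutral order_refl)
    qed
    then have "a * (t / a) \<le> a * ((t / a) powr p / p + (1 - 1 / p))"
      using a by (intro mult_left_mono) auto
    then show ?thesis using a that by (simp add: powr_divide mult.commute)
  qed
  have "(\<integral>\<^sup>+x. ennreal (indicator S x * f x) \<partial>M) \<le>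
    (\<integral>\<^sup>+x. ennreal (a / (p * a powr p)) * ennreal (indicator S x * f x powr p)
        + ennreal (a * (1 - 1 / p)) * indicator S x \<partial>M)"
  proof (intro nn_integral_mono)
    fix x
    have "indicator S x * f x \<le> a / (p * a powr p) * (indicator S x * f x powr p) + a * (1 - 1 / p) * indicator S x"
      using pt[OF f, of x] by (cases "x \<in> S") (auto simp: distrib_left)
    then have "ennreal (indicator S x * f x)
      \<le> ennreal (a / (p * a powr p) * (indicator S x * f x powr p) + a * (1 - 1 / p) * indicator S x)"
      by (rule ennreal_leI)
    also have "\<dots> = ennreal (a / (p * a powr p)) * ennreal (indicator S x * f x powr p)
        + ennreal (a * (1 - 1 / p)) * indicator S x"
    proof -
      have "0 \<le> a / (p * a powr p)" "0 \<le> a * (1 - 1 / p)" using a(1) p by auto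
      then have "ennreal (a / (p * a powr p) * f x powr p + a * (1 - 1 / p))
          = ennreal (a / (p * a powr p)) * ennreal (f x powr p) + ennreal (a * (1 - 1 / p))"
        by (metis ennreal_mult ennreal_plus mult_nonneg_nonneg powr_ge_zero)
      then show ?thesis by (cases "x \<in> S") simp_all
    qed
    finally show "ennreal (indicator S x * f x) \<le> ennreal (a / (p * a powr p)) * ennreal (indicator S x * f x powr p)
        + ennreal (a * (1 - 1 / p)) * indicator S x" .
  qed
  also have "\<dots> = ennreal (a / (p * a powr p)) * (\<integral>\<^sup>+x. ennreal (indicator S x * f x powr p) \<partial>M)
        + ennreal (a * (1 - 1 / p)) * emeasure M S"
    by (subst nn_integral_add) (auto simp: nn_integral_cmult nn_integral_cmult_indicator)
  also have "\<dots> \<le> ennreal (a / (p * a powr p)) * ennreal B + ennreal (a * (1 - 1 / p)) * ennreal \<mu>"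
    unfolding \<mu> by (intro add_mono mult_left_mono le) auto
  also have "\<dots> = ennreal (a / (p * a powr p) * B + a * (1 - 1 / p) * \<mu>)"
    using a p B \<mu> by (simp flip: ennreal_plus ennreal_mult)
  also have "a / (p * a powr p) * B + a * (1 - 1 / p) * \<mu> = \<mu> * a"
    unfolding a using a p False \<mu> by (simp add: field_simps)
  finally show ?thesis unfolding a_def .
qed

lemma le_one_add_powr: "1 \<le> p \<Longrightarrow> 0 \<le> t \<Longrightarrow> t \<le> 1 + t powr p" for t p :: real
  using powr_mono[of 1 p t] by (cases "t \<le> 1") (auto intro: order_trans add_increasing)

lemma cube_integrable:
  fixes u :: "real^'n \<Rightarrow> real"
  assumes [measurable]: "u \<in> borel_measurable borel" and m: "0 < m" and p: "1 \<le> p"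
    and fin: "(\<integral>\<^sup>+y. ennreal (\<bar>u y\<bar> powr p) \<partial>lborel) < \<infinity>"
  shows "integrable lborel (\<lambda>y. indicator (cube m x) y * u y)"
proof (rule integrableI_bounded)
  have "(\<integral>\<^sup>+y. ennreal (norm (indicator (cube m x) y * u y)) \<partial>lborel)
    \<le> (\<integral>\<^sup>+y. indicator (cube m x) y + ennreal (\<bar>u y\<bar> powr p) \<partial>lborel)"
    using le_one_add_powr[OF p]
    by (intro nn_integral_mono) (auto simp: indicator_def simp flip: ennreal_plus ennreal_1 intro!: ennreal_leI)
  also have "\<dots> = emeasure lborel (cube m x) + (\<integral>\<^sup>+y. ennreal (\<bar>u y\<bar> powr p) \<partial>lborel)"
    by (subst nn_integral_add) auto
  also have "\<dots> < \<infinity>" using fin m by (simp add: emeasure_cube)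
  finally show "(\<integral>\<^sup>+y. ennreal (norm (indicator (cube m x) y * u y)) \<partial>lborel) < \<infinity>" .
qed auto

text \<open>Since m^n is the reciprocal volume of the cell, c minus the average is the average of c
  - u, to which Jensen applies. The choice c = u x measures the oscillation, c = 0 the size of the
  average.\<close>

lemma cube_average_diff_le:
  fixes u :: "real^'n \<Rightarrow> real"
  assumes [measurable]: "u \<in> borel_measurable borel" and m: "0 < m" and p: "1 \<le> p" and B: "0 \<le> B"
    and int: "integrable lborel (\<lambda>y. indicator (cube m x) y * u y)"
    and le: "(\<integral>\<^sup>+y. ennreal (indicator (cube m x) y * \<bar>c - u y\<bar> powr p) \<partial>lborel) \<le> ennreal B"
  shows "\<bar>c - cube_average m u x\<bar> \<le> (m ^ CARD('n) * B) powr (1 / p)"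
proof -
  let ?S = "cube m x"
  define \<mu> where "\<mu> = (1 / m) ^ CARD('n)"
  have \<mu>: "0 < \<mu>" "emeasure lborel ?S = ennreal \<mu>" "m ^ CARD('n) * \<mu> = 1"
    using m by (auto simp: \<mu>_def emeasure_cube power_divide)
  have m\<mu>: "m ^ CARD('n) = 1 / \<mu>" using \<mu> by (simp add: field_simps)
  have le1: "(\<integral>\<^sup>+y. ennreal (indicator ?S y * \<bar>c - u y\<bar>) \<partial>lborel)
      \<le> ennreal (\<mu> * (B / \<mu>) powr (1 / p))"
    by (intro nn_integral_le_power_mean le p \<mu> B) auto
  have intc: "integrable lborel (\<lambda>y. indicator ?S y * c)"
    by (intro integrable_mult_left integrable_real_indicator) (auto simp: \<mu>(2))
  have meas: "measure lborel ?S = \<mu>" using \<mu> by (simp add: measure_def)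
  have "(LINT y|lborel. indicator ?S y * (c - u y))
      = (LINT y|lborel. indicator ?S y * c) - (LINT y|lborel. indicator ?S y * u y)"
    unfolding right_diff_distrib by (intro Bochner_Integration.integral_diff intc int)
  also have "(LINT y|lborel. indicator ?S y * c) = \<mu> * c"
    by (simp add: meas)
  finally have "m ^ CARD('n) * (LINT y|lborel. indicator ?S y * (c - u y)) = c - cube_average m u x"
    using \<mu>(3) by (simp add: cube_average_def right_diff_distrib flip: mult.assoc)
  then have "\<bar>c - cube_average m u x\<bar> = m ^ CARD('n) * \<bar>LINT y|lborel. indicator ?S y * (c - u y)\<bar>"
    using m by (metis abs_mult abs_of_pos zero_less_power)
  also have "\<bar>LINT y|lborel. indicator ?S y * (c - u y)\<bar> \<le> \<mu> * (B / \<mu>) powr (1 / p)"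
  proof -
    have "ennreal (norm (LINT y|lborel. indicator ?S y * (c - u y)))
        \<le> (\<integral>\<^sup>+y. norm (indicator ?S y * (c - u y)) \<partial>lborel)"
      using int intc by (intro integral_norm_bound_ennreal) (simp add: right_diff_distrib)
    also have "\<dots> = (\<integral>\<^sup>+y. ennreal (indicator ?S y * \<bar>c - u y\<bar>) \<partial>lborel)"
      by (simp add: abs_mult)
    also note le1
    finally show ?thesis using \<mu> by (subst (asm) ennreal_le_iff) auto
  qed
  finally show ?thesis using m \<mu> by (simp add: m\<mu> mult_left_mono field_simps)
qed

section \<open>The Gagliardo integral controls the distance to cube averages\<close>

definition gagliardo_slice :: "real \<Rightarrow> real \<Rightarrow> (real^'n \<Rightarrow> real) \<Rightarrow> real^'n \<Rightarrow> ennreal" where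
  "gagliardo_slice s p u x =
    (\<integral>\<^sup>+y. ennreal (\<bar>u y - u x\<bar> powr p / norm (y - x) powr (real CARD('n) + s * p)) \<partial>lborel)"

lemma gagliardo_integral_eq_slice:
  "gagliardo_integral s p u = (\<integral>\<^sup>+x. gagliardo_slice s p u x \<partial>lborel)"
  by (simp add: gagliardo_integral_def gagliardo_slice_def nn_integral_completion)

lemma gagliardo_slice_measurable [measurable]:
  assumes [measurable]: "u \<in> borel_measurable borel"
  shows "gagliardo_slice s p u \<in> borel_measurable borel"
  unfolding gagliardo_slice_def
  using lborel.borel_measurable_nn_integral[of "\<lambda>x y. ennreal (\<bar>u y - u x\<bar> powr p / norm (y - x) powr (real CARD('a) + s * p))" borel]
  by simp

text \<open>On the cell of x one has |y - x|^(n + s p) \<le> (n/m)^(n + s p), which lets the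
  Gagliardo kernel be inserted into the integral of |u x - u y|^p. The normalisation m^n cancels
  m^(-n) and leaves m^(-s p). Integrability is a hypothesis because callers get it from an L^P
  bound, with an exponent other than p.\<close>

lemma cube_average_close:
  fixes u :: "real^'n \<Rightarrow> real"
  assumes [measurable]: "u \<in> borel_measurable borel" and m: "0 < m" and p: "1 \<le> p" and s: "0 < s"
    and int: "integrable lborel (\<lambda>y. indicator (cube m x) y * u y)"
  shows "ennreal (\<bar>u x - cube_average m u x\<bar> powr p)
    \<le> ennreal (real CARD('n) powr (real CARD('n) + s * p) * m powr (- (s * p))) * gagliardo_slice s p u x"
proof (cases "gagliardo_slice s p u x")
  case top
  then show ?thesis using m by (auto simp: ennreal_mult_top)
next
  case (real d)
  define N where "N = real CARD('n)"
  have N: "0 < N" by (simp add: N_def)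
  define B where "B = (N / m) powr (N + s * p) * d"
  have B: "0 \<le> B" using real by (simp add: B_def)
  have "(\<integral>\<^sup>+y. ennreal (indicator (cube m x) y * \<bar>u x - u y\<bar> powr p) \<partial>lborel)
    \<le> (\<integral>\<^sup>+y. ennreal ((N / m) powr (N + s * p)) *
          ennreal (\<bar>u y - u x\<bar> powr p / norm (y - x) powr (N + s * p)) \<partial>lborel)"
  proof (intro nn_integral_mono)
    fix y
    have "indicator (cube m x) y * \<bar>u x - u y\<bar> powr p
      \<le> (N / m) powr (N + s * p) * (\<bar>u y - u x\<bar> powr p / norm (y - x) powr (N + s * p))"
    proof (cases "y \<in> cube m x \<and> y \<noteq> x")
      case True
      then have pos: "0 < norm (y - x) powr (N + s * p)" by simp
      have "norm (y - x) powr (N + s * p) \<le> (N / m) powr (N + s * p)"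
        using norm_diff_le_cube[OF m, of y x] True N s p unfolding N_def by (intro powr_mono2) auto
      then have "\<bar>u y - u x\<bar> powr p * norm (y - x) powr (N + s * p)
          \<le> \<bar>u y - u x\<bar> powr p * (N / m) powr (N + s * p)"
        by (intro mult_left_mono) auto
      then show ?thesis using True pos by (simp add: abs_minus_commute field_simps)
    qed (use N m in auto)
    then show "ennreal (indicator (cube m x) y * \<bar>u x - u y\<bar> powr p)
      \<le> ennreal ((N / m) powr (N + s * p)) * ennreal (\<bar>u y - u x\<bar> powr p / norm (y - x) powr (N + s * p))"
      by (simp add: ennreal_leI flip: ennreal_mult)
  qed
  also have "\<dots> = ennreal ((N / m) powr (N + s * p)) * gagliardo_slice s p u x"
    unfolding gagliardo_slice_def N_def by (subst nn_integral_cmult) auto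
  also have "\<dots> = ennreal B" using real by (simp add: B_def ennreal_mult)
  finally have "\<bar>u x - cube_average m u x\<bar> \<le> (m ^ CARD('n) * B) powr (1 / p)"
    by (intro cube_average_diff_le m p B int) auto
  then have "\<bar>u x - cube_average m u x\<bar> powr p \<le> ((m ^ CARD('n) * B) powr (1 / p)) powr p"
    using p by (intro powr_mono2) auto
  also have "\<dots> = m ^ CARD('n) * B" using p m B by (simp add: powr_powr)
  also have "m ^ CARD('n) = m powr N" using m by (simp add: N_def powr_realpow)
  also have "m powr N * B = N powr (N + s * p) * m powr (- (s * p)) * d"
  proof -
    have "m powr N * (N / m) powr (N + s * p) = N powr (N + s * p) * (m powr N / m powr (N + s * p))"
      using N m by (simp add: powr_divide)
    also have "m powr N / m powr (N + s * p) = m powr (- (s * p))"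
      by (simp flip: powr_diff)
    finally show ?thesis unfolding B_def by simp
  qed
  finally show ?thesis using real by (simp add: ennreal_leI N_def flip: ennreal_mult)
qed

lemma cube_average_le:
  fixes u :: "real^'n \<Rightarrow> real"
  assumes [measurable]: "u \<in> borel_measurable borel" and m: "0 < m" and p: "1 \<le> p" and N: "0 \<le> N"
    and le: "(\<integral>\<^sup>+y. ennreal (\<bar>u y\<bar> powr p) \<partial>lborel) \<le> ennreal N"
  shows "\<bar>cube_average m u x\<bar> \<le> (m ^ CARD('n) * N) powr (1 / p)"
proof -
  have fin: "(\<integral>\<^sup>+y. ennreal (\<bar>u y\<bar> powr p) \<partial>lborel) < \<infinity>"
    using le by (rule le_less_trans) simp
  have "(\<integral>\<^sup>+y. ennreal (indicator (cube m x) y * \<bar>0 - u y\<bar> powr p) \<partial>lborel)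
    \<le> (\<integral>\<^sup>+y. ennreal (\<bar>u y\<bar> powr p) \<partial>lborel)"
    by (intro nn_integral_mono) (auto simp: indicator_def)
  also note le
  finally have "\<bar>0 - cube_average m u x\<bar> \<le> (m ^ CARD('n) * N) powr (1 / p)"
    using fin by (intro cube_average_diff_le cube_integrable[OF _ m p fin] m p N) auto
  then show ?thesis by simp
qed

text \<open>Both terms are equal at m = (a / b)^(1 / (s + \<alpha>)), which gives the bound with the
  factor 2. For a = 0 this m is not positive, and small m force U \<le> 0 instead.\<close>

lemma balance_powers:
  fixes a b s \<alpha> \<theta> U :: real
  assumes a: "0 \<le> a" and b: "0 < b" and s: "0 < s" and \<alpha>: "0 < \<alpha>"
    and le: "\<And>m. 0 < m \<Longrightarrow> U \<le> a * m powr (- s) + b * m powr \<alpha>"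
  shows "U \<le> 2 * b * (a / b) powr (\<alpha> / (s + \<alpha>))"
proof (cases "a = 0")
  case True
  have "U \<le> 0"
  proof (rule ccontr)
    assume "\<not> U \<le> 0"
    then have U: "0 < U" by simp
    \<comment> \<open>Chosen so that b m^\<alpha> = U / 2.\<close>
    define m where "m = (U / (2 * b)) powr (1 / \<alpha>)"
    have "m powr \<alpha> = U / (2 * b)" using U b \<alpha> by (simp add: m_def powr_powr)
    moreover have "0 < m" using U b by (simp add: m_def)
    ultimately have "U \<le> U / 2" using le[of m] True b by simp
    then show False using U by simp
  qed
  then show ?thesis using True by simp
next
  case False
  define m where "m = (a / b) powr (1 / (s + \<alpha>))"
  have ab: "0 < a / b" using False a b by simp
  have "m powr \<alpha> = (a / b) powr (\<alpha> / (s + \<alpha>))" by (simp add: m_def powr_powr)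
  moreover have "a * m powr (- s) = b * (a / b) powr (\<alpha> / (s + \<alpha>))"
  proof -
    have "b * (a / b) powr 1 = a" using a b by simp
    moreover have "m powr (- s) = (a / b) powr (- s / (s + \<alpha>))" by (simp add: m_def powr_powr)
    ultimately have "a * m powr (- s) = b * ((a / b) powr 1 * (a / b) powr (- s / (s + \<alpha>)))"
      by (metis mult.assoc)
    also have "(a / b) powr 1 * (a / b) powr (- s / (s + \<alpha>)) = (a / b) powr (1 + - s / (s + \<alpha>))"
      by (simp only: powr_add)
    also have "1 + - s / (s + \<alpha>) = \<alpha> / (s + \<alpha>)" using s \<alpha> by (simp add: field_simps)
    finally show ?thesis .
  qed
  moreover have "0 < m" using False b by (simp add: m_def)
  ultimately show ?thesis using le[of m] by simp
qed

text \<open>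
  Following Brezis: the average over a cube of side \<open>1 / m\<close> differs from \<open>u x\<close> by at most
  \<open>c m^(-s) D(x)^(1/p)\<close>, where \<open>D\<close> is the inner Gagliardo integral, and is itself at most
  \<open>m^(n/P)\<close> times the \<open>L^P\<close> norm. Optimising in \<open>m\<close> gives a pointwise bound on \<open>\<bar>u x\<bar>\<close> whose
  integral can be absorbed because the \<open>L^P\<close> norm is finite.
\<close>

lemma fractional_Sobolev_inequality:
  fixes s p P :: real and u :: "real^'n \<Rightarrow> real"
  assumes p: "1 \<le> p" and s: "0 < s" and sp: "s * p < real CARD('n)"
    and P: "P = real CARD('n) * p / (real CARD('n) - s * p)"
    and [measurable]: "u \<in> borel_measurable borel"
    and fin: "(\<integral>\<^sup>+y. ennreal (\<bar>u y\<bar> powr P) \<partial>lborel) < \<infinity>"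
    and gag: "gagliardo_integral s p u \<le> ennreal G" and G: "0 \<le> G"
  shows "(\<integral>\<^sup>+y. ennreal (\<bar>u y\<bar> powr P) \<partial>lborel)
    \<le> ennreal ((2 powr P * real CARD('n) powr (real CARD('n) + s * p) * G) powr (P / p))"
proof -
  define n where "n = real CARD('n)"
  define c where "c = n powr (n + s * p)"
  have n: "0 < n" by (simp add: n_def)
  have c: "0 < c" using n by (simp add: c_def)
  have Pdef: "P = n * p / (n - s * p)" using P by (simp add: n_def)
  have nsp: "0 < n - s * p" using sp by (simp add: n_def)
  have pP: "p \<le> P" using nsp p s by (simp add: Pdef field_simps)
  have P1: "1 \<le> P" using pP p by simp
  \<comment> \<open>This is 1/P = 1/p - s/n. It turns the exponent of \<open>balance_powers\<close>
    into p / P, so that the P-th power of the pointwise bound is linear in the slice.\<close>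
  have sum_exp: "s + n / P = n / p" using nsp p n by (simp add: Pdef field_simps)
  have \<theta>: "(n / P) / (s + n / P) = p / P" unfolding sum_exp using n by simp
  obtain N where N: "0 \<le> N" "(\<integral>\<^sup>+y. ennreal (\<bar>u y\<bar> powr P) \<partial>lborel) = ennreal N"
    using fin by (cases "(\<integral>\<^sup>+y. ennreal (\<bar>u y\<bar> powr P) \<partial>lborel)") auto
  show ?thesis
  proof (cases "N = 0")
    case True
    then show ?thesis using N by simp
  next
    case False
    with N have N0: "0 < N" by simp
    define b where "b = N powr (1 / P)"
    have b: "0 < b" using N0 by (simp add: b_def)
    have bP: "b powr P = N" using N0 P1 by (simp add: b_def powr_powr)
    have bp: "b powr p = N powr (p / P)" by (simp add: b_def powr_powr)
    \<comment> \<open>N is the integral of |u|^P itself. The factor N^(1 - p / P) is positive and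
      finite and is divided out after integration, leaving N^(p / P) on the left.\<close>
    define C where "C = 2 powr P * c * N powr (1 - p / P)"
    have C: "0 < C" using c N0 by (simp add: C_def)
    have pt: "ennreal (\<bar>u x\<bar> powr P) \<le> ennreal C * gagliardo_slice s p u x" for x
    proof (cases "gagliardo_slice s p u x")
      case top
      then show ?thesis using C by (auto simp: ennreal_mult_top)
    next
      case (real d)
      define a where "a = (c * d) powr (1 / p)"
      have a: "0 \<le> a" "a powr p = c * d" using c real p by (auto simp: a_def powr_powr)
      have "\<bar>u x\<bar> \<le> a * m powr (- s) + b * m powr (n / P)" if m: "0 < m" for m
      proof -
        have "ennreal (\<bar>u x - cube_average m u x\<bar> powr p)
            \<le> ennreal (c * m powr (- (s * p))) * ennreal d"
          using cube_average_close[OF _ m p s cube_integrable[OF _ m P1 fin], of x] real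
          by (simp add: c_def n_def)
        also have "\<dots> = ennreal (c * m powr (- (s * p)) * d)"
          using c real by (simp flip: ennreal_mult)
        finally have "\<bar>u x - cube_average m u x\<bar> powr p \<le> c * m powr (- (s * p)) * d"
          using c real by (subst (asm) ennreal_le_iff) auto
        then have "(\<bar>u x - cube_average m u x\<bar> powr p) powr (1 / p)
            \<le> (c * m powr (- (s * p)) * d) powr (1 / p)"
          using p by (intro powr_mono2) auto
        also have "(c * m powr (- (s * p)) * d) powr (1 / p) = ((c * d) * m powr (- (s * p))) powr (1 / p)"
          by (simp add: mult_ac)
        also have "\<dots> = a * m powr (- s)"
          unfolding a_def using p c real by (subst powr_mult) (auto simp: powr_powr)
        finally have 1: "\<bar>u x - cube_average m u x\<bar> \<le> a * m powr (- s)"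
          using p by (simp add: powr_powr)
        have "\<bar>cube_average m u x\<bar> \<le> (m ^ CARD('n) * N) powr (1 / P)"
          using N by (intro cube_average_le m P1) auto
        also have "m ^ CARD('n) = m powr n" using m by (simp add: n_def powr_realpow)
        also have "(m powr n * N) powr (1 / P) = b * m powr (n / P)"
          unfolding b_def using N0 by (subst powr_mult) (auto simp: powr_powr)
        finally show ?thesis using 1 by linarith
      qed
      then have "\<bar>u x\<bar> \<le> 2 * b * (a / b) powr ((n / P) / (s + n / P))"
        using n P1 by (intro balance_powers a b s) auto
      then have "\<bar>u x\<bar> powr P \<le> (2 * b * (a / b) powr (p / P)) powr P"
        unfolding \<theta> using P1 by (intro powr_mono2) auto
      also have "\<dots> = 2 powr P * N * (a / b) powr p"
        using P1 a b by (simp add: powr_mult powr_powr bP)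
      also have "\<dots> = 2 powr P * (N / N powr (p / P)) * (c * d)"
        using a b by (simp add: powr_divide bp)
      also have "N / N powr (p / P) = N powr (1 - p / P)"
        using N0 by (simp add: powr_diff)
      finally have "\<bar>u x\<bar> powr P \<le> C * d" by (simp add: C_def mult_ac)
      then show ?thesis using real C by (simp add: ennreal_leI flip: ennreal_mult)
    qed
    have "ennreal N \<le> (\<integral>\<^sup>+x. ennreal C * gagliardo_slice s p u x \<partial>lborel)"
      unfolding N(2)[symmetric] by (intro nn_integral_mono pt)
    also have "\<dots> = ennreal C * gagliardo_integral s p u"
      unfolding gagliardo_integral_eq_slice by (intro nn_integral_cmult) auto
    also have "\<dots> \<le> ennreal C * ennreal G" by (intro mult_left_mono gag) auto
    also have "\<dots> = ennreal (C * G)" using C G by (simp flip: ennreal_mult)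
    finally have "N \<le> C * G" using C G by (subst (asm) ennreal_le_iff) auto
    also have "C * G = (2 powr P * c * G) * (N / N powr (p / P))"
      using N0 by (simp add: C_def powr_diff)
    finally have "N powr (p / P) \<le> 2 powr P * c * G"
      using N0 by (simp add: field_simps)
    then have "(N powr (p / P)) powr (P / p) \<le> (2 powr P * c * G) powr (P / p)"
      using p P1 by (intro powr_mono2) auto
    then have "N \<le> (2 powr P * c * G) powr (P / p)"
      using p P1 N0 by (simp add: powr_powr)
    then show ?thesis unfolding N(2) c_def n_def by (simp add: ennreal_leI)
  qed
qed

section \<open>Almost everywhere convergent subsequences\<close>

text \<open>Truncation at 1 does not worsen the constant: once a summand reaches 1, the right-hand
  side is at least 2^p \<ge> 1.\<close>

lemma min_one_powr_add_le:
  fixes a b p :: real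
  assumes "0 \<le> p"
  shows "min 1 (\<bar>a + b\<bar> powr p) \<le> 2 powr p * (min 1 (\<bar>a\<bar> powr p) + min 1 (\<bar>b\<bar> powr p))"
proof (cases "1 \<le> \<bar>a\<bar> powr p \<or> 1 \<le> \<bar>b\<bar> powr p")
  case True
  have "1 \<le> min 1 (\<bar>a\<bar> powr p) + min 1 (\<bar>b\<bar> powr p)"
    using True by (auto simp: min_def)
  moreover have "1 \<le> (2::real) powr p" using assms by (intro ge_one_powr_ge_zero) auto
  ultimately have "1 * 1 \<le> 2 powr p * (min 1 (\<bar>a\<bar> powr p) + min 1 (\<bar>b\<bar> powr p))"
    by (intro mult_mono) auto
  then show ?thesis by linarith
next
  case False
  then show ?thesis using powr_add_le_two_powr[OF assms, of a b] by (simp add: min_def)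
qed

text \<open>Approximability for every \<epsilon>, with l allowed to depend on \<epsilon>, makes the
  sequence Cauchy for the truncated distance \<open>d\<close>. A subsequence with consecutive
  distances at most 4^(-i) has geometrically small increments at almost every point, so it converges
  by telescoping.\<close>

lemma AE_convergent_subsequence:
  fixes v :: "nat \<Rightarrow> 'a \<Rightarrow> real" and g :: "'a \<Rightarrow> real"
  assumes [measurable]: "\<And>k. v k \<in> borel_measurable M" "g \<in> borel_measurable M"
    and g: "\<And>x. x \<in> space M \<Longrightarrow> 0 < g x" and p: "1 \<le> p"
    and approx: "\<And>\<epsilon>. 0 < \<epsilon> \<Longrightarrow> \<exists>l\<in>borel_measurable M. \<exists>J. \<forall>j\<ge>J.
       (\<integral>\<^sup>+x. ennreal (min 1 (\<bar>v j x - l x\<bar> powr p) * g x) \<partial>M) \<le> ennreal \<epsilon>"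
  shows "\<exists>\<kappa>::nat \<Rightarrow> nat. strict_mono \<kappa> \<and> (AE x in M. convergent (\<lambda>j. v (\<kappa> j) x))"
proof -
  define d where "d = (\<lambda>j k. \<integral>\<^sup>+x. ennreal (min 1 (\<bar>v j x - v k x\<bar> powr p) * g x) \<partial>M)"
  have cauchy: "\<exists>J. \<forall>j\<ge>J. \<forall>k\<ge>J. d j k \<le> ennreal \<delta>" if \<delta>: "0 < \<delta>" for \<delta>
  proof -
    define \<epsilon> where "\<epsilon> = \<delta> / (2 * 2 powr p)"
    have \<epsilon>: "0 < \<epsilon>" using \<delta> by (simp add: \<epsilon>_def)
    obtain l J where [measurable]: "l \<in> borel_measurable M"
      and J: "\<And>j. J \<le> j \<Longrightarrow> (\<integral>\<^sup>+x. ennreal (min 1 (\<bar>v j x - l x\<bar> powr p) * g x) \<partial>M) \<le> ennreal \<epsilon>"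
      using approx[OF \<epsilon>] by blast
    have "d j k \<le> ennreal \<delta>" if jk: "J \<le> j" "J \<le> k" for j k
    proof -
      have "d j k \<le> (\<integral>\<^sup>+x. ennreal (2 powr p) * (ennreal (min 1 (\<bar>v j x - l x\<bar> powr p) * g x)
          + ennreal (min 1 (\<bar>v k x - l x\<bar> powr p) * g x)) \<partial>M)"
        unfolding d_def
      proof (intro nn_integral_mono)
        fix x assume x: "x \<in> space M"
        have "min 1 (\<bar>v j x - v k x\<bar> powr p)
          \<le> 2 powr p * (min 1 (\<bar>v j x - l x\<bar> powr p) + min 1 (\<bar>v k x - l x\<bar> powr p))"
          using min_one_powr_add_le[of p "v j x - l x" "l x - v k x"] p
          by (simp add: abs_minus_commute)
        then have "min 1 (\<bar>v j x - v k x\<bar> powr p) * g x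
          \<le> 2 powr p * (min 1 (\<bar>v j x - l x\<bar> powr p) + min 1 (\<bar>v k x - l x\<bar> powr p)) * g x"
          using g[OF x] by (intro mult_right_mono) auto
        then have "ennreal (min 1 (\<bar>v j x - v k x\<bar> powr p) * g x) \<le> ennreal (2 powr p *
          (min 1 (\<bar>v j x - l x\<bar> powr p) * g x + min 1 (\<bar>v k x - l x\<bar> powr p) * g x))"
          by (intro ennreal_leI) (simp add: algebra_simps)
        then show "ennreal (min 1 (\<bar>v j x - v k x\<bar> powr p) * g x) \<le>
          ennreal (2 powr p) * (ennreal (min 1 (\<bar>v j x - l x\<bar> powr p) * g x)
          + ennreal (min 1 (\<bar>v k x - l x\<bar> powr p) * g x))"
          using g[OF x] by (simp add: ennreal_mult)
      qed
      also have "\<dots> = ennreal (2 powr p) * ((\<integral>\<^sup>+x. ennreal (min 1 (\<bar>v j x - l x\<bar> powr p) * g x) \<partial>M)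
          + (\<integral>\<^sup>+x. ennreal (min 1 (\<bar>v k x - l x\<bar> powr p) * g x) \<partial>M))"
        by (subst nn_integral_cmult) (auto simp: nn_integral_add)
      also have "\<dots> \<le> ennreal (2 powr p) * (ennreal \<epsilon> + ennreal \<epsilon>)"
        by (intro mult_left_mono add_mono J jk) auto
      also have "\<dots> = ennreal \<delta>" using \<epsilon> by (simp add: \<epsilon>_def flip: ennreal_plus ennreal_mult)
      finally show ?thesis .
    qed
    then show ?thesis by blast
  qed
  have "\<exists>J. \<forall>i. \<forall>j\<ge>J i. \<forall>k\<ge>J i. d j k \<le> ennreal ((1/4)^i)"
    by (intro choice allI cauchy) simp
  then obtain J where J: "\<And>i j k. J i \<le> j \<Longrightarrow> J i \<le> k \<Longrightarrow> d j k \<le> ennreal ((1/4)^i)"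
    by blast
  \<comment> \<open>The summand i gives strict monotonicity; the cumulative sum dominates
    \<open>J i\<close> at the two indices i and i + 1 that are compared.\<close>
  define \<kappa> where "\<kappa> i = i + (\<Sum>i'\<le>i. J i')" for i
  have \<kappa>: "strict_mono \<kappa>" by (simp add: strict_mono_Suc_iff \<kappa>_def)
  have \<kappa>J: "J i \<le> \<kappa> i" "J i \<le> \<kappa> (Suc i)" for i
    using member_le_sum[of i "{..i}" J] by (auto simp: \<kappa>_def)
  define \<rho> where "\<rho> i x = min 1 (\<bar>v (\<kappa> (Suc i)) x - v (\<kappa> i) x\<bar> powr p)" for i x
  have [measurable]: "\<rho> i \<in> borel_measurable M" for i unfolding \<rho>_def by measurable
  have \<rho>0: "0 \<le> \<rho> i x" for i x by (simp add: \<rho>_def)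
  \<comment> \<open>The factor 2^i still leaves the summable 2^i 4^(-i) = 2^(-i), and a finite value
    of the weighted series at x forces \<rho> i x \<le> R 2^(-i).\<close>
  have "(\<integral>\<^sup>+x. (\<Sum>i. ennreal (2^i * (\<rho> i x * g x))) \<partial>M)
      = (\<Sum>i. (\<integral>\<^sup>+x. ennreal (2^i * (\<rho> i x * g x)) \<partial>M))"
    by (intro nn_integral_suminf) auto
  also have "\<dots> \<le> (\<Sum>i. ennreal ((1/2)^i))"
  proof (intro suminf_le)
    fix i
    have "(\<integral>\<^sup>+x. ennreal (2^i * (\<rho> i x * g x)) \<partial>M) = ennreal (2^i) * d (\<kappa> (Suc i)) (\<kappa> i)"
      unfolding d_def \<rho>_def by (subst nn_integral_cmult[symmetric]) (auto simp: ennreal_mult' intro!: nn_integral_cong)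
    also have "\<dots> \<le> ennreal (2^i) * ennreal ((1/4)^i)"
      by (intro mult_left_mono J \<kappa>J) auto
    also have "\<dots> = ennreal ((1/2)^i)"
      by (simp flip: ennreal_mult power_mult_distrib)
    finally show "(\<integral>\<^sup>+x. ennreal (2^i * (\<rho> i x * g x)) \<partial>M) \<le> ennreal ((1/2)^i)" .
  qed auto
  also have "\<dots> < \<infinity>"
    by (simp add: suminf_ennreal2 summable_geometric)
  finally have "AE x in M. (\<Sum>i. ennreal (2^i * (\<rho> i x * g x))) \<noteq> \<infinity>"
    by (intro nn_integral_PInf_AE) auto
  then have "AE x in M. convergent (\<lambda>j. v (\<kappa> j) x)"
  proof (rule AE_mp, intro AE_I2 impI)
    fix x assume x: "x \<in> space M" and "(\<Sum>i. ennreal (2^i * (\<rho> i x * g x))) \<noteq> \<infinity>"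
    then obtain S where S: "0 \<le> S" "(\<Sum>i. ennreal (2^i * (\<rho> i x * g x))) = ennreal S"
      by (cases "(\<Sum>i. ennreal (2^i * (\<rho> i x * g x)))") auto
    define R where "R = S / g x"
    have R: "0 \<le> R" using S g[OF x] by (simp add: R_def)
    have \<rho>R: "\<rho> i x \<le> R * (1/2)^i" for i
    proof -
      have "ennreal (2^i * (\<rho> i x * g x)) \<le> ennreal S"
        unfolding S(2)[symmetric] using sum_le_suminf[of "\<lambda>i. ennreal (2^i * (\<rho> i x * g x))" "{i}"] by auto
      then have "2^i * (\<rho> i x * g x) \<le> S" using S by (subst (asm) ennreal_le_iff) auto
      then show ?thesis using g[OF x] by (simp add: R_def field_simps)
    qed
    define c where "c = (1/2::real) powr (1 / p)"
    have c: "0 < c" "c < 1" using p powr_less_mono2[of "1 / p" "1 / 2" 1] by (simp_all add: c_def)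
    have "(\<lambda>i. R * (1/2)^i) \<longlonglongrightarrow> R * 0"
      by (intro tendsto_mult tendsto_const LIMSEQ_power_zero) simp
    then have "\<forall>\<^sub>F i in sequentially. R * (1/2)^i < 1"
      by (rule order_tendstoD(2)) simp
    \<comment> \<open>Once R 2^(-i) is below 1, the minimum in \<rho> is the power and not the
      truncation value; c is the ratio 1/2 after taking the p-th root.\<close>
    then have ev: "\<forall>\<^sub>F i in sequentially. norm (v (\<kappa> (Suc i)) x - v (\<kappa> i) x) \<le> R powr (1 / p) * c ^ i"
    proof eventually_elim
      case (elim i)
      then have "\<bar>v (\<kappa> (Suc i)) x - v (\<kappa> i) x\<bar> powr p \<le> R * (1/2)^i"
        using \<rho>R[of i] by (auto simp: \<rho>_def min_def split: if_splits)
      then have "(\<bar>v (\<kappa> (Suc i)) x - v (\<kappa> i) x\<bar> powr p) powr (1 / p) \<le> (R * (1/2)^i) powr (1 / p)"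
        using p by (intro powr_mono2) auto
      also have "\<dots> = R powr (1 / p) * c ^ i"
        using R unfolding c_def
        by (subst powr_mult) (auto simp: powr_powr powr_realpow[symmetric] mult.commute simp del: powr_realpow)
      finally show ?case using p by (simp add: powr_powr)
    qed
    have "summable (\<lambda>i. R powr (1 / p) * c ^ i)"
      using c by (intro summable_mult summable_geometric) auto
    then have "summable (\<lambda>i. v (\<kappa> (Suc i)) x - v (\<kappa> i) x)"
      by (rule summable_comparison_test_ev[OF ev])
    then have "convergent (\<lambda>n. \<Sum>i<n. v (\<kappa> (Suc i)) x - v (\<kappa> i) x)"
      by (simp add: summable_iff_convergent)
    then have "convergent (\<lambda>n. v (\<kappa> n) x - v (\<kappa> 0) x)"
      by (subst (asm) sum_lessThan_telescope)
    then obtain L where "(\<lambda>n. v (\<kappa> n) x - v (\<kappa> 0) x) \<longlonglongrightarrow> L" by (auto simp: convergent_def)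
    from tendsto_add[OF this tendsto_const[of "v (\<kappa> 0) x"]]
    show "convergent (\<lambda>j. v (\<kappa> j) x)" by (auto simp: convergent_def)
  qed
  with \<kappa> show ?thesis by blast
qed

lemma cube_average_measurable [measurable]:
  fixes u :: "real^'n \<Rightarrow> real"
  assumes [measurable]: "u \<in> borel_measurable borel"
  shows "cube_average m u \<in> borel_measurable borel"
proof -
  have [measurable]: "(\<lambda>y::real^'n. y $ i) \<in> borel_measurable borel" for i
    by (intro borel_measurable_continuous_onI continuous_intros)
  \<comment> \<open>The indicator is spelled out as a function of both variables: measurability of
    an integral with parameter x rests on joint measurability in x and y.\<close>
  have "(\<lambda>(x, y). (if \<forall>i. \<lfloor>m * y$i\<rfloor> = \<lfloor>m * x$i\<rfloor> then 1 else 0) * u y)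
    \<in> borel_measurable (borel \<Otimes>\<^sub>M lborel)"
    by measurable
  then have "(\<lambda>x. m ^ CARD('n) * (LINT y|lborel. (if \<forall>i. \<lfloor>m * y$i\<rfloor> = \<lfloor>m * x$i\<rfloor> then 1 else 0) * u y))
    \<in> borel_measurable borel"
    by (intro borel_measurable_times borel_measurable_const lborel.borel_measurable_lebesgue_integral)
  also have "(\<lambda>x. m ^ CARD('n) * (LINT y|lborel. (if \<forall>i. \<lfloor>m * y$i\<rfloor> = \<lfloor>m * x$i\<rfloor> then 1 else 0) * u y))
    = cube_average m u"
    unfolding cube_average_def cube_def indicator_def by (simp add: of_bool_def)
  finally show ?thesis .
qed

text \<open>At scale i the average at x depends only on the integer vector \<open>fl i x\<close>, so
  the averages at all scales form a family with countable index set. Each member is bounded in k, so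
  a diagonal subsequence converges at every index, hence for every x and not just almost every
  x.\<close>

lemma cube_averages_convergent_subsequence:
  fixes u :: "nat \<Rightarrow> real^'n \<Rightarrow> real"
  assumes meas: "\<And>k. u k \<in> borel_measurable borel" and P: "1 \<le> P" and N: "0 \<le> N"
    and bound: "\<And>k. (\<integral>\<^sup>+y. ennreal (\<bar>u k y\<bar> powr P) \<partial>lborel) \<le> ennreal N"
  shows "\<exists>\<kappa>::nat \<Rightarrow> nat. strict_mono \<kappa> \<and>
    (\<forall>i x. convergent (\<lambda>k. cube_average (real (Suc i)) (u (\<kappa> k)) x))"
proof -
  define rep :: "nat \<Rightarrow> int^'n \<Rightarrow> real^'n" where "rep i z = (\<chi> j. of_int (z$j) / real (Suc i))" for i z
  define fl :: "nat \<Rightarrow> real^'n \<Rightarrow> int^'n" where "fl i x = (\<chi> j. \<lfloor>real (Suc i) * x$j\<rfloor>)" for i x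
  have cube_rep: "cube (real (Suc i)) (rep i (fl i x)) = cube (real (Suc i)) x" for i x
    by (simp add: cube_def rep_def fl_def del: of_nat_Suc)
  then have avg_rep: "cube_average (real (Suc i)) w (rep i (fl i x)) = cube_average (real (Suc i)) w x" for i w x
    by (simp add: cube_average_def)
  \<comment> \<open>Dividing by \<open>b i\<close> makes the bound uniform over the scales; the
    added 1 keeps the divisor positive when N = 0.\<close>
  define b where "b i = (real (Suc i) ^ CARD('n) * N) powr (1 / P) + 1" for i
  have b: "0 < b i" for i by (simp add: b_def add_nonneg_pos)
  define f where "f k iz = cube_average (real (Suc (fst iz))) (u k) (rep (fst iz) (snd iz)) / b (fst iz)" for k iz
  have f1: "norm (f k iz) \<le> 1" for k iz
    using cube_average_le[OF meas _ P N bound, of "real (Suc (fst iz))" k "rep (fst iz) (snd iz)"] b[of "fst iz"]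
    by (auto simp: f_def b_def)
  obtain \<kappa> :: "nat \<Rightarrow> nat" where \<kappa>: "strict_mono \<kappa>" "\<And>iz. \<exists>l. (\<lambda>n. f (\<kappa> n) iz) \<longlonglongrightarrow> l"
    by (rule function_convergent_subsequence[of "UNIV :: (nat \<times> (int^'n)) set" f 1]) (use f1 in \<open>simp_all only: UNIV_I countableI_type\<close>)
  have "convergent (\<lambda>k. cube_average (real (Suc i)) (u (\<kappa> k)) x)" for i x
  proof -
    obtain l where "(\<lambda>n. f (\<kappa> n) (i, fl i x)) \<longlonglongrightarrow> l" using \<kappa>(2) by blast
    from tendsto_mult[OF tendsto_const[of "b i"] this] b[of i]
    show ?thesis unfolding f_def by (auto simp: convergent_def avg_rep simp del: of_nat_Suc)
  qed
  with \<kappa>(1) show ?thesis by blast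
qed

text \<open>Let l_i be the limit of the averages at scale i. Then v_k - l_i splits into v_k minus
  its average, small in L^p uniformly in k by \<open>cube_average_close\<close>, and the average
  minus l_i, which tends to 0 pointwise. The scale is fixed first, from \<epsilon> and the uniform
  bound G, and the index k afterwards.\<close>

lemma gagliardo_bounded_AE_convergent_subsequence:
  fixes u :: "nat \<Rightarrow> real^'n \<Rightarrow> real"
  assumes meas [measurable]: "\<And>k. u k \<in> borel_measurable borel"
    and P: "1 \<le> P" and N: "0 \<le> N" and p: "1 \<le> p" and s: "0 < s" and G: "0 \<le> G"
    and bound: "\<And>k. (\<integral>\<^sup>+y. ennreal (\<bar>u k y\<bar> powr P) \<partial>lborel) \<le> ennreal N"
    and gag: "\<And>k. gagliardo_integral s p (u k) \<le> ennreal G"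
  shows "\<exists>\<kappa>::nat \<Rightarrow> nat. strict_mono \<kappa> \<and> (AE x in lborel. convergent (\<lambda>j. u (\<kappa> j) x))"
proof -
  have "\<exists>\<kappa>::nat \<Rightarrow> nat. strict_mono \<kappa> \<and>
    (\<forall>i x. convergent (\<lambda>k. cube_average (real (Suc i)) (u (\<kappa> k)) x))"
    by (rule cube_averages_convergent_subsequence[of u P N]) (fact meas P N bound)+
  then obtain \<kappa> :: "nat \<Rightarrow> nat" where \<kappa>: "strict_mono \<kappa>"
    and conv: "\<And>i x. convergent (\<lambda>k. cube_average (real (Suc i)) (u (\<kappa> k)) x)"
    by auto
  define v where "v k = u (\<kappa> k)" for k
  have [measurable]: "v k \<in> borel_measurable borel" for k by (simp add: v_def)
  define a where "a i k = cube_average (real (Suc i)) (v k)" for i k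
  have [measurable]: "a i k \<in> borel_measurable borel" for i k by (simp add: a_def)
  define l where "l i x = lim (\<lambda>k. a i k x)" for i x
  have al: "(\<lambda>k. a i k x) \<longlonglongrightarrow> l i x" for i x
    using conv[of i x] by (simp add: l_def a_def v_def convergent_LIMSEQ_iff)
  have [measurable]: "l i \<in> borel_measurable borel" for i
    by (rule borel_measurable_LIMSEQ_metric[of "a i"]) (simp_all add: al)
  \<comment> \<open>Lebesgue measure is infinite, so the constant 1 is no integrable majorant of the
    truncated differences; a positive integrable density is. Capping it at 1 lets it be dropped from
    the L^p part.\<close>
  obtain h :: "real^'n \<Rightarrow> ennreal" where [measurable]: "h \<in> borel_measurable borel"
    and h: "integral\<^sup>N lborel h \<noteq> \<infinity>" "\<And>x. 0 < h x \<and> h x < \<infinity>"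
    using sigma_finite_measure.Ex_finite_integrable_function[OF sigma_finite_lborel] by auto
  define g where "g x = min 1 (enn2real (h x))" for x
  have [measurable]: "g \<in> borel_measurable borel" unfolding g_def by measurable
  have g: "0 < g x" "g x \<le> 1" "ennreal (g x) \<le> h x" for x
  proof -
    obtain c where "0 < c" "h x = ennreal c" using h(2)[of x] by (cases "h x") auto
    then show "0 < g x" "g x \<le> 1" "ennreal (g x) \<le> h x" by (auto simp: g_def intro!: ennreal_leI)
  qed
  have gfin: "(\<integral>\<^sup>+x. ennreal (g x) \<partial>lborel) < \<infinity>"
    using nn_integral_mono[of lborel "\<lambda>x. ennreal (g x)" h] g(3) h(1) by (auto simp: top.not_eq_extremum intro: le_less_trans)
  define C where "C = real CARD('n) powr (real CARD('n) + s * p)"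
  have C: "0 < C" by (simp add: C_def)
  have "\<exists>\<kappa>'::nat \<Rightarrow> nat. strict_mono \<kappa>' \<and> (AE x in lborel. convergent (\<lambda>j. v (\<kappa>' j) x))"
  proof (rule AE_convergent_subsequence[of _ _ g])
    fix \<epsilon> :: real assume \<epsilon>: "0 < \<epsilon>"
    \<comment> \<open>The 2^p comes from \<open>min_one_powr_add_le\<close>, the other 2 from the
      two parts of the splitting.\<close>
    define \<delta> where "\<delta> = \<epsilon> / (2 * 2 powr p)"
    have \<delta>: "0 < \<delta>" using \<epsilon> by (simp add: \<delta>_def)
    have "(\<lambda>i. C * real (Suc i) powr (- (s * p)) * G) \<longlonglongrightarrow> C * 0 * G"
      using s p by (intro tendsto_mult tendsto_const tendsto_neg_powr filterlim_compose[OF filterlim_real_sequentially filterlim_Suc]) auto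
    then have "\<forall>\<^sub>F i in sequentially. C * real (Suc i) powr (- (s * p)) * G < \<delta>"
      by (rule order_tendstoD(2)) (use \<delta> in simp)
    then obtain i where i: "C * real (Suc i) powr (- (s * p)) * G < \<delta>"
      by (auto simp: eventually_sequentially)
    have "(\<lambda>k. \<integral>\<^sup>+x. ennreal (min 1 (\<bar>a i k x - l i x\<bar> powr p) * g x) \<partial>lborel)
      \<longlonglongrightarrow> (\<integral>\<^sup>+x. ennreal (min 1 (\<bar>0\<bar> powr p) * g x) \<partial>lborel)"
    proof (rule nn_integral_dominated_convergence[where w = "\<lambda>x. ennreal (g x)"])
      show "AE x in lborel. ennreal (min 1 (\<bar>a i k x - l i x\<bar> powr p) * g x) \<le> ennreal (g x)" for k
        using g(1) by (auto intro!: ennreal_leI simp: less_imp_le mult_left_le_one_le)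
      have "(\<lambda>k. ennreal (min 1 (\<bar>a i k x - l i x\<bar> powr p) * g x)) \<longlonglongrightarrow> ennreal (min 1 (\<bar>0\<bar> powr p) * g x)" for x
        using al[of i x] p LIM_zero[OF al[of i x]]
        by (intro tendsto_ennrealI tendsto_mult tendsto_min tendsto_powr' tendsto_rabs tendsto_const) auto
      then show "AE x in lborel. (\<lambda>k. ennreal (min 1 (\<bar>a i k x - l i x\<bar> powr p) * g x)) \<longlonglongrightarrow> ennreal (min 1 (\<bar>0\<bar> powr p) * g x)"
        by simp
    qed (use gfin in auto)
    then have "\<forall>\<^sub>F k in sequentially. (\<integral>\<^sup>+x. ennreal (min 1 (\<bar>a i k x - l i x\<bar> powr p) * g x) \<partial>lborel) < ennreal \<delta>"
      by (rule order_tendstoD(2)) (use \<delta> in simp)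
    then obtain J where J: "\<And>k. J \<le> k \<Longrightarrow>
        (\<integral>\<^sup>+x. ennreal (min 1 (\<bar>a i k x - l i x\<bar> powr p) * g x) \<partial>lborel) \<le> ennreal \<delta>"
      unfolding eventually_sequentially by (auto intro: less_imp_le)
    have "(\<integral>\<^sup>+x. ennreal (min 1 (\<bar>v k x - l i x\<bar> powr p) * g x) \<partial>lborel) \<le> ennreal \<epsilon>" if k: "J \<le> k" for k
    proof -
      have fin: "(\<integral>\<^sup>+y. ennreal (\<bar>v k y\<bar> powr P) \<partial>lborel) < \<infinity>"
        using bound[of "\<kappa> k"] unfolding v_def by (rule le_less_trans) simp
      have "(\<integral>\<^sup>+x. ennreal (\<bar>v k x - a i k x\<bar> powr p) \<partial>lborel)
        \<le> (\<integral>\<^sup>+x. ennreal (C * real (Suc i) powr (- (s * p))) * gagliardo_slice s p (v k) x \<partial>lborel)"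
        unfolding a_def C_def
        by (intro nn_integral_mono cube_average_close p s cube_integrable[OF _ _ P fin]) auto
      also have "\<dots> = ennreal (C * real (Suc i) powr (- (s * p))) * gagliardo_integral s p (v k)"
        unfolding gagliardo_integral_eq_slice by (intro nn_integral_cmult) auto
      also have "\<dots> \<le> ennreal (C * real (Suc i) powr (- (s * p))) * ennreal G"
        unfolding v_def by (intro mult_left_mono gag) auto
      also have "\<dots> = ennreal (C * real (Suc i) powr (- (s * p)) * G)"
        using C G by (simp flip: ennreal_mult)
      also have "\<dots> \<le> ennreal \<delta>" using i by (intro ennreal_leI) simp
      finally have close: "(\<integral>\<^sup>+x. ennreal (\<bar>v k x - a i k x\<bar> powr p) \<partial>lborel) \<le> ennreal \<delta>" .
      have "(\<integral>\<^sup>+x. ennreal (min 1 (\<bar>v k x - l i x\<bar> powr p) * g x) \<partial>lborel)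
        \<le> (\<integral>\<^sup>+x. ennreal (2 powr p) * (ennreal (\<bar>v k x - a i k x\<bar> powr p)
              + ennreal (min 1 (\<bar>a i k x - l i x\<bar> powr p) * g x)) \<partial>lborel)"
      proof (intro nn_integral_mono)
        fix x
        have "min 1 (\<bar>v k x - l i x\<bar> powr p) * g x
          \<le> 2 powr p * (min 1 (\<bar>v k x - a i k x\<bar> powr p) + min 1 (\<bar>a i k x - l i x\<bar> powr p)) * g x"
          using min_one_powr_add_le[of p "v k x - a i k x" "a i k x - l i x"] p g(1)[of x]
          by (intro mult_right_mono) auto
        also have "\<dots> = 2 powr p * (min 1 (\<bar>v k x - a i k x\<bar> powr p) * g x + min 1 (\<bar>a i k x - l i x\<bar> powr p) * g x)"
          by (simp add: algebra_simps)
        also have "\<dots> \<le> 2 powr p * (\<bar>v k x - a i k x\<bar> powr p * 1 + min 1 (\<bar>a i k x - l i x\<bar> powr p) * g x)"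
          using g[of x] by (intro mult_left_mono add_mono mult_mono) auto
        finally have "ennreal (min 1 (\<bar>v k x - l i x\<bar> powr p) * g x) \<le> ennreal (2 powr p *
            (\<bar>v k x - a i k x\<bar> powr p + min 1 (\<bar>a i k x - l i x\<bar> powr p) * g x))"
          by (intro ennreal_leI) simp
        then show "ennreal (min 1 (\<bar>v k x - l i x\<bar> powr p) * g x) \<le> ennreal (2 powr p) *
            (ennreal (\<bar>v k x - a i k x\<bar> powr p) + ennreal (min 1 (\<bar>a i k x - l i x\<bar> powr p) * g x))"
          using g(1)[of x] by (simp add: ennreal_mult)
      qed
      also have "\<dots> = ennreal (2 powr p) * ((\<integral>\<^sup>+x. ennreal (\<bar>v k x - a i k x\<bar> powr p) \<partial>lborel)
              + (\<integral>\<^sup>+x. ennreal (min 1 (\<bar>a i k x - l i x\<bar> powr p) * g x) \<partial>lborel))"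
        by (subst nn_integral_cmult) (auto simp: nn_integral_add)
      also have "\<dots> \<le> ennreal (2 powr p) * (ennreal \<delta> + ennreal \<delta>)"
        by (intro mult_left_mono add_mono close J k) auto
      also have "\<dots> = ennreal \<epsilon>" using \<delta> by (simp add: \<delta>_def flip: ennreal_plus ennreal_mult)
      finally show ?thesis .
    qed
    then show "\<exists>l\<in>borel_measurable lborel. \<exists>J. \<forall>j\<ge>J.
       (\<integral>\<^sup>+x. ennreal (min 1 (\<bar>v j x - l x\<bar> powr p) * g x) \<partial>lborel) \<le> ennreal \<epsilon>"
      by (intro bexI[of _ "l i"]) auto
  qed (use g p in auto)
  then obtain \<kappa>' :: "nat \<Rightarrow> nat" where \<kappa>': "strict_mono \<kappa>'" "AE x in lborel. convergent (\<lambda>j. v (\<kappa>' j) x)"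
    by blast
  then have "strict_mono (\<lambda>j. \<kappa> (\<kappa>' j)) \<and> (AE x in lborel. convergent (\<lambda>j. u (\<kappa> (\<kappa>' j)) x))"
    using \<kappa> by (simp add: v_def strict_mono_def)
  then show ?thesis by (rule exI[of _ "\<lambda>j. \<kappa> (\<kappa>' j)"])
qed

section \<open>Smooth functions, increments and weights\<close>

lemma C1_c_continuous: "u \<in> C1_c \<Longrightarrow> continuous_on UNIV u"
  unfolding C1_c_def gderiv_def
  by (auto intro!: continuous_at_imp_continuous_on dest: has_derivative_continuous)

lemma C1_c_borel: "u \<in> C1_c \<Longrightarrow> u \<in> borel_measurable borel"
  by (intro borel_measurable_continuous_onI C1_c_continuous)

lemma C1_c_linear:
  assumes u: "u \<in> C1_c" and v: "v \<in> C1_c"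
  shows "(\<lambda>x. a * u x + b * v x) \<in> C1_c"
proof -
  obtain u' v' where u': "\<And>x. GDERIV u x :> u' x" "continuous_on UNIV u'"
    and v': "\<And>x. GDERIV v x :> v' x" "continuous_on UNIV v'"
    using u v by (auto simp: C1_c_def)
  have bounded: "bounded {x. u x \<noteq> 0}" "bounded {x. v x \<noteq> 0}"
    using u v by (auto simp: C1_c_def compact_closure)
  have "GDERIV (\<lambda>x. a * u x + b * v x) x :> a *\<^sub>R u' x + b *\<^sub>R v' x" for x
    using u'(1)[of x] v'(1)[of x] unfolding gderiv_def
    by (auto intro!: derivative_eq_intros simp: inner_add_right)
  moreover have "continuous_on UNIV (\<lambda>x. a *\<^sub>R u' x + b *\<^sub>R v' x)"
    using u' v' by (intro continuous_intros) auto
  moreover have "bounded {x. a * u x + b * v x \<noteq> 0}"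
    by (rule bounded_subset[of "{x. u x \<noteq> 0} \<union> {x. v x \<noteq> 0}"]) (use bounded in auto)
  ultimately show ?thesis
    unfolding C1_c_def compact_closure
    by (intro CollectI conjI exI[of _ "\<lambda>x. a *\<^sub>R u' x + b *\<^sub>R v' x"]) auto
qed

text \<open>The a priori finiteness on which the absorption in
  \<open>fractional_Sobolev_inequality\<close> rests.\<close>

lemma C1_c_powr_integral_finite:
  assumes u: "u \<in> C1_c" and P: "0 < P"
  shows "(\<integral>\<^sup>+x. ennreal (\<bar>u x\<bar> powr P) \<partial>lborel) < \<infinity>"
proof -
  let ?S = "closure {x. u x \<noteq> 0}"
  have S: "compact ?S" using u by (simp add: C1_c_def)
  have "continuous_on ?S (\<lambda>x. \<bar>u x\<bar> powr P)"
    using P continuous_on_subset[OF C1_c_continuous[OF u]]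
    by (intro continuous_on_powr' continuous_on_rabs continuous_on_const) auto
  then have "integrable lborel (\<lambda>x. indicator ?S x *\<^sub>R (\<bar>u x\<bar> powr P))"
    by (rule borel_integrable_compact[OF S])
  also have "(\<lambda>x. indicator ?S x *\<^sub>R (\<bar>u x\<bar> powr P)) = (\<lambda>x. \<bar>u x\<bar> powr P)"
    using closure_subset[of "{x. u x \<noteq> 0}"] by (auto simp: indicator_def fun_eq_iff)
  finally show ?thesis by (simp add: integrable_iff_bounded)
qed

text \<open>With this weight on pairs the Gagliardo seminorm of u becomes the weighted L^p norm of
  its increment, so that Minkowski and Fatou carry over from \<open>weighted_measure\<close>. On the
  diagonal the weight is 1 / 0 = 0.\<close>

definition gagliardo_weight :: "real \<Rightarrow> real \<Rightarrow> (real^'n) \<times> (real^'n) \<Rightarrow> real" where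
  "gagliardo_weight s p z = 1 / norm (fst z - snd z) powr (real CARD('n) + s * p)"

definition increment :: "(real^'n \<Rightarrow> real) \<Rightarrow> (real^'n) \<times> (real^'n) \<Rightarrow> real" where
  "increment u z = u (fst z) - u (snd z)"

lemma increment_measurable [measurable]:
  assumes [measurable]: "u \<in> borel_measurable borel"
  shows "increment u \<in> borel_measurable (lborel \<Otimes>\<^sub>M lborel)"
  unfolding increment_def by measurable

lemma increment_linear: "increment (\<lambda>x. a * u x + b * v x) = (\<lambda>z. a * increment u z + b * increment v z)"
  by (simp add: increment_def fun_eq_iff algebra_simps)

lemma gagliardo_weight_measurable [measurable]:
  "gagliardo_weight s p \<in> borel_measurable (lborel \<Otimes>\<^sub>M lborel)"
  unfolding gagliardo_weight_def by measurable

lemma weighted_measure_gagliardo: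
  "1 \<le> p \<Longrightarrow> weighted_measure (lborel \<Otimes>\<^sub>M lborel) p (gagliardo_weight s p)"
  by unfold_locales (auto simp: gagliardo_weight_def[of s p])

text \<open>Tonelli; integrals over \<open>lebesgue\<close> and \<open>lborel\<close> agree because
  the former is the completion of the latter.\<close>

lemma gagliardo_integral_eq:
  assumes [measurable]: "u \<in> borel_measurable borel"
  shows "gagliardo_integral s p u = Lp_integral (lborel \<Otimes>\<^sub>M lborel) p (gagliardo_weight s p) (increment u)"
  unfolding Lp_integral_def
  by (subst lborel_pair.nn_integral_snd[symmetric])
     (auto simp: gagliardo_integral_def nn_integral_completion gagliardo_weight_def increment_def)

lemma gagliardo_seminorm_eq:
  assumes "u \<in> borel_measurable borel"
  shows "gagliardo_seminorm s p u = Lp_norm (lborel \<Otimes>\<^sub>M lborel) p (gagliardo_weight s p) (increment u)"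
  using assms by (simp add: gagliardo_seminorm_def Lp_norm_def gagliardo_integral_eq)

lemma weighted_integral_eq: "weighted_integral q w = Lp_integral lebesgue q w"
  by (simp add: fun_eq_iff weighted_integral_def Lp_integral_def)

lemma weighted_norm_eq: "weighted_norm q w = Lp_norm lebesgue q w"
  by (simp add: fun_eq_iff weighted_norm_def Lp_norm_def weighted_integral_eq)

text \<open>After K \<le> \<epsilon> V^\<tau> this is the weighted arithmetic-geometric mean
  inequality for |t|^q V and |t|^P with weights \<tau> and 1 - \<tau>.\<close>

lemma powr_interpolation_le:
  fixes t V K q r P \<tau> \<epsilon> :: real
  assumes qrP: "0 < q" "q \<le> r" "r < P" and \<tau>: "\<tau> = (P - r) / (P - q)"
    and V: "0 < V" and K: "K * V powr (- \<tau>) \<le> \<epsilon>" and \<epsilon>: "0 \<le> \<epsilon>"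
  shows "\<bar>t\<bar> powr r * K \<le> \<epsilon> * (\<bar>t\<bar> powr q * V + \<bar>t\<bar> powr P)"
proof (cases "t = 0")
  case False
  then have t: "0 < \<bar>t\<bar>" by simp
  have \<tau>01: "0 < \<tau>" "\<tau> \<le> 1" using qrP by (auto simp: \<tau>)
  have exp_eq: "q * \<tau> + P * (1 - \<tau>) = r"
  proof -
    have "\<tau> * (P - q) = P - r" using qrP by (simp add: \<tau>)
    then show ?thesis by (simp add: algebra_simps)
  qed
  have "K \<le> \<epsilon> * V powr \<tau>" using K V by (simp add: powr_minus field_simps)
  then have "\<bar>t\<bar> powr r * K \<le> \<epsilon> * (\<bar>t\<bar> powr r * V powr \<tau>)"
    using mult_left_mono[of K "\<epsilon> * V powr \<tau>" "\<bar>t\<bar> powr r"] by (simp add: mult_ac)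
  also have "\<bar>t\<bar> powr r * V powr \<tau> = (\<bar>t\<bar> powr q * V) powr \<tau> * (\<bar>t\<bar> powr P) powr (1 - \<tau>)"
    using t V by (simp add: powr_mult powr_powr exp_eq[symmetric] powr_add)
  also have "\<epsilon> * \<dots> \<le> \<epsilon> * (\<tau> * (\<bar>t\<bar> powr q * V) + (1 - \<tau>) * \<bar>t\<bar> powr P)"
    using \<tau>01 t V \<epsilon> by (intro mult_left_mono Youngs_inequality_0) auto
  also have "\<dots> \<le> \<epsilon> * (1 * (\<bar>t\<bar> powr q * V) + 1 * \<bar>t\<bar> powr P)"
    using \<tau>01 V \<epsilon> by (intro mult_left_mono add_mono mult_right_mono) auto
  finally show ?thesis by simp
qed (use qrP in simp)

text \<open>Arithmetic-geometric mean with weights r/P and (P-r)/P. The exponent -r/(P-r) of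
  \<epsilon>, multiplied by the second weight, is -r/P and cancels the power of \<epsilon> from the
  first term.\<close>

lemma powr_Young_le:
  fixes t K r P \<epsilon> :: real
  assumes r: "0 < r" "r < P" and K: "0 < K" and \<epsilon>: "0 < \<epsilon>"
  shows "\<bar>t\<bar> powr r * K \<le> \<epsilon> * \<bar>t\<bar> powr P + \<epsilon> powr (- (r / (P - r))) * K powr (P / (P - r))"
proof (cases "t = 0")
  case False
  then have t: "0 < \<bar>t\<bar>" by simp
  define \<alpha> where "\<alpha> = r / P"
  define \<beta> where "\<beta> = (P - r) / P"
  have ab: "0 < \<alpha>" "0 < \<beta>" "\<alpha> \<le> 1" "\<beta> \<le> 1" "\<alpha> + \<beta> = 1" using r by (auto simp: \<alpha>_def \<beta>_def field_simps)
  have e: "P * \<alpha> = r" "- (r / (P - r)) * \<beta> = - \<alpha>" "P / (P - r) * \<beta> = 1"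
    using r by (auto simp: \<alpha>_def \<beta>_def)
  let ?a = "\<epsilon> * \<bar>t\<bar> powr P" and ?b = "\<epsilon> powr (- (r / (P - r))) * K powr (P / (P - r))"
  have pos: "0 < ?a" "0 < ?b" using t K \<epsilon> by auto
  have "?a powr \<alpha> = \<epsilon> powr \<alpha> * \<bar>t\<bar> powr r"
    using t \<epsilon> by (simp add: powr_mult powr_powr e)
  moreover have "?b powr \<beta> = \<epsilon> powr (- \<alpha>) * K"
  proof -
    have "?b powr \<beta> = (\<epsilon> powr (- (r / (P - r)))) powr \<beta> * (K powr (P / (P - r))) powr \<beta>"
      by (rule powr_mult)
    also have "\<dots> = \<epsilon> powr (- \<alpha>) * K powr 1" by (simp only: powr_powr e)
    finally show ?thesis using K by simp
  qed
  moreover have "\<epsilon> powr \<alpha> * \<epsilon> powr (- \<alpha>) = 1"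
    using \<epsilon> by (simp flip: powr_add)
  ultimately have "\<bar>t\<bar> powr r * K = ?a powr \<alpha> * ?b powr \<beta>"
    by (metis (no_types, opaque_lifting) mult.assoc mult.commute mult_1)
  also have "\<dots> \<le> \<alpha> * ?a + \<beta> * ?b"
    using ab pos by (intro Youngs_inequality_0) auto
  also have "\<dots> \<le> 1 * ?a + 1 * ?b"
    using ab pos by (intro add_mono mult_right_mono) auto
  finally show ?thesis by simp
qed (use K in simp)

text \<open>On a set of finite measure a larger Lebesgue exponent implies a smaller one, by a^c
  \<le> 1 + a^t'. Applied with c = P / (P - r), the power that Young's inequality leaves on
  K.\<close>

lemma Lp_on_powr_integral_finite:
  fixes K :: "real^'n \<Rightarrow> real"
  assumes t: "ennreal c < t" and c: "0 < c" and \<Omega>: "\<Omega> \<in> sets lebesgue" "emeasure lebesgue \<Omega> < \<infinity>"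
    and K: "K \<in> Lp_on t \<Omega>"
  shows "(\<integral>\<^sup>+x. ennreal (indicator \<Omega> x * \<bar>K x\<bar> powr c) \<partial>lebesgue) < \<infinity>"
proof -
  have [measurable]: "K \<in> borel_measurable (lebesgue_on \<Omega>)" using K by (simp add: Lp_on_def)
  have const: "(\<integral>\<^sup>+x. ennreal a \<partial>lebesgue_on \<Omega>) < \<infinity>" for a
    using \<Omega> by (simp add: emeasure_restrict_space ennreal_mult_less_top)
  have "(\<integral>\<^sup>+x. ennreal (\<bar>K x\<bar> powr c) \<partial>lebesgue_on \<Omega>) < \<infinity>"
  proof (cases "t = \<infinity>")
    case True
    then obtain C where C: "AE x in lebesgue_on \<Omega>. \<bar>K x\<bar> \<le> C" using K by (auto simp: Lp_on_def)
    have "(\<integral>\<^sup>+x. ennreal (\<bar>K x\<bar> powr c) \<partial>lebesgue_on \<Omega>) \<le> (\<integral>\<^sup>+x. ennreal (C powr c) \<partial>lebesgue_on \<Omega>)"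
      by (rule nn_integral_mono_AE, use C in eventually_elim) (use c in \<open>auto intro!: ennreal_leI powr_mono2\<close>)
    also note const
    finally show ?thesis .
  next
    case False
    define t' where "t' = enn2real t"
    have tt': "t = ennreal t'" using False by (simp add: t'_def ennreal_enn2real_if)
    have t': "c < t'" using t c unfolding tt' by (simp add: ennreal_less_iff)
    have "(\<integral>\<^sup>+x. ennreal (\<bar>K x\<bar> powr c) \<partial>lebesgue_on \<Omega>)
      \<le> (\<integral>\<^sup>+x. ennreal 1 + ennreal (\<bar>K x\<bar> powr t') \<partial>lebesgue_on \<Omega>)"
    proof (intro nn_integral_mono)
      fix x
      have "\<bar>K x\<bar> powr c \<le> 1 + \<bar>K x\<bar> powr t'"
      proof (cases "\<bar>K x\<bar> \<le> 1")
        case True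
        then have "\<bar>K x\<bar> powr c \<le> 1" using c by (intro powr_le1) auto
        then show ?thesis by (simp add: add_increasing2)
      next
        case False
        then have "\<bar>K x\<bar> powr c \<le> \<bar>K x\<bar> powr t'" using t' by (intro powr_mono) auto
        then show ?thesis by linarith
      qed
      then show "ennreal (\<bar>K x\<bar> powr c) \<le> ennreal 1 + ennreal (\<bar>K x\<bar> powr t')"
        by (subst ennreal_plus[symmetric]) (rule ennreal_leI | simp)+
    qed
    also have "\<dots> = (\<integral>\<^sup>+x. ennreal 1 \<partial>lebesgue_on \<Omega>) + (\<integral>\<^sup>+x. ennreal (\<bar>K x\<bar> powr t') \<partial>lebesgue_on \<Omega>)"
      by (intro nn_integral_add) auto
    also have "\<dots> < \<infinity>"
      using const[of 1] K False by (auto simp: Lp_on_def t'_def)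
    finally show ?thesis .
  qed
  also have "(\<integral>\<^sup>+x. ennreal (\<bar>K x\<bar> powr c) \<partial>lebesgue_on \<Omega>)
      = (\<integral>\<^sup>+x. ennreal (\<bar>K x\<bar> powr c) * indicator \<Omega> x \<partial>lebesgue)"
    using \<Omega> by (subst nn_integral_restrict_space) auto
  also have "\<dots> = (\<integral>\<^sup>+x. ennreal (indicator \<Omega> x * \<bar>K x\<bar> powr c) \<partial>lebesgue)"
    by (intro nn_integral_cong) (auto simp: indicator_def)
  finally show ?thesis .
qed

text \<open>
  Off the set \<open>{K V^(-\<tau>) \<ge> \<epsilon>}\<close> the weight \<open>K\<close> is interpolated between \<open>V\<close> and \<open>1\<close>; on that set, which has
  finite measure, Young's inequality with exponents \<open>P/r\<close> and \<open>P/(P-r)\<close> applies.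
\<close>

lemma weight_domination:
  fixes K V :: "real^'n \<Rightarrow> real"
  assumes qrP: "1 \<le> q" "q \<le> r" "r < P"
    and [measurable]: "K \<in> borel_measurable lebesgue" "V \<in> borel_measurable lebesgue"
    and K: "\<forall>x. 0 < K x" and V: "\<forall>x. 0 < V x"
    and Lt: "\<exists>t::ennreal. ennreal (P / (P - r)) < t \<and>
           (\<forall>\<Omega>\<in>sets lebesgue. emeasure lebesgue \<Omega> < \<infinity> \<longrightarrow> K \<in> Lp_on t \<Omega>)"
    and \<tau>: "\<tau> = (P - r) / (P - q)"
    and van: "vanishes_at_infinity (\<lambda>x. K x * V x powr (- \<tau>))"
    and \<epsilon>: "0 < \<epsilon>"
  shows "\<exists>h. h \<in> borel_measurable lebesgue \<and> (\<forall>x. 0 \<le> h x) \<and> (\<integral>\<^sup>+x. ennreal (h x) \<partial>lebesgue) < \<infinity> \<and>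
    (\<forall>x t. \<bar>t\<bar> powr r * K x \<le> \<epsilon> * (\<bar>t\<bar> powr q * V x + \<bar>t\<bar> powr P) + h x)"
proof -
  define \<Omega> where "\<Omega> = {x. \<bar>K x * V x powr (- \<tau>)\<bar> \<ge> \<epsilon>}"
  have "{x \<in> space lebesgue. \<bar>K x * V x powr (- \<tau>)\<bar> \<ge> \<epsilon>} \<in> sets lebesgue"
    by measurable
  then have [measurable]: "\<Omega> \<in> sets lebesgue" by (simp add: \<Omega>_def)
  have fin: "emeasure lebesgue \<Omega> < \<infinity>"
    using van \<epsilon> by (simp add: vanishes_at_infinity_def \<Omega>_def)
  define c where "c = P / (P - r)"
  have c: "0 < c" using qrP by (simp add: c_def)
  have int: "(\<integral>\<^sup>+x. ennreal (indicator \<Omega> x * \<bar>K x\<bar> powr c) \<partial>lebesgue) < \<infinity>"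
  proof -
    obtain t where t: "ennreal c < t"
      and K_Lt: "\<forall>\<Omega>\<in>sets lebesgue. emeasure lebesgue \<Omega> < \<infinity> \<longrightarrow> K \<in> Lp_on t \<Omega>"
      using Lt unfolding c_def[symmetric] by (elim exE conjE) (rule that)
    have "K \<in> Lp_on t \<Omega>" using K_Lt fin by (metis \<open>\<Omega> \<in> sets lebesgue\<close>)
    then show ?thesis by (intro Lp_on_powr_integral_finite[OF t c _ fin]) measurable
  qed
  \<comment> \<open>The factor from \<open>powr_Young_le\<close>; h is its last term, cut off
    outside \<Omega>.\<close>
  define b where "b = \<epsilon> powr (- (r / (P - r)))"
  define h where "h x = b * (indicator \<Omega> x * \<bar>K x\<bar> powr c)" for x
  have [measurable]: "h \<in> borel_measurable lebesgue" unfolding h_def by measurable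
  have h0: "0 \<le> h x" for x by (simp add: h_def b_def)
  have "(\<integral>\<^sup>+x. ennreal (h x) \<partial>lebesgue)
      = ennreal b * (\<integral>\<^sup>+x. ennreal (indicator \<Omega> x * \<bar>K x\<bar> powr c) \<partial>lebesgue)"
    unfolding h_def by (subst nn_integral_cmult[symmetric]) (auto simp: ennreal_mult b_def)
  then have "(\<integral>\<^sup>+x. ennreal (h x) \<partial>lebesgue) < \<infinity>"
    using int by (simp add: ennreal_mult_less_top)
  moreover have "\<bar>t\<bar> powr r * K x \<le> \<epsilon> * (\<bar>t\<bar> powr q * V x + \<bar>t\<bar> powr P) + h x" for x t
  proof (cases "x \<in> \<Omega>")
    case True
    have "\<bar>t\<bar> powr r * K x \<le> \<epsilon> * \<bar>t\<bar> powr P + h x"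
      using powr_Young_le[of r P "K x" \<epsilon> t] qrP K[rule_format, of x] \<epsilon> True by (simp add: h_def b_def c_def)
    moreover have "0 \<le> \<epsilon> * (\<bar>t\<bar> powr q * V x)" using \<epsilon> V by (simp add: less_imp_le)
    ultimately show ?thesis by (simp add: distrib_left)
  next
    case False
    then have "K x * V x powr (- \<tau>) \<le> \<epsilon>" by (auto simp: \<Omega>_def)
    then have "\<bar>t\<bar> powr r * K x \<le> \<epsilon> * (\<bar>t\<bar> powr q * V x + \<bar>t\<bar> powr P)"
      using qrP V \<epsilon> by (intro powr_interpolation_le[OF _ _ _ \<tau>]) auto
    then show ?thesis using h0[of x] by simp
  qed
  ultimately show ?thesis
    using h0 by (intro exI[of _ h] conjI allI) measurable
qed

section \<open>Extending a closable compact inclusion to the completion\<close>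

text \<open>Separates the functional analysis from the concrete norms: \<open>compactness\<close>
  and \<open>closability\<close> concern X alone and are transported to the completion. N is
  homogeneous and subadditive only on X, because norms built with \<open>enn2real\<close> misbehave
  where an integral is infinite.\<close>

locale closable_compact_inclusion =
  fixes X :: "(real^'n \<Rightarrow> real) set" and N :: "(real^'n \<Rightarrow> real) \<Rightarrow> real" and r :: real
    and K :: "real^'n \<Rightarrow> real" and C :: real
  assumes r_ge_1: "1 \<le> r"
    and K_measurable [measurable]: "K \<in> borel_measurable lebesgue"
    and K_pos: "\<And>x. 0 < K x"
    and linear: "\<And>u v a b. u \<in> X \<Longrightarrow> v \<in> X \<Longrightarrow> (\<lambda>x. a * u x + b * v x) \<in> X"
    and N_nonneg: "\<And>u. 0 \<le> N u"
    and N_scale: "\<And>u a. u \<in> X \<Longrightarrow> N (\<lambda>x. a * u x) = \<bar>a\<bar> * N u"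
    and N_triangle: "\<And>u v. u \<in> X \<Longrightarrow> v \<in> X \<Longrightarrow> N (\<lambda>x. u x + v x) \<le> N u + N v"
    and inclusion: "\<And>u. u \<in> X \<Longrightarrow> u \<in> weighted_Lp r K"
    and inclusion_le: "\<And>u. u \<in> X \<Longrightarrow> weighted_norm r K u \<le> C * N u"
    and compactness: "\<And>\<sigma> B. (\<And>k. \<sigma> k \<in> X) \<Longrightarrow> (\<And>k::nat. N (\<sigma> k) \<le> B) \<Longrightarrow>
      \<exists>\<kappa>::nat \<Rightarrow> nat. strict_mono \<kappa> \<and>
        (\<exists>w\<in>weighted_Lp r K. (\<lambda>j. weighted_norm r K (\<lambda>x. \<sigma> (\<kappa> j) x - w x)) \<longlonglongrightarrow> 0)"
    and closability: "\<And>\<sigma> B. \<sigma> \<in> cauchy_seqs X N \<Longrightarrow> (\<And>k. N (\<sigma> k) \<le> B) \<Longrightarrow>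
      (\<lambda>k. weighted_norm r K (\<sigma> k)) \<longlonglongrightarrow> 0 \<Longrightarrow>
      (\<lambda>k. N (\<sigma> k)) \<longlonglongrightarrow> 0"
begin

sublocale weighted_measure lebesgue r K
  using r_ge_1 K_pos by unfold_locales (auto intro: less_imp_le)

abbreviation W where "W \<equiv> weighted_Lp r K"
abbreviation nrm where "nrm \<equiv> weighted_norm r K"

lemma W_iff: "f \<in> W \<longleftrightarrow> f \<in> borel_measurable lebesgue \<and> Lp_integral lebesgue r K f < \<infinity>"
  by (simp add: weighted_Lp_def weighted_integral_eq)

lemma W_linear: "f \<in> W \<Longrightarrow> g \<in> W \<Longrightarrow> (\<lambda>x. a * f x + b * g x) \<in> W"
  using Lp_integral_finite_linear by (auto simp: W_iff)

lemma W_diff: "f \<in> W \<Longrightarrow> g \<in> W \<Longrightarrow> (\<lambda>x. f x - g x) \<in> W"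
  using W_linear[of f g 1 "-1"] by simp

lemma nrm_triangle: "f \<in> W \<Longrightarrow> g \<in> W \<Longrightarrow> nrm (\<lambda>x. f x + g x) \<le> nrm f + nrm g"
  using Lp_norm_triangle by (simp add: W_iff weighted_norm_eq)

lemma nrm_nonneg: "0 \<le> nrm f"
  by (simp add: weighted_norm_eq Lp_norm_nonneg)

lemma nrm_scale: "f \<in> W \<Longrightarrow> nrm (\<lambda>x. a * f x) = \<bar>a\<bar> * nrm f"
  using Lp_norm_scale by (simp add: W_iff weighted_norm_eq)

lemma nrm_minus_commute: "nrm (\<lambda>x. f x - g x) = nrm (\<lambda>x. g x - f x)"
  using Lp_norm_uminus[of "\<lambda>x. f x - g x"] by (simp add: weighted_norm_eq)

lemma nrm_diff_triangle:
  "f \<in> W \<Longrightarrow> g \<in> W \<Longrightarrow> h \<in> W \<Longrightarrow> nrm (\<lambda>x. f x - h x) \<le> nrm (\<lambda>x. f x - g x) + nrm (\<lambda>x. g x - h x)"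
  using nrm_triangle[of "\<lambda>x. f x - g x" "\<lambda>x. g x - h x"] W_diff by simp

lemma nrm_eq_0_AE: "f \<in> W \<Longrightarrow> nrm f = 0 \<Longrightarrow> AE x in lebesgue. f x = 0"
  using Lp_norm_eq_0_AE[of f] K_pos by (simp add: W_iff weighted_norm_eq)

lemma X_diff: "u \<in> X \<Longrightarrow> v \<in> X \<Longrightarrow> (\<lambda>x. u x - v x) \<in> X"
  using linear[of u v 1 "-1"] by simp

lemma X_scale: "u \<in> X \<Longrightarrow> (\<lambda>x. a * u x) \<in> X"
  using linear[of u u a 0] by simp

lemma N_minus_commute: "u \<in> X \<Longrightarrow> v \<in> X \<Longrightarrow> N (\<lambda>x. u x - v x) = N (\<lambda>x. v x - u x)"
  using N_scale[OF X_diff, of u v "-1"] by simp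

lemma N_diff_triangle:
  "u \<in> X \<Longrightarrow> v \<in> X \<Longrightarrow> w \<in> X \<Longrightarrow> N (\<lambda>x. u x - w x) \<le> N (\<lambda>x. u x - v x) + N (\<lambda>x. v x - w x)"
  using N_triangle[OF X_diff X_diff, of u v v w] by simp

lemma N_le_diff: "u \<in> X \<Longrightarrow> v \<in> X \<Longrightarrow> N u \<le> N (\<lambda>x. u x - v x) + N v"
  using N_triangle[OF X_diff, of u v v] by simp

lemma N_zero: "u \<in> X \<Longrightarrow> N (\<lambda>x. 0) = 0"
  using N_scale[of u 0] by simp

section \<open>Cauchy sequences in X and their equivalence\<close>

lemma cauchy_seqs_in: "\<sigma> \<in> cauchy_seqs X N \<Longrightarrow> \<sigma> k \<in> X"
  by (simp add: cauchy_seqs_def)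

lemma cauchy_seqsD:
  "\<sigma> \<in> cauchy_seqs X N \<Longrightarrow> 0 < e \<Longrightarrow> \<exists>m. \<forall>j\<ge>m. \<forall>k\<ge>m. N (\<lambda>x. \<sigma> j x - \<sigma> k x) < e"
  by (simp add: cauchy_seqs_def)

lemma cauchy_seqs_bounded:
  assumes \<sigma>: "\<sigma> \<in> cauchy_seqs X N"
  shows "\<exists>B. \<forall>k. N (\<sigma> k) \<le> B"
proof -
  obtain m where m: "\<And>j k. m \<le> j \<Longrightarrow> m \<le> k \<Longrightarrow> N (\<lambda>x. \<sigma> j x - \<sigma> k x) < 1"
    using cauchy_seqsD[OF \<sigma>, of 1] by auto
  have "N (\<sigma> k) \<le> 1 + N (\<sigma> m) + (\<Sum>i<m. N (\<sigma> i))" for k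
  proof (cases "k < m")
    case True
    then have "N (\<sigma> k) \<le> (\<Sum>i<m. N (\<sigma> i))"
      using member_le_sum[of k "{..<m}" "\<lambda>i. N (\<sigma> i)"] N_nonneg by auto
    then show ?thesis using N_nonneg[of "\<sigma> m"] by linarith
  next
    case False
    then have "N (\<sigma> k) \<le> 1 + N (\<sigma> m)"
      using m[of k m] N_le_diff[OF cauchy_seqs_in[OF \<sigma>] cauchy_seqs_in[OF \<sigma>], of k m] by simp
    then show ?thesis using sum_nonneg[of "{..<m}" "\<lambda>i. N (\<sigma> i)"] N_nonneg by simp
  qed
  then show ?thesis by blast
qed

lemma cauchy_seqs_norm_convergent:
  assumes \<sigma>: "\<sigma> \<in> cauchy_seqs X N"
  shows "convergent (\<lambda>k. N (\<sigma> k))"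
proof -
  have "Cauchy (\<lambda>k. N (\<sigma> k))"
  proof (rule CauchyI)
    fix e :: real assume "0 < e"
    then obtain m where m: "\<And>j k. m \<le> j \<Longrightarrow> m \<le> k \<Longrightarrow> N (\<lambda>x. \<sigma> j x - \<sigma> k x) < e"
      using cauchy_seqsD[OF \<sigma>, of e] by auto
    have "norm (N (\<sigma> j) - N (\<sigma> k)) < e" if "m \<le> j" "m \<le> k" for j k
      using m[OF that] m[OF that(2,1)] N_le_diff[OF cauchy_seqs_in[OF \<sigma>] cauchy_seqs_in[OF \<sigma>], of j k]
        N_le_diff[OF cauchy_seqs_in[OF \<sigma>] cauchy_seqs_in[OF \<sigma>], of k j] by (simp add: abs_less_iff)
    then show "\<exists>m. \<forall>j\<ge>m. \<forall>k\<ge>m. norm (N (\<sigma> j) - N (\<sigma> k)) < e" by blast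
  qed
  then show ?thesis by (rule Cauchy_convergent)
qed

lemma cauchy_seqs_linear:
  assumes \<sigma>: "\<sigma> \<in> cauchy_seqs X N" and \<rho>: "\<rho> \<in> cauchy_seqs X N"
  shows "(\<lambda>k x. a * \<sigma> k x + b * \<rho> k x) \<in> cauchy_seqs X N"
proof -
  note in_X = cauchy_seqs_in[OF \<sigma>] cauchy_seqs_in[OF \<rho>]
  have "\<exists>m. \<forall>j\<ge>m. \<forall>k\<ge>m. N (\<lambda>x. (a * \<sigma> j x + b * \<rho> j x) - (a * \<sigma> k x + b * \<rho> k x)) < e"
    if e: "0 < e" for e
  proof -
    define c where "c = \<bar>a\<bar> + \<bar>b\<bar> + 1"
    define d where "d = e / (2 * c)"
    have c: "0 < c" by (simp add: c_def add_nonneg_pos)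
    have d: "0 < d" using e c by (simp add: d_def)
    obtain m1 where m1: "\<And>j k. m1 \<le> j \<Longrightarrow> m1 \<le> k \<Longrightarrow> N (\<lambda>x. \<sigma> j x - \<sigma> k x) < d"
      using cauchy_seqsD[OF \<sigma> d] by auto
    obtain m2 where m2: "\<And>j k. m2 \<le> j \<Longrightarrow> m2 \<le> k \<Longrightarrow> N (\<lambda>x. \<rho> j x - \<rho> k x) < d"
      using cauchy_seqsD[OF \<rho> d] by auto
    have "N (\<lambda>x. (a * \<sigma> j x + b * \<rho> j x) - (a * \<sigma> k x + b * \<rho> k x)) < e"
      if jk: "max m1 m2 \<le> j" "max m1 m2 \<le> k" for j k
    proof -
      have "N (\<lambda>x. (a * \<sigma> j x + b * \<rho> j x) - (a * \<sigma> k x + b * \<rho> k x))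
          = N (\<lambda>x. a * (\<sigma> j x - \<sigma> k x) + b * (\<rho> j x - \<rho> k x))"
        by (intro arg_cong[where f = N] ext) (simp add: algebra_simps)
      also have "\<dots> \<le> \<bar>a\<bar> * N (\<lambda>x. \<sigma> j x - \<sigma> k x) + \<bar>b\<bar> * N (\<lambda>x. \<rho> j x - \<rho> k x)"
        using N_triangle[OF X_scale[OF X_diff[of "\<sigma> j" "\<sigma> k"], of a] X_scale[OF X_diff[of "\<rho> j" "\<rho> k"], of b]]
        by (simp add: N_scale X_diff in_X)
      also have "\<dots> \<le> \<bar>a\<bar> * d + \<bar>b\<bar> * d"
        using m1[of j k] m2[of j k] jk by (intro add_mono mult_left_mono) auto
      also have "\<dots> \<le> c * d" using d by (simp add: c_def algebra_simps)
      also have "\<dots> = e / 2" using c by (simp add: d_def)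
      also have "\<dots> < e" using e by simp
      finally show ?thesis .
    qed
    then show ?thesis by blast
  qed
  then show ?thesis using linear in_X by (simp add: cauchy_seqs_def)
qed

lemma cauchy_seqs_const: "u \<in> X \<Longrightarrow> (\<lambda>k. u) \<in> cauchy_seqs X N"
  by (simp add: cauchy_seqs_def N_zero)

lemma equiv_cauchy_rel: "equiv (cauchy_seqs X N) (cauchy_rel X N)"
proof (rule equivI)
  show "refl_on (cauchy_seqs X N) (cauchy_rel X N)"
    by (auto simp: refl_on_def cauchy_rel_def N_zero[OF cauchy_seqs_in])
  show "sym (cauchy_rel X N)"
  proof (rule symI)
    fix \<sigma> \<rho> assume rel: "(\<sigma>, \<rho>) \<in> cauchy_rel X N"
    then have "N (\<lambda>x. \<rho> k x - \<sigma> k x) = N (\<lambda>x. \<sigma> k x - \<rho> k x)" for k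
      by (intro N_minus_commute) (auto simp: cauchy_rel_def cauchy_seqs_in)
    then show "(\<rho>, \<sigma>) \<in> cauchy_rel X N" using rel by (simp add: cauchy_rel_def)
  qed
  show "trans (cauchy_rel X N)"
  proof (rule transI)
    fix \<sigma> \<rho> \<pi> assume 1: "(\<sigma>, \<rho>) \<in> cauchy_rel X N" and 2: "(\<rho>, \<pi>) \<in> cauchy_rel X N"
    have "(\<lambda>k. N (\<lambda>x. \<sigma> k x - \<rho> k x) + N (\<lambda>x. \<rho> k x - \<pi> k x)) \<longlonglongrightarrow> 0 + 0"
      using 1 2 by (intro tendsto_add) (auto simp: cauchy_rel_def)
    then have "(\<lambda>k. N (\<lambda>x. \<sigma> k x - \<rho> k x) + N (\<lambda>x. \<rho> k x - \<pi> k x)) \<longlonglongrightarrow> 0" by simp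
    then have "(\<lambda>k. N (\<lambda>x. \<sigma> k x - \<pi> k x)) \<longlonglongrightarrow> 0"
    proof (rule tendsto_sandwich[OF _ _ tendsto_const, rotated 2])
      show "\<forall>\<^sub>F k in sequentially. N (\<lambda>x. \<sigma> k x - \<pi> k x)
          \<le> N (\<lambda>x. \<sigma> k x - \<rho> k x) + N (\<lambda>x. \<rho> k x - \<pi> k x)"
        using 1 2 by (intro always_eventually allI N_diff_triangle) (auto simp: cauchy_rel_def cauchy_seqs_in)
    qed (simp add: N_nonneg)
    then show "(\<sigma>, \<pi>) \<in> cauchy_rel X N" using 1 2 by (auto simp: cauchy_rel_def)
  qed
qed (auto simp: cauchy_rel_def)

section \<open>Limits of Cauchy sequences in L^r_K\<close>

definition limit_in_W :: "(nat \<Rightarrow> real^'n \<Rightarrow> real) \<Rightarrow> (real^'n \<Rightarrow> real) \<Rightarrow> bool" where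
  "limit_in_W \<sigma> f \<longleftrightarrow> f \<in> W \<and> (\<lambda>k. nrm (\<lambda>x. \<sigma> k x - f x)) \<longlonglongrightarrow> 0"

text \<open>The limit comes from compactness rather than from completeness of the target: a Cauchy
  sequence is bounded, so a subsequence converges. As \<kappa> k \<ge> k, the N-distance from
  \<sigma> k to \<sigma> (\<kappa> k) tends to 0, and \<open>inclusion_le\<close> carries the limit
  over to the whole sequence.\<close>

lemma limit_exists:
  assumes \<sigma>: "\<sigma> \<in> cauchy_seqs X N"
  shows "\<exists>f. limit_in_W \<sigma> f"
proof -
  note in_X = cauchy_seqs_in[OF \<sigma>]
  obtain B where "\<And>k. N (\<sigma> k) \<le> B" using cauchy_seqs_bounded[OF \<sigma>] by blast
  then obtain \<kappa> w where \<kappa>: "strict_mono (\<kappa>::nat \<Rightarrow> nat)" and w: "w \<in> W"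
    and lim: "(\<lambda>j. nrm (\<lambda>x. \<sigma> (\<kappa> j) x - w x)) \<longlonglongrightarrow> 0"
    using compactness[of \<sigma> B] in_X by blast
  have diff: "(\<lambda>k. N (\<lambda>x. \<sigma> k x - \<sigma> (\<kappa> k) x)) \<longlonglongrightarrow> 0"
  proof (rule LIMSEQ_I)
    fix e :: real assume "0 < e"
    then obtain m where m: "\<And>j k. m \<le> j \<Longrightarrow> m \<le> k \<Longrightarrow> N (\<lambda>x. \<sigma> j x - \<sigma> k x) < e"
      using cauchy_seqsD[OF \<sigma>, of e] by auto
    have "norm (N (\<lambda>x. \<sigma> k x - \<sigma> (\<kappa> k) x) - 0) < e" if "m \<le> k" for k
      using m[of k "\<kappa> k"] that seq_suble[OF \<kappa>, of k] N_nonneg by simp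
    then show "\<exists>m. \<forall>k\<ge>m. norm (N (\<lambda>x. \<sigma> k x - \<sigma> (\<kappa> k) x) - 0) < e" by blast
  qed
  have "(\<lambda>k. C * N (\<lambda>x. \<sigma> k x - \<sigma> (\<kappa> k) x) + nrm (\<lambda>x. \<sigma> (\<kappa> k) x - w x)) \<longlonglongrightarrow> C * 0 + 0"
    by (intro tendsto_add tendsto_mult tendsto_const diff lim)
  then have "(\<lambda>k. C * N (\<lambda>x. \<sigma> k x - \<sigma> (\<kappa> k) x) + nrm (\<lambda>x. \<sigma> (\<kappa> k) x - w x)) \<longlonglongrightarrow> 0" by simp
  then have "(\<lambda>k. nrm (\<lambda>x. \<sigma> k x - w x)) \<longlonglongrightarrow> 0"
  proof (rule tendsto_sandwich[OF _ _ tendsto_const, rotated 2])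
    show "\<forall>\<^sub>F k in sequentially. nrm (\<lambda>x. \<sigma> k x - w x)
        \<le> C * N (\<lambda>x. \<sigma> k x - \<sigma> (\<kappa> k) x) + nrm (\<lambda>x. \<sigma> (\<kappa> k) x - w x)"
    proof (intro always_eventually allI)
      fix k
      show "nrm (\<lambda>x. \<sigma> k x - w x) \<le> C * N (\<lambda>x. \<sigma> k x - \<sigma> (\<kappa> k) x) + nrm (\<lambda>x. \<sigma> (\<kappa> k) x - w x)"
        using nrm_diff_triangle[OF inclusion[OF in_X] inclusion[OF in_X] w, of k "\<kappa> k"]
          inclusion_le[OF X_diff[OF in_X in_X], of k "\<kappa> k"] by linarith
    qed
  qed (simp add: nrm_nonneg)
  then show ?thesis using w by (auto simp: limit_in_W_def)
qed

text \<open>The difference of equivalent sequences tends to 0 in N, hence in L^r_K; so the limit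
  belongs to the class, not to the representative.\<close>

lemma limit_rel:
  assumes rel: "(\<sigma>, \<rho>) \<in> cauchy_rel X N" and f: "limit_in_W \<sigma> f"
  shows "limit_in_W \<rho> f"
proof -
  have c: "\<sigma> \<in> cauchy_seqs X N" "\<rho> \<in> cauchy_seqs X N" and fW: "f \<in> W"
    using rel f by (auto simp: cauchy_rel_def limit_in_W_def)
  note in_X = cauchy_seqs_in[OF c(1)] cauchy_seqs_in[OF c(2)]
  have "(\<lambda>k. C * N (\<lambda>x. \<sigma> k x - \<rho> k x) + nrm (\<lambda>x. \<sigma> k x - f x)) \<longlonglongrightarrow> C * 0 + 0"
    using rel f by (intro tendsto_add tendsto_mult tendsto_const) (auto simp: cauchy_rel_def limit_in_W_def)
  then have "(\<lambda>k. C * N (\<lambda>x. \<sigma> k x - \<rho> k x) + nrm (\<lambda>x. \<sigma> k x - f x)) \<longlonglongrightarrow> 0" by simp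
  then have "(\<lambda>k. nrm (\<lambda>x. \<rho> k x - f x)) \<longlonglongrightarrow> 0"
  proof (rule tendsto_sandwich[OF _ _ tendsto_const, rotated 2])
    show "\<forall>\<^sub>F k in sequentially. nrm (\<lambda>x. \<rho> k x - f x)
        \<le> C * N (\<lambda>x. \<sigma> k x - \<rho> k x) + nrm (\<lambda>x. \<sigma> k x - f x)"
    proof (intro always_eventually allI)
      fix k
      show "nrm (\<lambda>x. \<rho> k x - f x) \<le> C * N (\<lambda>x. \<sigma> k x - \<rho> k x) + nrm (\<lambda>x. \<sigma> k x - f x)"
        using nrm_diff_triangle[OF inclusion[OF in_X(2)] inclusion[OF in_X(1)] fW, of k k]
          inclusion_le[OF X_diff[OF in_X(1,2)], of k k] nrm_minus_commute[of "\<rho> k" "\<sigma> k"] by linarith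
    qed
  qed (simp add: nrm_nonneg)
  then show ?thesis using fW by (auto simp: limit_in_W_def)
qed

lemma limit_linear:
  assumes \<sigma>: "\<sigma> \<in> cauchy_seqs X N" "limit_in_W \<sigma> f" and \<rho>: "\<rho> \<in> cauchy_seqs X N" "limit_in_W \<rho> g"
  shows "limit_in_W (\<lambda>k x. a * \<sigma> k x + b * \<rho> k x) (\<lambda>x. a * f x + b * g x)"
proof -
  have W: "f \<in> W" "g \<in> W" "\<And>k. \<sigma> k \<in> W" "\<And>k. \<rho> k \<in> W"
    using assms by (auto simp: limit_in_W_def intro!: inclusion cauchy_seqs_in)
  have "(\<lambda>k. \<bar>a\<bar> * nrm (\<lambda>x. \<sigma> k x - f x) + \<bar>b\<bar> * nrm (\<lambda>x. \<rho> k x - g x)) \<longlonglongrightarrow> \<bar>a\<bar> * 0 + \<bar>b\<bar> * 0"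
    using \<sigma> \<rho> by (intro tendsto_add tendsto_mult tendsto_const) (auto simp: limit_in_W_def)
  then have "(\<lambda>k. \<bar>a\<bar> * nrm (\<lambda>x. \<sigma> k x - f x) + \<bar>b\<bar> * nrm (\<lambda>x. \<rho> k x - g x)) \<longlonglongrightarrow> 0" by simp
  then have "(\<lambda>k. nrm (\<lambda>x. (a * \<sigma> k x + b * \<rho> k x) - (a * f x + b * g x))) \<longlonglongrightarrow> 0"
  proof (rule tendsto_sandwich[OF _ _ tendsto_const, rotated 2])
    show "\<forall>\<^sub>F k in sequentially. nrm (\<lambda>x. (a * \<sigma> k x + b * \<rho> k x) - (a * f x + b * g x))
        \<le> \<bar>a\<bar> * nrm (\<lambda>x. \<sigma> k x - f x) + \<bar>b\<bar> * nrm (\<lambda>x. \<rho> k x - g x)"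
    proof (intro always_eventually allI)
      fix k
      have D: "(\<lambda>x. \<sigma> k x - f x) \<in> W" "(\<lambda>x. \<rho> k x - g x) \<in> W" using W by (auto intro: W_diff)
      have "nrm (\<lambda>x. (a * \<sigma> k x + b * \<rho> k x) - (a * f x + b * g x))
          = nrm (\<lambda>x. a * (\<sigma> k x - f x) + b * (\<rho> k x - g x))"
        by (intro arg_cong[where f = nrm] ext) (simp add: algebra_simps)
      also have "\<dots> \<le> nrm (\<lambda>x. a * (\<sigma> k x - f x)) + nrm (\<lambda>x. b * (\<rho> k x - g x))"
        using W_linear[OF D(1) D(1), of a 0] W_linear[OF D(2) D(2), of b 0]
        by (intro nrm_triangle) simp_all
      finally show "nrm (\<lambda>x. (a * \<sigma> k x + b * \<rho> k x) - (a * f x + b * g x))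
        \<le> \<bar>a\<bar> * nrm (\<lambda>x. \<sigma> k x - f x) + \<bar>b\<bar> * nrm (\<lambda>x. \<rho> k x - g x)"
        by (simp add: nrm_scale D)
    qed
  qed (simp add: nrm_nonneg)
  then show ?thesis using W_linear[OF W(1,2)] by (simp add: limit_in_W_def)
qed

lemma limit_unique:
  assumes \<sigma>: "\<sigma> \<in> cauchy_seqs X N" and f: "limit_in_W \<sigma> f" and g: "limit_in_W \<sigma> g"
  shows "AE x in lebesgue. f x = g x"
proof -
  have W: "f \<in> W" "g \<in> W" "\<And>k. \<sigma> k \<in> W"
    using assms by (auto simp: limit_in_W_def intro!: inclusion cauchy_seqs_in)
  have "(\<lambda>k. nrm (\<lambda>x. \<sigma> k x - f x) + nrm (\<lambda>x. \<sigma> k x - g x)) \<longlonglongrightarrow> 0 + 0"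
    using f g by (intro tendsto_add) (auto simp: limit_in_W_def)
  then have "nrm (\<lambda>x. f x - g x) \<le> 0 + 0"
  proof (rule tendsto_lowerbound)
    show "\<forall>\<^sub>F k in sequentially. nrm (\<lambda>x. f x - g x) \<le> nrm (\<lambda>x. \<sigma> k x - f x) + nrm (\<lambda>x. \<sigma> k x - g x)"
    proof (intro always_eventually allI)
      fix k
      show "nrm (\<lambda>x. f x - g x) \<le> nrm (\<lambda>x. \<sigma> k x - f x) + nrm (\<lambda>x. \<sigma> k x - g x)"
        using nrm_diff_triangle[OF W(1) W(3) W(2), of k] nrm_minus_commute[of f "\<sigma> k"] by linarith
    qed
  qed simp
  then have "nrm (\<lambda>x. f x - g x) = 0" using nrm_nonneg[of "\<lambda>x. f x - g x"] by simp
  from nrm_eq_0_AE[OF W_diff[OF W(1,2)] this] show ?thesis by simp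
qed

text \<open>If the limits agree a.e., the difference of the sequences tends to 0 in L^r_K. It is
  again Cauchy and bounded in N, so \<open>closability\<close> makes it tend to 0 in N.\<close>

lemma limit_inj:
  assumes \<sigma>: "\<sigma> \<in> cauchy_seqs X N" "limit_in_W \<sigma> f" and \<rho>: "\<rho> \<in> cauchy_seqs X N" "limit_in_W \<rho> g"
    and fg: "AE x in lebesgue. f x = g x"
  shows "(\<sigma>, \<rho>) \<in> cauchy_rel X N"
proof -
  have "(\<lambda>k. nrm (\<lambda>x. (1 * \<sigma> k x + (-1) * \<rho> k x) - (1 * f x + (-1) * g x))) \<longlonglongrightarrow> 0"
    using limit_linear[OF assms(1-4), of 1 "-1"] by (simp only: limit_in_W_def)
  also have "(\<lambda>k. nrm (\<lambda>x. (1 * \<sigma> k x + (-1) * \<rho> k x) - (1 * f x + (-1) * g x)))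
      = (\<lambda>k. nrm (\<lambda>x. 1 * \<sigma> k x + (-1) * \<rho> k x))"
    unfolding weighted_norm_eq Lp_norm_def
    by (intro ext arg_cong[where f = "\<lambda>t. enn2real t powr (1 / r)"] Lp_integral_cong_AE)
       (use fg in eventually_elim, simp)
  finally have lim: "(\<lambda>k. nrm (\<lambda>x. 1 * \<sigma> k x + (-1) * \<rho> k x)) \<longlonglongrightarrow> 0" .
  note diff = cauchy_seqs_linear[OF \<sigma>(1) \<rho>(1), of 1 "-1"]
  obtain B where B: "\<And>k. N (\<lambda>x. 1 * \<sigma> k x + (-1) * \<rho> k x) \<le> B"
    using cauchy_seqs_bounded[OF diff] by blast
  have "(\<lambda>k. N (\<lambda>x. 1 * \<sigma> k x + (-1) * \<rho> k x)) \<longlonglongrightarrow> 0"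
    by (rule closability[OF diff B lim])
  then show ?thesis using \<sigma> \<rho> by (simp add: cauchy_rel_def)
qed

text \<open>A choice among a.e. equal functions. Some member of \<xi> is enough to pin it down,
  since by \<open>limit_rel\<close> all members share their limits.\<close>

definition embed :: "(nat \<Rightarrow> real^'n \<Rightarrow> real) set \<Rightarrow> real^'n \<Rightarrow> real" where
  "embed \<xi> = (SOME f. \<exists>\<sigma>\<in>\<xi>. limit_in_W \<sigma> f)"

lemma embed_class:
  assumes \<sigma>: "\<sigma> \<in> cauchy_seqs X N"
  shows "limit_in_W \<sigma> (embed (cauchy_class X N \<sigma>))"
proof -
  have "\<sigma> \<in> cauchy_class X N \<sigma>"
    using equiv_class_self[OF equiv_cauchy_rel \<sigma>] by (simp add: cauchy_class_def)
  then have "\<exists>f. \<exists>\<rho>\<in>cauchy_class X N \<sigma>. limit_in_W \<rho> f" using limit_exists[OF \<sigma>] by blast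
  from someI_ex[OF this] obtain \<rho> where "\<rho> \<in> cauchy_class X N \<sigma>"
    and \<rho>: "limit_in_W \<rho> (embed (cauchy_class X N \<sigma>))" by (auto simp: embed_def)
  then have "(\<rho>, \<sigma>) \<in> cauchy_rel X N"
    using equiv_cauchy_rel by (auto simp: cauchy_class_def equiv_def sym_def)
  from limit_rel[OF this \<rho>] show ?thesis .
qed

lemma norm_completionE:
  assumes "\<xi> \<in> norm_completion X N"
  obtains \<sigma> where "\<sigma> \<in> cauchy_seqs X N" "\<xi> = cauchy_class X N \<sigma>"
  using assms by (auto simp: norm_completion_def cauchy_class_def elim: quotientE)

text \<open>\<open>completion_norm\<close> is computed along one chosen representative; taking the
  same one here puts the norm and the limit on a single sequence.\<close>

lemma norm_completion_representative:
  assumes "\<xi> \<in> norm_completion X N"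
  obtains \<sigma> where "\<sigma> \<in> cauchy_seqs X N" "limit_in_W \<sigma> (embed \<xi>)"
    "(\<lambda>k. N (\<sigma> k)) \<longlonglongrightarrow> completion_norm N \<xi>"
proof -
  obtain \<rho> where \<rho>: "\<rho> \<in> cauchy_seqs X N" "\<xi> = cauchy_class X N \<rho>"
    using assms by (rule norm_completionE)
  define \<sigma> where "\<sigma> = (SOME \<sigma>. \<sigma> \<in> \<xi>)"
  have "\<rho> \<in> \<xi>"
    using equiv_class_self[OF equiv_cauchy_rel \<rho>(1)] \<rho>(2) by (simp add: cauchy_class_def)
  then have "\<sigma> \<in> \<xi>" using someI[of "\<lambda>\<sigma>. \<sigma> \<in> \<xi>" \<rho>] by (simp add: \<sigma>_def)
  then have rel: "(\<rho>, \<sigma>) \<in> cauchy_rel X N" using \<rho>(2) by (simp add: cauchy_class_def)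
  then have \<sigma>: "\<sigma> \<in> cauchy_seqs X N" by (simp add: cauchy_rel_def)
  have "limit_in_W \<sigma> (embed \<xi>)"
    using limit_rel[OF rel embed_class[OF \<rho>(1)]] \<rho>(2) by simp
  moreover have "(\<lambda>k. N (\<sigma> k)) \<longlonglongrightarrow> completion_norm N \<xi>"
    using cauchy_seqs_norm_convergent[OF \<sigma>]
    by (simp add: completion_norm_def convergent_LIMSEQ_iff flip: \<sigma>_def)
  ultimately show ?thesis using that \<sigma> by blast
qed

lemma embed_in_W: "\<xi> \<in> norm_completion X N \<Longrightarrow> embed \<xi> \<in> W"
  by (rule norm_completion_representative) (auto simp: limit_in_W_def)

lemma embed_bounded:
  assumes "\<xi> \<in> norm_completion X N"
  shows "nrm (embed \<xi>) \<le> C * completion_norm N \<xi>"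
proof -
  obtain \<sigma> where \<sigma>: "\<sigma> \<in> cauchy_seqs X N" "limit_in_W \<sigma> (embed \<xi>)"
    "(\<lambda>k. N (\<sigma> k)) \<longlonglongrightarrow> completion_norm N \<xi>"
    using assms by (rule norm_completion_representative)
  have W: "embed \<xi> \<in> W" "\<And>k. \<sigma> k \<in> W"
    using \<sigma> by (auto simp: limit_in_W_def intro!: inclusion cauchy_seqs_in)
  have "(\<lambda>k. nrm (\<lambda>x. \<sigma> k x - embed \<xi> x) + C * N (\<sigma> k)) \<longlonglongrightarrow> 0 + C * completion_norm N \<xi>"
    using \<sigma> by (intro tendsto_add tendsto_mult tendsto_const) (auto simp: limit_in_W_def)
  then have "nrm (embed \<xi>) \<le> 0 + C * completion_norm N \<xi>"
  proof (rule tendsto_lowerbound)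
    show "\<forall>\<^sub>F k in sequentially. nrm (embed \<xi>) \<le> nrm (\<lambda>x. \<sigma> k x - embed \<xi> x) + C * N (\<sigma> k)"
    proof (intro always_eventually allI)
      fix k
      have "nrm (embed \<xi>) \<le> nrm (\<lambda>x. embed \<xi> x - \<sigma> k x) + nrm (\<sigma> k)"
        using nrm_triangle[OF W_diff[OF W(1) W(2)] W(2), of k k] by simp
      then show "nrm (embed \<xi>) \<le> nrm (\<lambda>x. \<sigma> k x - embed \<xi> x) + C * N (\<sigma> k)"
        using nrm_minus_commute[of "embed \<xi>" "\<sigma> k"] inclusion_le[OF cauchy_seqs_in[OF \<sigma>(1)], of k]
        by linarith
    qed
  qed simp
  then show ?thesis by simp
qed

lemma is_embedding_embed: "is_embedding X N r K embed"
  unfolding is_embedding_def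
proof (intro conjI ballI allI impI)
  show "embed \<xi> \<in> W" if "\<xi> \<in> norm_completion X N" for \<xi>
    using that by (rule embed_in_W)
next
  fix u assume u: "u \<in> X"
  have "limit_in_W (\<lambda>k. u) u"
    using inclusion[OF u] nrm_scale[OF inclusion[OF u], of 0] by (simp add: limit_in_W_def)
  then show "AE x in lebesgue. embed (cauchy_class X N (\<lambda>k. u)) x = u x"
    using limit_unique[OF cauchy_seqs_const[OF u] embed_class[OF cauchy_seqs_const[OF u]]] by blast
next
  fix \<sigma> \<rho> a b assume c: "\<sigma> \<in> cauchy_seqs X N" "\<rho> \<in> cauchy_seqs X N"
  show "AE x in lebesgue. embed (cauchy_class X N (\<lambda>k y. a * \<sigma> k y + b * \<rho> k y)) x =
    a * embed (cauchy_class X N \<sigma>) x + b * embed (cauchy_class X N \<rho>) x"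
    by (rule limit_unique[OF cauchy_seqs_linear[OF c] embed_class[OF cauchy_seqs_linear[OF c]]
          limit_linear[OF c(1) embed_class[OF c(1)] c(2) embed_class[OF c(2)]]])
next
  fix \<xi> \<eta> assume \<xi>: "\<xi> \<in> norm_completion X N" and \<eta>: "\<eta> \<in> norm_completion X N"
    and eq: "AE x in lebesgue. embed \<xi> x = embed \<eta> x"
  obtain \<sigma> where \<sigma>: "\<sigma> \<in> cauchy_seqs X N" "\<xi> = cauchy_class X N \<sigma>" using \<xi> by (rule norm_completionE)
  obtain \<rho> where \<rho>: "\<rho> \<in> cauchy_seqs X N" "\<eta> = cauchy_class X N \<rho>" using \<eta> by (rule norm_completionE)
  have "(\<sigma>, \<rho>) \<in> cauchy_rel X N"
    using limit_inj[OF \<sigma>(1) embed_class[OF \<sigma>(1)] \<rho>(1) embed_class[OF \<rho>(1)]] eq \<sigma>(2) \<rho>(2) by simp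
  then show "\<xi> = \<eta>"
    unfolding \<sigma>(2) \<rho>(2) cauchy_class_def by (rule equiv_class_eq[OF equiv_cauchy_rel])
next
  show "\<exists>C. \<forall>\<xi>\<in>norm_completion X N. nrm (embed \<xi>) \<le> C * completion_norm N \<xi>"
    using embed_bounded by blast
qed

text \<open>Each class is replaced by an element of X with N at most B + 1 whose L^r_K distance to
  the image of the class is at most 1 / (k + 1). Compactness on X then applies, and the errors
  vanish along the subsequence.\<close>

lemma is_compact_map_embed: "is_compact_map X N r K embed"
  unfolding is_compact_map_def
proof (intro allI impI, elim conjE exE)
  fix \<xi> B assume \<xi>: "\<forall>k. \<xi> k \<in> norm_completion X N" and B: "\<forall>k::nat. completion_norm N (\<xi> k) \<le> B"
  have "\<exists>u. u \<in> X \<and> N u \<le> B + 1 \<and> nrm (\<lambda>x. u x - embed (\<xi> k) x) \<le> inverse (real (Suc k))" for k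
  proof -
    obtain \<sigma> where \<sigma>: "\<sigma> \<in> cauchy_seqs X N" "limit_in_W \<sigma> (embed (\<xi> k))"
      "(\<lambda>j. N (\<sigma> j)) \<longlonglongrightarrow> completion_norm N (\<xi> k)"
      using \<xi> norm_completion_representative by blast
    have "\<forall>\<^sub>F j in sequentially. N (\<sigma> j) < B + 1"
      using \<sigma>(3) B by (intro order_tendstoD(2)) (auto intro: le_less_trans)
    moreover have "\<forall>\<^sub>F j in sequentially. nrm (\<lambda>x. \<sigma> j x - embed (\<xi> k) x) < inverse (real (Suc k))"
      using \<sigma>(2) by (intro order_tendstoD(2)[of _ 0]) (auto simp: limit_in_W_def)
    ultimately have "\<forall>\<^sub>F j in sequentially. N (\<sigma> j) \<le> B + 1 \<and>
        nrm (\<lambda>x. \<sigma> j x - embed (\<xi> k) x) \<le> inverse (real (Suc k))"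
      by eventually_elim auto
    then obtain j where "N (\<sigma> j) \<le> B + 1 \<and> nrm (\<lambda>x. \<sigma> j x - embed (\<xi> k) x) \<le> inverse (real (Suc k))"
      using eventually_happens'[OF sequentially_bot] by blast
    then show ?thesis using cauchy_seqs_in[OF \<sigma>(1)] by blast
  qed
  then obtain u where u: "\<And>k. u k \<in> X" "\<And>k. N (u k) \<le> B + 1"
    and close: "\<And>k. nrm (\<lambda>x. u k x - embed (\<xi> k) x) \<le> inverse (real (Suc k))"
    by metis
  obtain \<kappa> w where \<kappa>: "strict_mono (\<kappa>::nat \<Rightarrow> nat)" and w: "w \<in> W"
    and lim: "(\<lambda>j. nrm (\<lambda>x. u (\<kappa> j) x - w x)) \<longlonglongrightarrow> 0"
    using compactness[of u "B + 1", OF u] by (elim exE bexE conjE) (rule that)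
  have "(\<lambda>j. inverse (real (Suc (\<kappa> j)))) \<longlonglongrightarrow> 0"
    using LIMSEQ_subseq_LIMSEQ[OF LIMSEQ_inverse_real_of_nat \<kappa>] by (simp add: o_def)
  from tendsto_add[OF this lim]
  have "(\<lambda>j. inverse (real (Suc (\<kappa> j))) + nrm (\<lambda>x. u (\<kappa> j) x - w x)) \<longlonglongrightarrow> 0" by simp
  then have "(\<lambda>j. nrm (\<lambda>x. embed (\<xi> (\<kappa> j)) x - w x)) \<longlonglongrightarrow> 0"
  proof (rule tendsto_sandwich[OF _ _ tendsto_const, rotated 2])
    show "\<forall>\<^sub>F j in sequentially. nrm (\<lambda>x. embed (\<xi> (\<kappa> j)) x - w x)
        \<le> inverse (real (Suc (\<kappa> j))) + nrm (\<lambda>x. u (\<kappa> j) x - w x)"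
    proof (intro always_eventually allI)
      fix j
      have "embed (\<xi> (\<kappa> j)) \<in> W" using \<xi> by (intro embed_in_W) auto
      from nrm_diff_triangle[OF this inclusion[OF u(1)] w, of "\<kappa> j"]
      show "nrm (\<lambda>x. embed (\<xi> (\<kappa> j)) x - w x)
        \<le> inverse (real (Suc (\<kappa> j))) + nrm (\<lambda>x. u (\<kappa> j) x - w x)"
        using close[of "\<kappa> j"] nrm_minus_commute[of "u (\<kappa> j)" "embed (\<xi> (\<kappa> j))"] by linarith
    qed
  qed (simp add: nrm_nonneg)
  with \<kappa> w show "\<exists>\<kappa>::nat \<Rightarrow> nat. strict_mono \<kappa> \<and>
      (\<exists>w\<in>W. (\<lambda>j. nrm (\<lambda>x. embed (\<xi> (\<kappa> j)) x - w x)) \<longlonglongrightarrow> 0)" by blast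
qed

lemma compactly_embedded: "compactly_embedded X N r K"
  unfolding compactly_embedded_def using is_embedding_embed is_compact_map_embed by blast

end

section \<open>The compact embedding\<close>

locale fractional_weights =
  fixes p s q r P \<tau> :: real and K V :: "real^'n \<Rightarrow> real"
  assumes p: "1 \<le> p" and s: "0 < s" and sp: "s * p < real CARD('n)"
    and P: "P = real CARD('n) * p / (real CARD('n) - s * p)"
    and q: "1 \<le> q" and qr: "q \<le> r" and rP: "r < P"
    and K_meas [measurable]: "K \<in> borel_measurable lebesgue"
    and V_meas [measurable]: "V \<in> borel_measurable lebesgue"
    and K_positive: "\<forall>x. 0 < K x" and V_positive: "\<forall>x. 0 < V x"
    and K_Lt: "\<exists>t::ennreal. ennreal (P / (P - r)) < t \<and>
           (\<forall>\<Omega>\<in>sets lebesgue. emeasure lebesgue \<Omega> < \<infinity> \<longrightarrow> K \<in> Lp_on t \<Omega>)"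
    and \<tau>: "\<tau> = (P - r) / (P - q)"
    and vanishing: "vanishes_at_infinity (\<lambda>x. K x * V x powr (- \<tau>))"
begin

text \<open>Four instances of one calculus: the target norm, the two parts of the norm N, and the
  unweighted L^P norm that the Sobolev inequality controls.\<close>

sublocale Kw: weighted_measure lebesgue r K
  using q qr K_positive by unfold_locales (auto intro: less_imp_le)

sublocale Vw: weighted_measure lebesgue q V
  using q V_positive by unfold_locales (auto intro: less_imp_le)

sublocale Gw: weighted_measure "lborel \<Otimes>\<^sub>M lborel" p "gagliardo_weight s p :: (real^'n) \<times> (real^'n) \<Rightarrow> real"
  by (rule weighted_measure_gagliardo[OF p])

sublocale Pw: weighted_measure lebesgue P "\<lambda>x::real^'n. 1"
  using q qr rP by unfold_locales auto

abbreviation X where "X \<equiv> MV_core s q p V"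
abbreviation N where "N \<equiv> MV_norm s q p V"

section \<open>The core as a space with norm N\<close>

lemma core_borel: "u \<in> X \<Longrightarrow> u \<in> borel_measurable borel"
  by (simp add: MV_core_def C1_c_borel)

lemma core_lebesgue: "u \<in> X \<Longrightarrow> u \<in> borel_measurable lebesgue"
  using core_borel by (intro measurable_completion) simp

lemma core_increment: "u \<in> X \<Longrightarrow> increment u \<in> borel_measurable (lborel \<Otimes>\<^sub>M lborel)"
  by (intro increment_measurable core_borel)

lemma core_finite:
  assumes "u \<in> X"
  shows "Lp_integral lebesgue q V u < \<infinity>"
    and "Lp_integral (lborel \<Otimes>\<^sub>M lborel) p (gagliardo_weight s p) (increment u) < \<infinity>"
  using assms by (auto simp: MV_core_def weighted_integral_eq gagliardo_integral_eq[OF C1_c_borel])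

lemma norm_eq:
  "u \<in> X \<Longrightarrow> N u = Lp_norm lebesgue q V u + Lp_norm (lborel \<Otimes>\<^sub>M lborel) p (gagliardo_weight s p) (increment u)"
  by (simp add: MV_norm_def weighted_norm_eq gagliardo_seminorm_eq core_borel)

lemma norm_nonneg: "0 \<le> N u"
  by (simp add: MV_norm_def weighted_norm_def gagliardo_seminorm_def)

lemma core_linear:
  assumes u: "u \<in> X" and v: "v \<in> X"
  shows "(\<lambda>x. a * u x + b * v x) \<in> X"
proof -
  have C: "(\<lambda>x. a * u x + b * v x) \<in> C1_c" using u v by (intro C1_c_linear) (auto simp: MV_core_def)
  show ?thesis
    using C Vw.Lp_integral_finite_linear[OF core_lebesgue[OF u] core_lebesgue[OF v] core_finite(1)[OF u] core_finite(1)[OF v]]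
      Gw.Lp_integral_finite_linear[OF core_increment[OF u] core_increment[OF v] core_finite(2)[OF u] core_finite(2)[OF v]]
    by (simp add: MV_core_def weighted_integral_eq gagliardo_integral_eq[OF C1_c_borel] increment_linear)
qed

lemma norm_scale:
  assumes u: "u \<in> X"
  shows "N (\<lambda>x. a * u x) = \<bar>a\<bar> * N u"
proof -
  have "(\<lambda>x. a * u x) \<in> X" using core_linear[OF u u, of a 0] by simp
  moreover have "increment (\<lambda>x. a * u x) = (\<lambda>z. a * increment u z)"
    by (simp add: increment_def fun_eq_iff right_diff_distrib)
  ultimately show ?thesis
    using u by (simp add: norm_eq Vw.Lp_norm_scale core_lebesgue Gw.Lp_norm_scale core_increment distrib_left)
qed

lemma norm_triangle:
  assumes u: "u \<in> X" and v: "v \<in> X"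
  shows "N (\<lambda>x. u x + v x) \<le> N u + N v"
proof -
  have "(\<lambda>x. u x + v x) \<in> X" using core_linear[OF u v, of 1 1] by simp
  moreover have "increment (\<lambda>x. u x + v x) = (\<lambda>z. increment u z + increment v z)"
    by (simp add: increment_def fun_eq_iff)
  ultimately show ?thesis
    using Vw.Lp_norm_triangle[OF core_lebesgue[OF u] core_lebesgue[OF v] core_finite(1)[OF u] core_finite(1)[OF v]]
      Gw.Lp_norm_triangle[OF core_increment[OF u] core_increment[OF v] core_finite(2)[OF u] core_finite(2)[OF v]] u v
    by (simp add: norm_eq)
qed

text \<open>The right-hand side of \<open>fractional_Sobolev_inequality\<close> for G = B^p, the
  Gagliardo bound that N u \<le> B implies.\<close>

definition sobolev_bound :: "real \<Rightarrow> real" where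
  "sobolev_bound B = (2 powr P * real CARD('n) powr (real CARD('n) + s * p) * B powr p) powr (P / p)"

text \<open>Both parts of N are nonnegative, so each is at most B; the Gagliardo part then feeds the
  Sobolev inequality.\<close>

lemma core_bounds:
  assumes u: "u \<in> X" and B: "N u \<le> B"
  shows "Lp_integral lebesgue q V u \<le> ennreal (B powr q)"
    and "gagliardo_integral s p u \<le> ennreal (B powr p)"
    and "(\<integral>\<^sup>+x. ennreal (\<bar>u x\<bar> powr P) \<partial>lborel) \<le> ennreal (sobolev_bound B)"
proof -
  show "Lp_integral lebesgue q V u \<le> ennreal (B powr q)"
    using B Gw.Lp_norm_nonneg[of "increment u"]
    by (intro Vw.Lp_integral_le core_finite u) (simp add: norm_eq[OF u])
  show gag: "gagliardo_integral s p u \<le> ennreal (B powr p)"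
    unfolding gagliardo_integral_eq[OF core_borel[OF u]]
    using B Vw.Lp_norm_nonneg[of u]
    by (intro Gw.Lp_integral_le core_finite u) (simp add: norm_eq[OF u])
  show "(\<integral>\<^sup>+x. ennreal (\<bar>u x\<bar> powr P) \<partial>lborel) \<le> ennreal (sobolev_bound B)"
    unfolding sobolev_bound_def
    using u q qr rP gag
    by (intro fractional_Sobolev_inequality p s sp P core_borel C1_c_powr_integral_finite) (auto simp: MV_core_def)
qed

section \<open>Uniform estimates and boundedness of the inclusion\<close>

lemma Pw_integral_eq: "Lp_integral lebesgue P (\<lambda>x. 1) u = (\<integral>\<^sup>+x. ennreal (\<bar>u x\<bar> powr P) \<partial>lborel)"
  by (simp add: Lp_integral_def nn_integral_completion)

lemma domination:
  assumes "0 < \<epsilon>"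
  obtains h where "h \<in> borel_measurable lebesgue" "\<And>x. 0 \<le> h x" "(\<integral>\<^sup>+x. ennreal (h x) \<partial>lebesgue) < \<infinity>"
    "\<And>x t. \<bar>t\<bar> powr r * K x \<le> \<epsilon> * (\<bar>t\<bar> powr q * V x + \<bar>t\<bar> powr P) + h x"
  using weight_domination[OF q qr rP K_meas V_meas K_positive V_positive K_Lt \<tau> vanishing assms] by blast

text \<open>Where |w|^r K \<le> h the minimum is the left-hand integrand itself; elsewhere it is h
  and the domination applies. The minimum has an integrable majorant and still vanishes as w
  \<rightarrow> 0, which h alone does not.\<close>

lemma Lp_integral_le_min:
  assumes \<epsilon>: "0 < \<epsilon>" and [measurable]: "h \<in> borel_measurable lebesgue" "w \<in> borel_measurable lebesgue"
    and h: "\<And>x. 0 \<le> h x"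
    and le: "\<And>x t. \<bar>t\<bar> powr r * K x \<le> \<epsilon> * (\<bar>t\<bar> powr q * V x + \<bar>t\<bar> powr P) + h x"
  shows "Lp_integral lebesgue r K w \<le>
    ennreal \<epsilon> * (Lp_integral lebesgue q V w + Lp_integral lebesgue P (\<lambda>x. 1) w)
      + (\<integral>\<^sup>+x. ennreal (min (\<bar>w x\<bar> powr r * K x) (h x)) \<partial>lebesgue)"
proof -
  have "Lp_integral lebesgue r K w \<le>
    (\<integral>\<^sup>+x. ennreal \<epsilon> * (ennreal (\<bar>w x\<bar> powr q * V x) + ennreal (\<bar>w x\<bar> powr P * 1))
      + ennreal (min (\<bar>w x\<bar> powr r * K x) (h x)) \<partial>lebesgue)"
    unfolding Lp_integral_def
  proof (intro nn_integral_mono)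
    fix x
    have 0: "0 \<le> \<bar>w x\<bar> powr q * V x" "0 \<le> \<bar>w x\<bar> powr r * K x"
      using Vw.weight_nonneg[of x] Kw.weight_nonneg[of x] by auto
    have "\<bar>w x\<bar> powr r * K x \<le> \<epsilon> * (\<bar>w x\<bar> powr q * V x + \<bar>w x\<bar> powr P) + min (\<bar>w x\<bar> powr r * K x) (h x)"
    proof (cases "\<bar>w x\<bar> powr r * K x \<le> h x")
      case True
      moreover have "0 \<le> \<epsilon> * (\<bar>w x\<bar> powr q * V x + \<bar>w x\<bar> powr P)" using 0 \<epsilon> by simp
      ultimately show ?thesis by (simp add: min_absorb1)
    next
      case False
      then show ?thesis using le[of "w x" x] by (simp add: min_absorb2)
    qed
    then have "ennreal (\<bar>w x\<bar> powr r * K x)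
      \<le> ennreal (\<epsilon> * (\<bar>w x\<bar> powr q * V x + \<bar>w x\<bar> powr P) + min (\<bar>w x\<bar> powr r * K x) (h x))"
      by (rule ennreal_leI)
    also have "\<dots> = ennreal \<epsilon> * (ennreal (\<bar>w x\<bar> powr q * V x) + ennreal (\<bar>w x\<bar> powr P * 1))
      + ennreal (min (\<bar>w x\<bar> powr r * K x) (h x))"
      using 0 \<epsilon> h[of x] by (subst ennreal_plus) (auto simp: ennreal_mult)
    finally show "ennreal (\<bar>w x\<bar> powr r * K x) \<le> \<dots>" .
  qed
  also have "\<dots> = ennreal \<epsilon> * (Lp_integral lebesgue q V w + Lp_integral lebesgue P (\<lambda>x. 1) w)
      + (\<integral>\<^sup>+x. ennreal (min (\<bar>w x\<bar> powr r * K x) (h x)) \<partial>lebesgue)"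
    unfolding Lp_integral_def
    by (subst nn_integral_add, measurable, subst nn_integral_cmult, measurable, subst nn_integral_add) auto
  finally show ?thesis .
qed

text \<open>Asks of w only measurability and two integral bounds, not membership in X, because it
  also has to cover a.e. limits of sequences from X.\<close>

lemma Lp_integral_bounded:
  "\<exists>C. \<forall>w. w \<in> borel_measurable lebesgue \<longrightarrow> Lp_integral lebesgue q V w \<le> ennreal a \<longrightarrow>
     Lp_integral lebesgue P (\<lambda>x. 1) w \<le> ennreal b \<longrightarrow> Lp_integral lebesgue r K w \<le> ennreal C"
proof -
  obtain h where [measurable]: "h \<in> borel_measurable lebesgue" and h: "\<And>x. 0 \<le> h x"
    and hfin: "(\<integral>\<^sup>+x. ennreal (h x) \<partial>lebesgue) < \<infinity>"
    and le: "\<And>x t. \<bar>t\<bar> powr r * K x \<le> 1 * (\<bar>t\<bar> powr q * V x + \<bar>t\<bar> powr P) + h x"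
    using domination[of 1] by (metis zero_less_one)
  obtain H where H: "(\<integral>\<^sup>+x. ennreal (h x) \<partial>lebesgue) = ennreal H" "0 \<le> H"
    using hfin by (cases "\<integral>\<^sup>+x. ennreal (h x) \<partial>lebesgue") auto
  have "Lp_integral lebesgue r K w \<le> ennreal (max 0 a + max 0 b + H)"
    if [measurable]: "w \<in> borel_measurable lebesgue" and a: "Lp_integral lebesgue q V w \<le> ennreal a"
      and b: "Lp_integral lebesgue P (\<lambda>x. 1) w \<le> ennreal b" for w
  proof -
    have "Lp_integral lebesgue r K w \<le>
      ennreal 1 * (Lp_integral lebesgue q V w + Lp_integral lebesgue P (\<lambda>x. 1) w)
      + (\<integral>\<^sup>+x. ennreal (min (\<bar>w x\<bar> powr r * K x) (h x)) \<partial>lebesgue)"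
      by (intro Lp_integral_le_min h le) auto
    also have "\<dots> \<le> ennreal 1 * (ennreal a + ennreal b) + (\<integral>\<^sup>+x. ennreal (h x) \<partial>lebesgue)"
      by (intro add_mono mult_left_mono a b nn_integral_mono ennreal_leI) auto
    also have "\<dots> \<le> ennreal 1 * (ennreal (max 0 a) + ennreal (max 0 b)) + ennreal H"
      unfolding H by (intro add_mono mult_left_mono ennreal_leI) auto
    also have "\<dots> = ennreal (max 0 a + max 0 b + H)"
      using H by (simp add: max_def)
    finally show ?thesis .
  qed
  then show ?thesis by blast
qed

text \<open>A bound on the unit ball, extended by scaling. Since N u may be 0, u is divided by an
  arbitrary t > N u, and t tends to N u from the right at the end.\<close>

lemma inclusion_bounded:
  "\<exists>C. \<forall>u\<in>X. u \<in> weighted_Lp r K \<and> weighted_norm r K u \<le> C * N u"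
proof -
  obtain C where C: "\<And>w. w \<in> borel_measurable lebesgue \<Longrightarrow> Lp_integral lebesgue q V w \<le> ennreal (1 powr q) \<Longrightarrow>
     Lp_integral lebesgue P (\<lambda>x. 1) w \<le> ennreal (sobolev_bound 1) \<Longrightarrow> Lp_integral lebesgue r K w \<le> ennreal C"
    using Lp_integral_bounded[of "1 powr q" "sobolev_bound 1"] by blast
  define D where "D = (max 0 C) powr (1 / r)"
  have D: "0 \<le> D" "D powr r = max 0 C" using Kw.q_ge_1 by (auto simp: D_def powr_powr)
  have unit: "Lp_integral lebesgue r K u \<le> ennreal (D powr r)" if u: "u \<in> X" "N u \<le> 1" for u
    using C[OF core_lebesgue[OF u(1)]] core_bounds[OF u] unfolding D
    by (auto simp: Pw_integral_eq intro: order_trans ennreal_leI)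
  have fin: "Lp_integral lebesgue r K u < \<infinity> \<and> Lp_norm lebesgue r K u \<le> D * t"
    if u: "u \<in> X" and t: "N u < t" for u t
  proof -
    have t0: "0 < t" using t norm_nonneg[of u] by linarith
    have v: "(\<lambda>x. (1 / t) * u x) \<in> X" using core_linear[OF u u, of "1 / t" 0] by simp
    have "N (\<lambda>x. (1 / t) * u x) \<le> 1" using t t0 by (simp only: norm_scale[OF u]) (simp add: field_simps)
    from unit[OF v this] have le: "Lp_integral lebesgue r K (\<lambda>x. (1 / t) * u x) \<le> ennreal (D powr r)" .
    then have "Lp_norm lebesgue r K (\<lambda>x. (1 / t) * u x) \<le> D" using D by (intro Kw.Lp_norm_le) auto
    then have "\<bar>1 / t\<bar> * Lp_norm lebesgue r K u \<le> D" by (simp only: Kw.Lp_norm_scale[OF core_lebesgue[OF u]])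
    then have "Lp_norm lebesgue r K u \<le> D * t" using t0 by (simp add: field_simps)
    moreover have "ennreal (\<bar>1 / t\<bar> powr r) * Lp_integral lebesgue r K u < \<infinity>"
      using le by (simp only: Kw.Lp_integral_scale[OF core_lebesgue[OF u]]) (auto intro: le_less_trans)
    then have "Lp_integral lebesgue r K u < \<infinity>" using t0 by (auto simp: ennreal_mult_less_top)
    ultimately show ?thesis by simp
  qed
  have "u \<in> weighted_Lp r K \<and> weighted_norm r K u \<le> D * N u" if u: "u \<in> X" for u
  proof
    show "u \<in> weighted_Lp r K"
      using fin[OF u, of "N u + 1"] core_lebesgue[OF u] by (simp add: weighted_Lp_def weighted_integral_eq)
    have "((\<lambda>t. D * t) \<longlongrightarrow> D * N u) (at_right (N u))"
      by (intro tendsto_intros)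
    then show "weighted_norm r K u \<le> D * N u"
      unfolding weighted_norm_eq
      by (rule tendsto_lowerbound) (use fin[OF u] in \<open>auto simp: eventually_at_filter\<close>)
  qed
  then show ?thesis by blast
qed

section \<open>Compactness and closability on the core\<close>

lemma dominated_min_tendsto_0:
  assumes [measurable]: "\<And>j. w j \<in> borel_measurable lebesgue" "h \<in> borel_measurable lebesgue"
    and h: "\<And>x. 0 \<le> h x" "(\<integral>\<^sup>+x. ennreal (h x) \<partial>lebesgue) < \<infinity>"
    and lim: "AE x in lebesgue. (\<lambda>j. w j x) \<longlonglongrightarrow> 0"
  shows "(\<lambda>j. \<integral>\<^sup>+x. ennreal (min (\<bar>w j x\<bar> powr r * K x) (h x)) \<partial>lebesgue) \<longlonglongrightarrow> 0"
proof -
  have "(\<lambda>j. \<integral>\<^sup>+x. ennreal (min (\<bar>w j x\<bar> powr r * K x) (h x)) \<partial>lebesgue)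
    \<longlonglongrightarrow> (\<integral>\<^sup>+(x::real^'n). 0 \<partial>lebesgue)"
  proof (rule nn_integral_dominated_convergence[of "\<lambda>j x. ennreal (min (\<bar>w j x\<bar> powr r * K x) (h x))"
        lebesgue "\<lambda>x. 0" "\<lambda>x. ennreal (h x)"])
    show "AE x in lebesgue. (\<lambda>j. ennreal (min (\<bar>w j x\<bar> powr r * K x) (h x))) \<longlonglongrightarrow> 0"
      using lim
    proof eventually_elim
      case (elim x)
      have "(\<lambda>j. ennreal (min (\<bar>w j x\<bar> powr r * K x) (h x))) \<longlonglongrightarrow> ennreal (min (\<bar>0\<bar> powr r * K x) (h x))"
        using elim Kw.q_ge_1
        by (intro tendsto_ennrealI tendsto_min tendsto_mult tendsto_powr' tendsto_rabs tendsto_const) auto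
      then show ?case using h(1)[of x] by simp
    qed
  qed (use h(2) in \<open>auto intro!: ennreal_leI\<close>)
  then show ?thesis by simp
qed

text \<open>The a.e. convergence is kept in the conclusion because \<open>closability\<close>
  applies Fatou along the same subsequence.\<close>

lemma compactness:
  assumes \<sigma>: "\<And>k. \<sigma> k \<in> X" and B: "\<And>k::nat. N (\<sigma> k) \<le> B"
  shows "\<exists>\<kappa>::nat \<Rightarrow> nat. strict_mono \<kappa> \<and> (\<exists>w\<in>weighted_Lp r K.
    (AE x in lebesgue. (\<lambda>j. \<sigma> (\<kappa> j) x) \<longlonglongrightarrow> w x) \<and>
    (\<lambda>j. weighted_norm r K (\<lambda>x. \<sigma> (\<kappa> j) x - w x)) \<longlonglongrightarrow> 0)"
proof -
  define a where "a = B powr q"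
  define b where "b = sobolev_bound B"
  have ab: "0 \<le> a" "0 \<le> b" by (auto simp: a_def b_def sobolev_bound_def)
  have bounds: "Lp_integral lebesgue q V (\<sigma> k) \<le> ennreal a" "Lp_integral lebesgue P (\<lambda>x. 1) (\<sigma> k) \<le> ennreal b" for k
    using core_bounds[OF \<sigma> B] by (auto simp: a_def b_def Pw_integral_eq)
  have [measurable]: "\<sigma> k \<in> borel_measurable lebesgue" for k by (rule core_lebesgue[OF \<sigma>])
  obtain \<kappa> :: "nat \<Rightarrow> nat" where \<kappa>: "strict_mono \<kappa>" and conv: "AE x in lborel. convergent (\<lambda>j. \<sigma> (\<kappa> j) x)"
    using gagliardo_bounded_AE_convergent_subsequence[of \<sigma> P b p s "B powr p", OF core_borel[OF \<sigma>] Pw.q_ge_1 ab(2) p s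
        powr_ge_zero core_bounds(3)[OF \<sigma> B, folded b_def] core_bounds(2)[OF \<sigma> B]] by (elim exE conjE) (rule that)
  define w where "w x = lim (\<lambda>j. \<sigma> (\<kappa> j) x)" for x
  have [measurable]: "w \<in> borel_measurable lebesgue" unfolding w_def by (rule borel_measurable_lim_metric) simp
  have lim: "AE x in lebesgue. (\<lambda>j. \<sigma> (\<kappa> j) x) \<longlonglongrightarrow> w x"
    using AE_completion[OF conv] by eventually_elim (simp add: w_def convergent_LIMSEQ_iff)
  \<comment> \<open>The limit need not lie in X; Fatou still gives it both integral bounds, and
    these suffice for membership in L^r_K and for the bound A on the differences.\<close>
  have w: "Lp_integral lebesgue q V w \<le> ennreal a" "Lp_integral lebesgue P (\<lambda>x. 1) w \<le> ennreal b"
    by (rule Vw.Lp_integral_Fatou[OF _ lim] Pw.Lp_integral_Fatou[OF _ lim]; simp add: bounds)+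
  have wW: "w \<in> weighted_Lp r K"
  proof -
    obtain C where C: "w \<in> borel_measurable lebesgue \<longrightarrow> Lp_integral lebesgue q V w \<le> ennreal a \<longrightarrow>
      Lp_integral lebesgue P (\<lambda>x. 1) w \<le> ennreal b \<longrightarrow> Lp_integral lebesgue r K w \<le> ennreal C"
      using Lp_integral_bounded[of a b] by (elim exE allE) (rule that)
    then have "Lp_integral lebesgue r K w \<le> ennreal C" using w by simp
    also have "\<dots> < \<infinity>" by simp
    finally show ?thesis by (simp add: weighted_Lp_def weighted_integral_eq)
  qed
  define d where "d j x = \<sigma> (\<kappa> j) x - w x" for j x
  have [measurable]: "d j \<in> borel_measurable lebesgue" for j unfolding d_def by measurable
  have dlim: "AE x in lebesgue. (\<lambda>j. d j x) \<longlonglongrightarrow> 0"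
    using lim by eventually_elim (simp add: d_def LIM_zero)
  \<comment> \<open>The factors 2^q and 2^P come from \<open>Lp_integral_add_le\<close>, applied to
    \<sigma> (\<kappa> j) and -w.\<close>
  define A where "A = 2 powr q * (a + a) + 2 powr P * (b + b)"
  have A: "0 \<le> A" using ab by (simp add: A_def)
  have dA: "Lp_integral lebesgue q V (d j) + Lp_integral lebesgue P (\<lambda>x. 1) (d j) \<le> ennreal A" for j
  proof -
    have dj: "d j = (\<lambda>x. \<sigma> (\<kappa> j) x - w x)" by (simp add: d_def fun_eq_iff)
    have "Lp_integral lebesgue q V (d j) \<le> ennreal (2 powr q) * (ennreal a + ennreal a)"
      using Vw.Lp_integral_add_le[of "\<sigma> (\<kappa> j)" "\<lambda>x. - w x"]
        mult_left_mono[OF add_mono[OF bounds(1)[of "\<kappa> j"] w(1)], of "ennreal (2 powr q)"]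
      by (auto simp: dj Vw.Lp_integral_uminus intro: order_trans)
    moreover have "Lp_integral lebesgue P (\<lambda>x. 1) (d j) \<le> ennreal (2 powr P) * (ennreal b + ennreal b)"
      using Pw.Lp_integral_add_le[of "\<sigma> (\<kappa> j)" "\<lambda>x. - w x"]
        mult_left_mono[OF add_mono[OF bounds(2)[of "\<kappa> j"] w(2)], of "ennreal (2 powr P)"]
      by (auto simp: dj Pw.Lp_integral_uminus intro: order_trans)
    ultimately have "Lp_integral lebesgue q V (d j) + Lp_integral lebesgue P (\<lambda>x. 1) (d j)
      \<le> ennreal (2 powr q) * (ennreal a + ennreal a) + ennreal (2 powr P) * (ennreal b + ennreal b)"
      by (rule add_mono)
    also have "\<dots> = ennreal A" using ab by (simp only: A_def ennreal_plus ennreal_mult add_nonneg_nonneg mult_nonneg_nonneg powr_ge_zero)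
    finally show ?thesis .
  qed
  have "(\<lambda>j. weighted_norm r K (d j)) \<longlonglongrightarrow> 0"
  proof (rule LIMSEQ_I)
    fix e :: real assume e: "0 < e"
    \<comment> \<open>An integral of at most (e / 2)^r means norm at most e / 2. One half of \<eta>
      goes to the \<epsilon> term, the other to the truncated one; c = A + 1 keeps the divisor in
      \<epsilon> positive.\<close>
    define \<eta> where "\<eta> = (e / 2) powr r"
    have \<eta>: "0 < \<eta>" using e by (simp add: \<eta>_def)
    define c where "c = A + 1"
    have c: "0 < c" using A by (simp add: c_def)
    define \<epsilon> where "\<epsilon> = \<eta> / (2 * c)"
    have \<epsilon>: "0 < \<epsilon>" using \<eta> c by (simp add: \<epsilon>_def)
    have \<epsilon>A: "\<epsilon> * A \<le> \<eta> / 2"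
    proof -
      have "\<epsilon> * A \<le> \<epsilon> * c" using \<epsilon> by (simp add: c_def)
      also have "\<dots> = \<eta> / 2" using c by (simp add: \<epsilon>_def)
      finally show ?thesis .
    qed
    obtain h where [measurable]: "h \<in> borel_measurable lebesgue" and h: "\<And>x. 0 \<le> h x"
      and hfin: "(\<integral>\<^sup>+x. ennreal (h x) \<partial>lebesgue) < \<infinity>"
      and le: "\<And>x t. \<bar>t\<bar> powr r * K x \<le> \<epsilon> * (\<bar>t\<bar> powr q * V x + \<bar>t\<bar> powr P) + h x"
      using domination[OF \<epsilon>] by blast
    have "\<forall>\<^sub>F j in sequentially.
        (\<integral>\<^sup>+x. ennreal (min (\<bar>d j x\<bar> powr r * K x) (h x)) \<partial>lebesgue) < ennreal (\<eta> / 2)"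
      using \<eta> by (intro order_tendstoD(2)[OF dominated_min_tendsto_0[OF _ _ h hfin dlim]]) auto
    then obtain J where J: "\<And>j. J \<le> j \<Longrightarrow>
        (\<integral>\<^sup>+x. ennreal (min (\<bar>d j x\<bar> powr r * K x) (h x)) \<partial>lebesgue) < ennreal (\<eta> / 2)"
      by (auto simp: eventually_sequentially)
    have "norm (weighted_norm r K (d j) - 0) < e" if j: "J \<le> j" for j
    proof -
      have "Lp_integral lebesgue r K (d j) \<le>
        ennreal \<epsilon> * (Lp_integral lebesgue q V (d j) + Lp_integral lebesgue P (\<lambda>x. 1) (d j))
          + (\<integral>\<^sup>+x. ennreal (min (\<bar>d j x\<bar> powr r * K x) (h x)) \<partial>lebesgue)"
        by (intro Lp_integral_le_min \<epsilon> h le) auto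
      also have "\<dots> \<le> ennreal \<epsilon> * ennreal A + ennreal (\<eta> / 2)"
        by (intro add_mono mult_left_mono dA less_imp_le[OF J[OF j]]) auto
      also have "\<dots> = ennreal (\<epsilon> * A + \<eta> / 2)"
        using \<epsilon> A \<eta> by (simp add: ennreal_mult)
      also have "\<dots> \<le> ennreal ((e / 2) powr r)"
        using \<epsilon>A by (intro ennreal_leI) (simp add: \<eta>_def)
      finally have "Lp_norm lebesgue r K (d j) \<le> e / 2" using e by (intro Kw.Lp_norm_le) auto
      then show ?thesis using e Kw.Lp_norm_nonneg[of "d j"] by (simp add: weighted_norm_eq)
    qed
    then show "\<exists>J. \<forall>j\<ge>J. norm (weighted_norm r K (d j) - 0) < e" by blast
  qed
  then show ?thesis using \<kappa> wW lim unfolding d_def by blast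
qed

text \<open>A subsequence converges a.e., and its limit is 0 because the L^r_K norms tend to 0. For
  fixed k the differences \<sigma> k - \<sigma> (\<kappa> j) then converge a.e. to \<sigma> k as j
  grows, so Fatou, used in each part of N, turns the Cauchy bound on the differences into a bound on
  \<sigma> k.\<close>

lemma closability:
  assumes \<sigma>: "\<sigma> \<in> cauchy_seqs X N" and lim0: "(\<lambda>k. weighted_norm r K (\<sigma> k)) \<longlonglongrightarrow> 0"
    and B: "\<And>k. N (\<sigma> k) \<le> B"
  shows "(\<lambda>k. N (\<sigma> k)) \<longlonglongrightarrow> 0"
proof -
  have in_X: "\<sigma> k \<in> X" for k using \<sigma> by (simp add: cauchy_seqs_def)
  have diff_X: "(\<lambda>x. \<sigma> k x - \<sigma> j x) \<in> X" for j k
    using core_linear[OF in_X in_X, of 1 k "-1" j] by simp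
  obtain \<kappa> w where \<kappa>: "strict_mono (\<kappa>::nat \<Rightarrow> nat)" and w: "w \<in> weighted_Lp r K"
    and lim: "AE x in lebesgue. (\<lambda>j. \<sigma> (\<kappa> j) x) \<longlonglongrightarrow> w x"
    and conv: "(\<lambda>j. weighted_norm r K (\<lambda>x. \<sigma> (\<kappa> j) x - w x)) \<longlonglongrightarrow> 0"
    using compactness[of \<sigma> B, OF in_X B] by (elim exE bexE conjE) (rule that)
  have wI: "w \<in> borel_measurable lebesgue" "Lp_integral lebesgue r K w < \<infinity>"
    using w by (auto simp: weighted_Lp_def weighted_integral_eq)
  have \<sigma>I: "Lp_integral lebesgue r K (\<sigma> k) < \<infinity>" for k
    using inclusion_bounded in_X by (auto simp: weighted_Lp_def weighted_integral_eq)
  have "(\<lambda>j. weighted_norm r K (\<sigma> (\<kappa> j))) \<longlonglongrightarrow> 0"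
    using LIMSEQ_subseq_LIMSEQ[OF lim0 \<kappa>] by (simp add: o_def)
  from tendsto_add[OF this conv]
  have sum0: "(\<lambda>j. weighted_norm r K (\<sigma> (\<kappa> j)) + weighted_norm r K (\<lambda>x. \<sigma> (\<kappa> j) x - w x)) \<longlonglongrightarrow> 0" by simp
  have "weighted_norm r K w \<le> 0"
  proof (rule tendsto_lowerbound[OF sum0])
    show "\<forall>\<^sub>F j in sequentially. weighted_norm r K w
      \<le> weighted_norm r K (\<sigma> (\<kappa> j)) + weighted_norm r K (\<lambda>x. \<sigma> (\<kappa> j) x - w x)"
    proof (intro always_eventually allI)
      fix j
      have [measurable]: "\<sigma> (\<kappa> j) \<in> borel_measurable lebesgue" "w \<in> borel_measurable lebesgue"
        using core_lebesgue[OF in_X] wI by auto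
      \<comment> \<open>w is written as \<sigma> - (\<sigma> - w), in the form of a sum to which the
        triangle inequality applies.\<close>
      have "Lp_norm lebesgue r K (\<lambda>x. \<sigma> (\<kappa> j) x + - (\<sigma> (\<kappa> j) x - w x))
        \<le> Lp_norm lebesgue r K (\<sigma> (\<kappa> j)) + Lp_norm lebesgue r K (\<lambda>x. - (\<sigma> (\<kappa> j) x - w x))"
        using \<sigma>I[of "\<kappa> j"] wI Kw.Lp_integral_finite_diff[of "\<sigma> (\<kappa> j)" w]
        by (intro Kw.Lp_norm_triangle) (simp_all only: Kw.Lp_integral_uminus, measurable)
      then show "weighted_norm r K w
      \<le> weighted_norm r K (\<sigma> (\<kappa> j)) + weighted_norm r K (\<lambda>x. \<sigma> (\<kappa> j) x - w x)"
        unfolding Kw.Lp_norm_uminus by (simp add: weighted_norm_eq)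
    qed
  qed simp
  then have "AE x in lebesgue. w x = 0"
    using wI K_positive Kw.Lp_norm_nonneg[of w] by (intro Kw.Lp_norm_eq_0_AE) (auto simp: weighted_norm_eq)
  with lim have lim: "AE x in lebesgue. (\<lambda>j. \<sigma> (\<kappa> j) x) \<longlonglongrightarrow> 0" by eventually_elim simp
  have AEk: "AE x in lebesgue. (\<lambda>j. \<sigma> k x - \<sigma> (\<kappa> j) x) \<longlonglongrightarrow> \<sigma> k x" for k
    using lim by eventually_elim (auto intro!: tendsto_eq_intros)
  have lim': "AE x in lborel. (\<lambda>j. \<sigma> (\<kappa> j) x) \<longlonglongrightarrow> 0" using lim by (simp add: AE_completion_iff)
  have AE2: "AE z in lborel \<Otimes>\<^sub>M lborel. (\<lambda>j. increment (\<lambda>x. \<sigma> k x - \<sigma> (\<kappa> j) x) z) \<longlonglongrightarrow> increment (\<sigma> k) z" for k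
  proof -
    have [measurable]: "\<sigma> j \<in> borel_measurable borel" for j by (rule core_borel[OF in_X])
    \<comment> \<open>By Fubini, convergence at almost every point gives convergence at both entries
      of almost every pair.\<close>
    have "AE z in lborel \<Otimes>\<^sub>M lborel. (\<lambda>j. \<sigma> (\<kappa> j) (fst z)) \<longlonglongrightarrow> 0 \<and> (\<lambda>j. \<sigma> (\<kappa> j) (snd z)) \<longlonglongrightarrow> 0"
    proof (rule lborel_pair.AE_pair_measure)
      show "AE x in lborel. AE y in lborel. (\<lambda>j. \<sigma> (\<kappa> j) (fst (x, y))) \<longlonglongrightarrow> 0 \<and> (\<lambda>j. \<sigma> (\<kappa> j) (snd (x, y))) \<longlonglongrightarrow> 0"
        using lim' by eventually_elim (use lim' in auto)
    qed measurable
    then show ?thesis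
    proof eventually_elim
      case (elim z)
      then have "(\<lambda>j. (\<sigma> k (fst z) - \<sigma> (\<kappa> j) (fst z)) - (\<sigma> k (snd z) - \<sigma> (\<kappa> j) (snd z)))
        \<longlonglongrightarrow> (\<sigma> k (fst z) - 0) - (\<sigma> k (snd z) - 0)"
        by (intro tendsto_diff tendsto_const) auto
      then show ?case by (simp add: increment_def)
    qed
  qed
  show ?thesis
  proof (rule LIMSEQ_I)
    fix e :: real assume e: "0 < e"
    \<comment> \<open>Each of the two parts of N will be at most e / 3, so their sum stays strictly
      below e.\<close>
    then have "0 < e / 3" by simp
    then have "\<exists>m. \<forall>j\<ge>m. \<forall>k\<ge>m. N (\<lambda>x. \<sigma> j x - \<sigma> k x) < e / 3"
      using \<sigma> unfolding cauchy_seqs_def by blast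
    then obtain m where m: "\<And>j k. m \<le> j \<Longrightarrow> m \<le> k \<Longrightarrow> N (\<lambda>x. \<sigma> j x - \<sigma> k x) < e / 3"
      by blast
    have "norm (N (\<sigma> k) - 0) < e" if k: "m \<le> k" for k
    proof -
      have ev: "\<forall>\<^sub>F j in sequentially. N (\<lambda>x. \<sigma> k x - \<sigma> (\<kappa> j) x) \<le> e / 3"
        unfolding eventually_sequentially
      proof (intro exI[of _ m] allI impI)
        fix j assume "m \<le> j"
        then have "m \<le> \<kappa> j" using seq_suble[OF \<kappa>, of j] by simp
        then show "N (\<lambda>x. \<sigma> k x - \<sigma> (\<kappa> j) x) \<le> e / 3" using m[OF k] by (simp add: less_imp_le)
      qed
      have "Lp_integral lebesgue q V (\<sigma> k) \<le> ennreal ((e / 3) powr q)"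
      proof (rule Vw.Lp_integral_Fatou[OF _ AEk])
        show "\<forall>\<^sub>F j in sequentially. Lp_integral lebesgue q V (\<lambda>x. \<sigma> k x - \<sigma> (\<kappa> j) x) \<le> ennreal ((e / 3) powr q)"
          using ev by eventually_elim (rule core_bounds(1)[OF diff_X])
      qed (rule core_lebesgue[OF diff_X])
      then have 1: "Lp_norm lebesgue q V (\<sigma> k) \<le> e / 3" using e by (intro Vw.Lp_norm_le) auto
      have "Lp_integral (lborel \<Otimes>\<^sub>M lborel) p (gagliardo_weight s p) (increment (\<sigma> k)) \<le> ennreal ((e / 3) powr p)"
      proof (rule Gw.Lp_integral_Fatou[OF _ AE2])
        show "\<forall>\<^sub>F j in sequentially. Lp_integral (lborel \<Otimes>\<^sub>M lborel) p (gagliardo_weight s p)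
            (increment (\<lambda>x. \<sigma> k x - \<sigma> (\<kappa> j) x)) \<le> ennreal ((e / 3) powr p)"
          using ev by eventually_elim
            (use core_bounds(2)[OF diff_X] gagliardo_integral_eq[OF core_borel[OF diff_X]] in auto)
      qed (rule core_increment[OF diff_X])
      then have 2: "Lp_norm (lborel \<Otimes>\<^sub>M lborel) p (gagliardo_weight s p) (increment (\<sigma> k)) \<le> e / 3"
        using e by (intro Gw.Lp_norm_le) auto
      show ?thesis using 1 2 e norm_nonneg[of "\<sigma> k"] by (simp add: norm_eq[OF in_X])
    qed
    then show "\<exists>m. \<forall>k\<ge>m. norm (N (\<sigma> k) - 0) < e" by blast
  qed
qed

lemma compactly_embedded: "compactly_embedded X N r K"
proof -
  obtain C where C: "\<And>u. u \<in> X \<Longrightarrow> u \<in> weighted_Lp r K"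
    "\<And>u. u \<in> X \<Longrightarrow> weighted_norm r K u \<le> C * N u"
    using inclusion_bounded by blast
  interpret inclusion: closable_compact_inclusion X N r K C
  proof
    show "\<exists>\<kappa>::nat \<Rightarrow> nat. strict_mono \<kappa> \<and>
        (\<exists>w\<in>weighted_Lp r K. (\<lambda>j. weighted_norm r K (\<lambda>x. \<sigma> (\<kappa> j) x - w x)) \<longlonglongrightarrow> 0)"
      if "\<And>k. \<sigma> k \<in> X" "\<And>k. N (\<sigma> k) \<le> B" for \<sigma> :: "nat \<Rightarrow> real^'n \<Rightarrow> real" and B
      using compactness[of \<sigma> B, OF that] by (elim exE bexE conjE) (intro exI conjI bexI)
    show "(\<lambda>k. N (\<sigma> k)) \<longlonglongrightarrow> 0"
      if "\<sigma> \<in> cauchy_seqs X N" "\<And>k. N (\<sigma> k) \<le> B" "(\<lambda>k. weighted_norm r K (\<sigma> k)) \<longlonglongrightarrow> 0" for \<sigma> B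
      by (rule closability[OF that(1,3,2)])
  qed (use K_positive in \<open>simp_all add: Kw.q_ge_1 core_linear norm_nonneg norm_scale norm_triangle C\<close>)
  show ?thesis by (rule inclusion.compactly_embedded)
qed

end

theorem theorem4:
  fixes p s q r pstar \<tau> :: real and K V :: "real^'n \<Rightarrow> real"
  assumes "CARD('n) \<ge> 2"
    and "1 \<le> p" and "0 < s" and "s < 1" and "s * p < real CARD('n)"
    and "pstar = real CARD('n) * p / (real CARD('n) - s * p)"
    and "1 \<le> q" and "q \<le> r" and "r < pstar"
    and "K \<in> borel_measurable lebesgue" and "V \<in> borel_measurable lebesgue"
    and "\<forall>x. 0 < K x" and "\<forall>x. 0 < V x"
    and "\<forall>D. compact D \<and> D \<noteq> {} \<longrightarrow> 0 < (INF x\<in>D. V x)"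
    and "\<exists>t::ennreal. ennreal (pstar / (pstar - r)) < t \<and>
           (\<forall>\<Omega>\<in>sets lebesgue. emeasure lebesgue \<Omega> < \<infinity> \<longrightarrow> K \<in> Lp_on t \<Omega>)"
    and "\<tau> = (pstar - r) / (pstar - q)"
    and "vanishes_at_infinity (\<lambda>x. K x * V x powr (- \<tau>))"
  shows "compactly_embedded (MV_core s q p V) (MV_norm s q p V) r K"
proof -
  interpret fractional_weights p s q r pstar \<tau> K V
    by unfold_locales (fact assms)+
  show ?thesis by (rule compactly_embedded)
qed

end
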